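(* Let $n\ge 1$ and $k=\lceil \log_2(n+1)\rceil$. If the $(2k+1,n)$-MSDHS assumption and the SDA assumption both hold for the $(2k+1)$-multilinear map instance $\Gamma$ used in the scheme $\Pi_{\rm pe}$, then $\Pi_{\rm pe}$ is a verifiable computation scheme with input privacy for the evaluation of univariate polynomials of degree $n$; that is, $\Pi_{\rm pe}$ is correct, secure, achieves input privacy, and is outsourced.
   Context: **Multilinear maps.** $\lambda$ is the security parameter; PPT means probabilistic polynomial time; $\mathsf{neg}(\lambda)$ denotes a negligible function; $x\leftarrow A$ means $x$ is uniform in the finite set $A$; $[k]=\{1,\dots,k\}$. A group generator $\mathcal G(1^\lambda,\kappa)$ outputs $\Gamma_\kappa=(N,G_1,\dots,G_\kappa,e,g_1,\dots,g_\kappa)$ where $N=pq$ for two distinct $\lambda$-bit primes $p,q$ (not part of $\Gamma_\kappa$), each $G_i$ is a cyclic group of order $N$ generated by $g_i$, and for $i+j\le \kappa$ there is an efficiently computable map $e:G_i\times G_j\to G_{i+j}$ with $e(g_i^a,g_j^b)=g_{i+j}^{ab}$. For $i\le\kappa$ the induced map $e_i:G_1^i\to G_i$ satisfies $e_i(g_1^{a_1},\dots,g_1^{a_i})=g_i^{a_1\cdots a_i}$ ($e_1$ is the identity). **SDA (for $\Gamma_\kappa$).** For every $i\in[\kappa]$ and every PPT $\mathcal A$, $|\Pr[\mathcal A(\Gamma_\kappa,u)=1]-\Pr[\mathcal A(\Gamma_\kappa,u^q)=1]|<\mathsf{neg}(\lambda)$, over $\Gamma_\kappa\leftarrow\mathcal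 G(1^\lambda,\kappa)$, $u\leftarrow G_i$ and the coins of $\mathcal A$. **$(\kappa,n)$-MSDHS.** For every PPT $\mathcal A$, $\Pr[\mathcal A(p,q,\Gamma_\kappa,g_1,g_1^s,\dots,g_1^{s^n})=g_\kappa^{p/s}]<\mathsf{neg}(\lambda)$, over $\Gamma_\kappa\leftarrow\mathcal G(1^\lambda,\kappa)$, $s\leftarrow\mathbb Z_N$ and the coins of $\mathcal A$ ($1/s$ is the inverse of $s$ modulo $N$, which exists except with negligible probability). **The scheme $\Pi_{\rm pe}$.** The function is a polynomial $f(x)=f_0+f_1x+\cdots+f_nx^n\in\mathbb Z_q[x]$ and the inputs $\alpha$ lie in a domain $\mathbb D\subseteq\mathbb Z_q$ with $|\mathbb D|=\mathrm{poly}(\lambda)$. The results $f(\alpha)$ are required to lie in a set $\mathbb M$ with $|\mathbb M|=\mathrm{poly}(\lambda)$, so that the client can decrypt (decryption is a discrete logarithm computation). Elements of $\mathbb Z_q$ are used in exponents through integer representatives. - $\mathsf{KeyGen}(1^\lambda,f)$: pick $\Gamma\leftarrow\mathcal G(1^\lambda,2k+1)$, $s\leftarrow\mathbb Z_N$, $t=g_1^{f(s)}$, $u\leftarrow G_1$, $h=u^q$. Output $sk=(p,q,s,t)$ and $pk=(\Gamma,g_1,h,g_1^s,g_1^{s^2},g_1^{s^4},\dots,g_1^{s^{2^{k-1}}},f)$. - $\mathsf{ProbGen}(sk,\alpha)$: for $\ell\in[k]$ pick $r_\ell\leftarrow\mathbb Z_N$ and set $\sigma_\ell=g_1^{\alpha^{2^{\ell-1}}}h^{r_\ell}$.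 Output $\sigma=(\sigma_1,\dots,\sigma_k)$ and $\tau=\perp$. - $\mathsf{Compute}(pk,\sigma)$: for $0\le i\le n$ with binary digits $i=\sum_{\ell=1}^k i_\ell2^{\ell-1}$, let $\rho_i=e_k(\phi_1,\dots,\phi_k)\in G_k$ with $\phi_\ell=\sigma_\ell$ if $i_\ell=1$ and $\phi_\ell=g_1$ otherwise; $\rho=\prod_{i=0}^n\rho_i^{f_i}$. For $0\le j\le i\le n-1$, with binary digits $(j_\ell)$ of $j$ and $(d_\ell)$ of $i-j$, let $\pi_{ij}=e(e_k(\phi_1,\dots,\phi_k),e_k(\psi_1,\dots,\psi_k))\in G_{2k}$ with $\phi_\ell=\sigma_\ell$ if $j_\ell=1$, else $g_1$; $\psi_\ell=g_1^{s^{2^{\ell-1}}}$ if $d_\ell=1$, else $g_1$; $\pi=\prod_{i=0}^{n-1}\prod_{j=0}^i\pi_{ij}^{f_{i+1}}$. Output $(\rho,\pi)$. - $\mathsf{Verify}(sk,\tau,\rho,\pi)$ (run by the client, who knows $\alpha$): compute the $y\in\mathbb Z_q$ such that $\rho^p=(g_k^p)^y$. If $e(t/g_1^y,g_{2k}^p)=e(g_1^s/g_1^\alpha,\pi^p)$, output $y$; otherwise output $\perp$. **Properties of a VC scheme** $\Pi=(\mathsf{KeyGen},\mathsf{ProbGen},\mathsf{Compute},\mathsf{Verify})$ for a function family $\mathcal F$ (here: the polynomials $f$ above). - *Correct*: for any $f\in\mathcal F$, any $(pk,sk)\leftarrow\mathsf{KeyGen}(1^\lambda,f)$, any input $x$,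 any $(\sigma,\tau)\leftarrow\mathsf{ProbGen}(sk,x)$, any $(\rho,\pi)\leftarrow\mathsf{Compute}(pk,\sigma)$: $\mathsf{Verify}(sk,\tau,\rho,\pi)=f(x)$. - *Secure*: for any $f\in\mathcal F$ and any PPT $\mathcal A$, the following experiment outputs 1 with probability $<\mathsf{neg}(\lambda)$. $(pk,sk)\leftarrow\mathsf{KeyGen}(1^\lambda,f)$; for $i=1,\dots,l=\mathrm{poly}(\lambda)$: $x_i\leftarrow\mathcal A(pk,x_1,\sigma_1,\dots,x_{i-1},\sigma_{i-1})$, $(\sigma_i,\tau_i)\leftarrow\mathsf{ProbGen}(sk,x_i)$; then $\hat x\leftarrow\mathcal A(pk,x_1,\sigma_1,\dots,x_l,\sigma_l)$; $(\hat\sigma,\hat\tau)\leftarrow\mathsf{ProbGen}(sk,\hat x)$; $(\bar\rho,\bar\pi)\leftarrow\mathcal A(pk,x_1,\sigma_1,\dots,x_l,\sigma_l,\hat\sigma)$; $\bar y\leftarrow\mathsf{Verify}(sk,\hat\tau,\bar\rho,\bar\pi)$; output 1 iff $\bar y\notin\{f(\hat x),\perp\}$. - *Input privacy*: for any $f\in\mathcal F$ and any PPT $\mathcal A$, the following experiment outputs 1 with probability at most $\frac12+\mathsf{neg}(\lambda)$. $(pk,sk)\leftarrow\mathsf{KeyGen}(1^\lambda,f)$; $(x_0,x_1)\leftarrow\mathcal A^{O}(pk)$; $b\leftarrow\{0,1\}$; $(\sigma,\tau)\leftarrow\mathsf{ProbGen}(sk,x_b)$; $b'\leftarrow\mathcal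 A^{O}(pk,x_0,x_1,\sigma)$; output 1 iff $b'=b$. The oracle $O$ on input $x$ runs $(\sigma,\tau)\leftarrow\mathsf{ProbGen}(sk,x)$ and returns $\sigma$. - *Outsourced*: for any $f\in\mathcal F$ and any input $x$, the running time of $\mathsf{ProbGen}$ and $\mathsf{Verify}$ is $o(t)$, where $t$ is the time required to compute $f(x)$. Here costs are counted as functions of $n$ in unit operations (ring/group operations, exponentiations, map evaluations, one decryption, i.e. finding $y$ from $\rho$), and $t$ is of order $n$.
   Formalization: Verify rejects if no y in M decrypts ρ (any y in Z_q would allow forgeries); M can be listed from q in polynomial time; f is a sequence of integer polynomials efficiently computable from λ and independent of q (coefficients depending on q could reveal q). *)

theory Defs
  imports
    "HOL-Probability.Probability"
    "HOL-Algebra.Elementary_Groups"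
    "HOL-Algebra.FiniteProduct"
    "HOL-Computational_Algebra.Polynomial"
    "HOL-Computational_Algebra.Primes"
    "HOL-Number_Theory.Modular_Inverse"
    "HOL-Library.Log_Nat"
    "HOL-Library.Landau_Symbols"
begin

section \<open>Polynomial time\<close>

text \<open>
  Algorithms read and write finite binary trees with integer leaves; this type plays the role of
  the finite strings. The programs below form an untyped while-language. The cost of each step
  includes the number of bits of all data it touches, so that polynomial time in this model
  coincides with polynomial time on Turing machines.
\<close>

datatype data = Atom int | Node data data

primrec bits :: "data \<Rightarrow> nat" where
  "bits (Atom i) = 1 + floorlog 2 (nat \<bar>i\<bar>)"
| "bits (Node x y) = 1 + bits x + bits y"

fun left :: "data \<Rightarrow> data" where
  "left (Node x y) = x"
| "left (Atom i) = Atom 0"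

fun right :: "data \<Rightarrow> data" where
  "right (Node x y) = y"
| "right (Atom i) = Atom 0"

fun int_of :: "data \<Rightarrow> int" where
  "int_of (Atom i) = i"
| "int_of (Node x y) = 0"

datatype primitive =
    PId | PLeft | PRight | PAdd | PSub | PMul | PDiv | PMod | PLess | PEqual | PIsAtom

fun arith :: "(int \<Rightarrow> int \<Rightarrow> int) \<Rightarrow> data \<Rightarrow> data" where
  "arith f (Node (Atom a) (Atom b)) = Atom (f a b)"
| "arith f _ = Atom 0"

primrec apply_primitive :: "primitive \<Rightarrow> data \<Rightarrow> data" where
  "apply_primitive PId x = x"
| "apply_primitive PLeft x = left x"
| "apply_primitive PRight x = right x"
| "apply_primitive PAdd x = arith (+) x"
| "apply_primitive PSub x = arith (-) x"
| "apply_primitive PMul x = arith (*) x"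
| "apply_primitive PDiv x = arith (div) x"
| "apply_primitive PMod x = arith (mod) x"
| "apply_primitive PLess x = arith (\<lambda>a b. of_bool (a < b)) x"
| "apply_primitive PEqual x = Atom (of_bool (left x = right x))"
| "apply_primitive PIsAtom x = Atom (of_bool (\<exists>i. x = Atom i))"

datatype program =
    Prim primitive
  | Const data
  | Seq program program
  | Both program program
  | Cond program program program
  | While program program

text \<open>\<open>runs P x t y\<close>: on input \<open>x\<close>, the program \<open>P\<close> halts with output \<open>y\<close> at cost \<open>t\<close>.\<close>

inductive runs :: "program \<Rightarrow> data \<Rightarrow> nat \<Rightarrow> data \<Rightarrow> bool" where
  prim: "runs (Prim f) x (1 + bits x + bits (apply_primitive f x)) (apply_primitive f x)"
| const: "runs (Const d) x (1 + bits d) d"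
| seq: "runs P x t y \<Longrightarrow> runs Q y u z \<Longrightarrow> runs (Seq P Q) x (1 + t + u) z"
| both: "runs P x t y \<Longrightarrow> runs Q x u z \<Longrightarrow> runs (Both P Q) x (1 + bits x + t + u) (Node y z)"
| cond_true: "runs B x t v \<Longrightarrow> v \<noteq> Atom 0 \<Longrightarrow> runs P x u y \<Longrightarrow>
    runs (Cond B P Q) x (1 + bits x + t + u) y"
| cond_false: "runs B x t (Atom 0) \<Longrightarrow> runs Q x u y \<Longrightarrow>
    runs (Cond B P Q) x (1 + bits x + t + u) y"
| while_stop: "runs B x t (Atom 0) \<Longrightarrow> runs (While B P) x (1 + bits x + t) x"
| while_step: "runs B x t v \<Longrightarrow> v \<noteq> Atom 0 \<Longrightarrow> runs P x u y \<Longrightarrow> runs (While B P) y w z \<Longrightarrow>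
    runs (While B P) x (1 + bits x + t + u + w) z"

definition polytime :: "(data \<Rightarrow> data) \<Rightarrow> bool" where
  "polytime F \<longleftrightarrow> (\<exists>P. \<exists>T :: nat poly. \<forall>x. \<exists>t \<le> poly T (bits x). runs P x t (F x))"

definition lst :: "data list \<Rightarrow> data" where
  "lst xs = foldr Node xs (Atom 0)"

definition unary :: "nat \<Rightarrow> data" where
  "unary m = lst (replicate m (Atom 1))"

text \<open>
  A probabilistic polynomial-time algorithm is a deterministic polynomial-time one that is also
  given \<open>poly (coins A) \<eta>\<close> uniform random bits, read as one integer \<open>\<omega>\<close>, where \<open>\<eta>\<close> is the
  security parameter. In games that invoke \<open>A\<close> several times, all invocations see the same \<open>\<omega>\<close>
  and the whole transcript, so \<open>A\<close> can recompute its earlier internal state. \<open>calls A\<close> bounds the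
  number of oracle calls and matters only in games with an oracle.
\<close>

record alg =
  prog :: "data \<Rightarrow> data"
  coins :: "nat poly"
  calls :: "nat poly"

definition ppt :: "alg \<Rightarrow> bool" where
  "ppt A \<longleftrightarrow> polytime (prog A)"

definition toss :: "alg \<Rightarrow> nat \<Rightarrow> int pmf" where
  "toss A \<eta> = pmf_of_set {0..<2 ^ poly (coins A) \<eta>}"

definition answer :: "alg \<Rightarrow> nat \<Rightarrow> int \<Rightarrow> data \<Rightarrow> data" where
  "answer A \<eta> \<omega> x = prog A (lst [unary \<eta>, Atom \<omega>, x])"

definition negligible :: "(nat \<Rightarrow> real) \<Rightarrow> bool" where
  "negligible \<nu> \<longleftrightarrow> (\<forall>c :: nat. eventually (\<lambda>\<eta>. \<bar>\<nu> \<eta>\<bar> < 1 / real \<eta> ^ c) at_top)"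


section \<open>Multilinear maps\<close>

text \<open>
  \<open>descr\<close> is the string through which an algorithm learns the groups and the map. Group elements
  are themselves strings. The index of \<open>grp\<close> and \<open>gen\<close> ranges over \<open>{1..levels}\<close>, and
  \<open>pairing \<Gamma> i j\<close> is the map from levels \<open>i\<close> and \<open>j\<close> to level \<open>i + j\<close>.
\<close>

record mlm =
  levels :: nat
  modulus :: nat
  grp :: "nat \<Rightarrow> data monoid"
  pairing :: "nat \<Rightarrow> nat \<Rightarrow> data \<Rightarrow> data \<Rightarrow> data"
  gen :: "nat \<Rightarrow> data"
  descr :: data

definition enc_mlm :: "mlm \<Rightarrow> data" where
  "enc_mlm \<Gamma> = lst [Atom (int (modulus \<Gamma>)), descr \<Gamma>, lst (map (gen \<Gamma>) [1..<Suc (levels \<Gamma>)])]"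

definition is_mlm :: "nat \<Rightarrow> mlm \<Rightarrow> bool" where
  "is_mlm \<kappa> \<Gamma> \<longleftrightarrow> levels \<Gamma> = \<kappa> \<and>
     (\<forall>i\<in>{1..\<kappa>}. group (grp \<Gamma> i) \<and> order (grp \<Gamma> i) = modulus \<Gamma> \<and>
        gen \<Gamma> i \<in> carrier (grp \<Gamma> i) \<and> generate (grp \<Gamma> i) {gen \<Gamma> i} = carrier (grp \<Gamma> i)) \<and>
     (\<forall>i\<in>{1..\<kappa>}. \<forall>j\<in>{1..\<kappa>}. i + j \<le> \<kappa> \<longrightarrow> (\<forall>a b :: nat.
        pairing \<Gamma> i j (gen \<Gamma> i [^]\<^bsub>grp \<Gamma> i\<^esub> a) (gen \<Gamma> j [^]\<^bsub>grp \<Gamma> j\<^esub> b)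
          = gen \<Gamma> (i + j) [^]\<^bsub>grp \<Gamma> (i + j)\<^esub> (a * b)))"

text \<open>
  \<open>induced_map \<Gamma> i \<phi>\<close> is \<open>e_i(\<phi> 1, \<dots>, \<phi> i)\<close>.
\<close>

fun induced_map :: "mlm \<Rightarrow> nat \<Rightarrow> (nat \<Rightarrow> data) \<Rightarrow> data" where
  "induced_map \<Gamma> (Suc 0) \<phi> = \<phi> 1"
| "induced_map \<Gamma> (Suc (Suc i)) \<phi> =
     pairing \<Gamma> (Suc i) 1 (induced_map \<Gamma> (Suc i) \<phi>) (\<phi> (Suc (Suc i)))"

text \<open>
  A generator returns the two primes next to \<open>\<Gamma>\<close>. Two distinct primes with exactly \<open>\<eta>\<close> bits exist
  only for \<open>\<eta> \<ge> 2\<close>, so this and all later conditions on individual security parameters are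
  restricted to \<open>\<eta> \<ge> 2\<close>. \<open>floorlog 2 p\<close> is the number of binary digits of \<open>p\<close>.
\<close>

text \<open>
  Besides the evaluation of the map, efficiency covers the group operation and short
  representations of the group elements. Inverses are powers with exponent \<open>N - 1\<close>.
\<close>

type_synonym generator = "nat \<Rightarrow> nat \<Rightarrow> (nat \<times> nat \<times> mlm) pmf"

definition efficient_generator :: "generator \<Rightarrow> nat \<Rightarrow> bool" where
  "efficient_generator \<G> \<kappa> \<longleftrightarrow> (\<exists>mul e. \<exists>B :: nat poly. polytime mul \<and> polytime e \<and>
     (\<forall>\<eta>\<ge>2. \<forall>(p, q, \<Gamma>)\<in>set_pmf (\<G> \<eta> \<kappa>).
        bits (descr \<Gamma>) \<le> poly B \<eta> \<and>
        (\<forall>i\<in>{1..\<kappa>}. \<forall>x\<in>carrier (grp \<Gamma> i). bits x \<le> poly B \<eta> \<and>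
          (\<forall>y\<in>carrier (grp \<Gamma> i).
             mul (lst [enc_mlm \<Gamma>, Atom (int i), x, y]) = x \<otimes>\<^bsub>grp \<Gamma> i\<^esub> y) \<and>
          (\<forall>j\<in>{1..\<kappa>}. i + j \<le> \<kappa> \<longrightarrow> (\<forall>y\<in>carrier (grp \<Gamma> j).
             e (lst [enc_mlm \<Gamma>, Atom (int i), Atom (int j), x, y]) = pairing \<Gamma> i j x y)))))"

definition multilinear_generator :: "generator \<Rightarrow> nat \<Rightarrow> bool" where
  "multilinear_generator \<G> \<kappa> \<longleftrightarrow>
     (\<forall>\<eta>\<ge>2. \<forall>(p, q, \<Gamma>)\<in>set_pmf (\<G> \<eta> \<kappa>).
        prime p \<and> prime q \<and> p \<noteq> q \<and> floorlog 2 p = \<eta> \<and> floorlog 2 q = \<eta> \<and>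
        modulus \<Gamma> = p * q \<and> is_mlm \<kappa> \<Gamma>) \<and>
     efficient_generator \<G> \<kappa>"

definition SDA_game :: "generator \<Rightarrow> nat \<Rightarrow> nat \<Rightarrow> bool \<Rightarrow> alg \<Rightarrow> nat \<Rightarrow> bool pmf" where
  "SDA_game \<G> \<kappa> i in_subgroup A \<eta> = do {
     (p, q, \<Gamma>) \<leftarrow> \<G> \<eta> \<kappa>;
     u \<leftarrow> pmf_of_set (carrier (grp \<Gamma> i));
     \<omega> \<leftarrow> toss A \<eta>;
     let v = (if in_subgroup then u [^]\<^bsub>grp \<Gamma> i\<^esub> q else u);
     return_pmf (answer A \<eta> \<omega> (lst [enc_mlm \<Gamma>, v]) = Atom 1)
   }"

definition SDA :: "generator \<Rightarrow> nat \<Rightarrow> bool" where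
  "SDA \<G> \<kappa> \<longleftrightarrow> (\<forall>i\<in>{1..\<kappa>}. \<forall>A. ppt A \<longrightarrow>
     negligible (\<lambda>\<eta>. \<bar>pmf (SDA_game \<G> \<kappa> i False A \<eta>) True - pmf (SDA_game \<G> \<kappa> i True A \<eta>) True\<bar>))"

text \<open>The adversary cannot win when \<open>s\<close> has no inverse modulo \<open>N\<close>.\<close>

definition MSDHS_game :: "generator \<Rightarrow> nat \<Rightarrow> nat \<Rightarrow> alg \<Rightarrow> nat \<Rightarrow> bool pmf" where
  "MSDHS_game \<G> \<kappa> n A \<eta> = do {
     (p, q, \<Gamma>) \<leftarrow> \<G> \<eta> \<kappa>;
     s \<leftarrow> pmf_of_set {0..<modulus \<Gamma>};
     \<omega> \<leftarrow> toss A \<eta>;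
     let powers = map (\<lambda>i. gen \<Gamma> 1 [^]\<^bsub>grp \<Gamma> 1\<^esub> (s ^ i)) [0..<Suc n];
     let z = answer A \<eta> \<omega> (lst [Atom (int p), Atom (int q), enc_mlm \<Gamma>, lst powers]);
     return_pmf (coprime (modulus \<Gamma>) s \<and>
       z = gen \<Gamma> \<kappa> [^]\<^bsub>grp \<Gamma> \<kappa>\<^esub> (int p * modular_inverse (int (modulus \<Gamma>)) (int s)))
   }"

definition MSDHS :: "generator \<Rightarrow> nat \<Rightarrow> nat \<Rightarrow> bool" where
  "MSDHS \<G> \<kappa> n \<longleftrightarrow> (\<forall>A. ppt A \<longrightarrow> negligible (\<lambda>\<eta>. pmf (MSDHS_game \<G> \<kappa> n A \<eta>) True))"


section \<open>Counting unit operations\<close>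

text \<open>A randomized computation whose result is paired with the number of unit operations spent.\<close>

datatype 'a costed = Costed (run_costed: "('a \<times> nat) pmf")

definition bind_costed :: "'a costed \<Rightarrow> ('a \<Rightarrow> 'b costed) \<Rightarrow> 'b costed" where
  "bind_costed m g = Costed (do {
     (x, c) \<leftarrow> run_costed m;
     (y, d) \<leftarrow> run_costed (g x);
     return_pmf (y, c + d)
   })"

adhoc_overloading Monad_Syntax.bind \<rightleftharpoons> bind_costed

definition result :: "'a \<Rightarrow> 'a costed" where
  "result x = Costed (return_pmf (x, 0))"

definition unit_op :: "'a \<Rightarrow> 'a costed" where
  "unit_op x = Costed (return_pmf (x, 1))"

definition sample :: "'a set \<Rightarrow> 'a costed" where
  "sample S = Costed (map_pmf (\<lambda>x. (x, 1)) (pmf_of_set S))"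

definition outcome :: "'a costed \<Rightarrow> 'a pmf" where
  "outcome m = map_pmf fst (run_costed m)"

definition costs :: "'a costed \<Rightarrow> nat set" where
  "costs m = snd ` set_pmf (run_costed m)"

definition mult_op :: "data monoid \<Rightarrow> data \<Rightarrow> data \<Rightarrow> data costed" where
  "mult_op G x y = unit_op (x \<otimes>\<^bsub>G\<^esub> y)"

definition div_op :: "data monoid \<Rightarrow> data \<Rightarrow> data \<Rightarrow> data costed" where
  "div_op G x y = unit_op (x \<otimes>\<^bsub>G\<^esub> inv\<^bsub>G\<^esub> y)"

definition pow_op :: "data monoid \<Rightarrow> data \<Rightarrow> int \<Rightarrow> data costed" where
  "pow_op G x a = unit_op (x [^]\<^bsub>G\<^esub> a)"

definition map_op :: "mlm \<Rightarrow> nat \<Rightarrow> nat \<Rightarrow> data \<Rightarrow> data \<Rightarrow> data costed" where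
  "map_op \<Gamma> i j x y = unit_op (pairing \<Gamma> i j x y)"

definition add_mod_op :: "int \<Rightarrow> int \<Rightarrow> int \<Rightarrow> int costed" where
  "add_mod_op m a b = unit_op ((a + b) mod m)"

definition mult_mod_op :: "int \<Rightarrow> int \<Rightarrow> int \<Rightarrow> int costed" where
  "mult_mod_op m a b = unit_op ((a * b) mod m)"


section \<open>Verifiable computation schemes\<close>

text \<open>
  Inputs and results are integers. The function family may depend on the security parameter: a
  member of the family is a sequence \<open>f\<close> whose entry \<open>f \<eta>\<close> is handed to \<open>keygen \<S> \<eta>\<close>. The
  domain \<open>inputs\<close> and the value \<open>func\<close> of the outsourced function depend on the secret key
  because they live in \<open>\<int>\<^sub>q\<close>. \<open>probgen\<close> and \<open>verify\<close> are run by the client, who knows \<open>pk\<close>, \<open>sk\<close>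
  and the input. \<open>direct\<close> is the computation of the function without outsourcing.
\<close>

record ('f, 'pk, 'sk, 'sig, 'tau, 'prf) vc_scheme =
  keygen :: "nat \<Rightarrow> 'f \<Rightarrow> ('pk \<times> 'sk) pmf"
  probgen :: "'pk \<Rightarrow> 'sk \<Rightarrow> int \<Rightarrow> ('sig \<times> 'tau) costed"
  compute :: "'pk \<Rightarrow> 'sig \<Rightarrow> 'prf pmf"
  verify :: "'pk \<Rightarrow> 'sk \<Rightarrow> int \<Rightarrow> 'tau \<Rightarrow> 'prf \<Rightarrow> int option costed"
  inputs :: "'sk \<Rightarrow> int set"
  func :: "'sk \<Rightarrow> 'f \<Rightarrow> int \<Rightarrow> int"
  direct :: "'sk \<Rightarrow> 'f \<Rightarrow> int \<Rightarrow> int costed"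
  enc_pk :: "'pk \<Rightarrow> data"
  enc_sig :: "'sig \<Rightarrow> data"
  dec_prf :: "data \<Rightarrow> 'prf"

definition correct ::
    "('f, 'pk, 'sk, 'sig, 'tau, 'prf) vc_scheme \<Rightarrow> (nat \<Rightarrow> 'f) set \<Rightarrow> bool" where
  "correct \<S> F \<longleftrightarrow> (\<forall>f\<in>F. \<forall>\<eta>\<ge>2. \<forall>(pk, sk)\<in>set_pmf (keygen \<S> \<eta> (f \<eta>)). \<forall>x\<in>inputs \<S> sk.
     \<forall>(\<sigma>, \<tau>)\<in>set_pmf (outcome (probgen \<S> pk sk x)). \<forall>\<rho>\<pi>\<in>set_pmf (compute \<S> pk \<sigma>).
     \<forall>y\<in>set_pmf (outcome (verify \<S> pk sk x \<tau> \<rho>\<pi>)). y = Some (func \<S> sk (f \<eta>) x))"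

definition enc_transcript ::
    "('f, 'pk, 'sk, 'sig, 'tau, 'prf) vc_scheme \<Rightarrow> (int \<times> 'sig) list \<Rightarrow> data" where
  "enc_transcript \<S> h = lst (map (\<lambda>(x, \<sigma>). Node (Atom x) (enc_sig \<S> \<sigma>)) h)"

primrec query_phase ::
    "('f, 'pk, 'sk, 'sig, 'tau, 'prf) vc_scheme \<Rightarrow> alg \<Rightarrow> nat \<Rightarrow> int \<Rightarrow> 'pk \<Rightarrow> 'sk \<Rightarrow> nat \<Rightarrow>
     (int \<times> 'sig) list pmf" where
  "query_phase \<S> A \<eta> \<omega> pk sk 0 = return_pmf []"
| "query_phase \<S> A \<eta> \<omega> pk sk (Suc i) = do {
     h \<leftarrow> query_phase \<S> A \<eta> \<omega> pk sk i;
     let x = int_of (answer A \<eta> \<omega> (lst [enc_pk \<S> pk, enc_transcript \<S> h]));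
     (\<sigma>, \<tau>) \<leftarrow> outcome (probgen \<S> pk sk x);
     return_pmf (h @ [(x, \<sigma>)])
   }"

text \<open>
  The experiments return a pair: whether all inputs the adversary chose belong to the domain, and
  the outcome of the experiment. Only adversaries that choose inputs from the domain are
  considered, i.e. those for which the first component is always true.
\<close>

definition stays_in_domain :: "(nat \<Rightarrow> (bool \<times> bool) pmf) \<Rightarrow> bool" where
  "stays_in_domain E \<longleftrightarrow> (\<forall>\<eta>\<ge>2. \<forall>r\<in>set_pmf (E \<eta>). fst r)"

definition success :: "(nat \<Rightarrow> (bool \<times> bool) pmf) \<Rightarrow> nat \<Rightarrow> real" where
  "success E \<eta> = pmf (map_pmf snd (E \<eta>)) True"

definition security_game ::
    "('f, 'pk, 'sk, 'sig, 'tau, 'prf) vc_scheme \<Rightarrow> (nat \<Rightarrow> 'f) \<Rightarrow> alg \<Rightarrow> nat poly \<Rightarrow> nat \<Rightarrow>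
     (bool \<times> bool) pmf" where
  "security_game \<S> f A l \<eta> = do {
     (pk, sk) \<leftarrow> keygen \<S> \<eta> (f \<eta>);
     \<omega> \<leftarrow> toss A \<eta>;
     h \<leftarrow> query_phase \<S> A \<eta> \<omega> pk sk (poly l \<eta>);
     let x = int_of (answer A \<eta> \<omega> (lst [enc_pk \<S> pk, enc_transcript \<S> h]));
     (\<sigma>, \<tau>) \<leftarrow> outcome (probgen \<S> pk sk x);
     let \<rho>\<pi> = dec_prf \<S> (answer A \<eta> \<omega> (lst [enc_pk \<S> pk, enc_transcript \<S> h, enc_sig \<S> \<sigma>]));
     y \<leftarrow> outcome (verify \<S> pk sk x \<tau> \<rho>\<pi>);
     return_pmf (insert x (fst ` set h) \<subseteq> inputs \<S> sk, y \<notin> {Some (func \<S> sk (f \<eta>) x), None})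
   }"

definition secure ::
    "('f, 'pk, 'sk, 'sig, 'tau, 'prf) vc_scheme \<Rightarrow> (nat \<Rightarrow> 'f) set \<Rightarrow> bool" where
  "secure \<S> F \<longleftrightarrow> (\<forall>f\<in>F. \<forall>A l. ppt A \<and> stays_in_domain (security_game \<S> f A l) \<longrightarrow>
     negligible (success (security_game \<S> f A l)))"

text \<open>
  With access to an oracle, an algorithm produces, from the oracle transcript so far, either the
  message \<open>Node (Atom 1) x\<close>, which asks the oracle for \<open>x\<close>, or another message, whose right
  component is the final output. The first argument of \<open>oracle_run\<close> is the number of calls left; an
  algorithm that asks for more is cut off.
\<close>

definition asks :: "data \<Rightarrow> bool" where
  "asks d \<longleftrightarrow> left d = Atom 1"

primrec oracle_run ::
    "nat \<Rightarrow> ((int \<times> 'sig) list \<Rightarrow> data) \<Rightarrow> (int \<Rightarrow> 'sig pmf) \<Rightarrow> (int \<times> 'sig) list \<Rightarrow>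
     (data \<times> (int \<times> 'sig) list) pmf" where
  "oracle_run 0 next_msg orac h =
     return_pmf (if asks (next_msg h) then Atom 0 else right (next_msg h), h)"
| "oracle_run (Suc m) next_msg orac h =
     (if asks (next_msg h) then do {
        let x = int_of (right (next_msg h));
        \<sigma> \<leftarrow> orac x;
        oracle_run m next_msg orac (h @ [(x, \<sigma>)])
      }
      else return_pmf (right (next_msg h), h))"

definition privacy_game ::
    "('f, 'pk, 'sk, 'sig, 'tau, 'prf) vc_scheme \<Rightarrow> (nat \<Rightarrow> 'f) \<Rightarrow> alg \<Rightarrow> nat \<Rightarrow>
     (bool \<times> bool) pmf" where
  "privacy_game \<S> f A \<eta> = do {
     (pk, sk) \<leftarrow> keygen \<S> \<eta> (f \<eta>);
     \<omega> \<leftarrow> toss A \<eta>;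
     let orac = (\<lambda>x. map_pmf fst (outcome (probgen \<S> pk sk x)));
     (d, h) \<leftarrow> oracle_run (poly (calls A) \<eta>)
       (\<lambda>h. answer A \<eta> \<omega> (lst [enc_pk \<S> pk, enc_transcript \<S> h])) orac [];
     let x0 = int_of (left d);
     let x1 = int_of (right d);
     b \<leftarrow> pmf_of_set (UNIV :: bool set);
     (\<sigma>, \<tau>) \<leftarrow> outcome (probgen \<S> pk sk (if b then x1 else x0));
     (b', h') \<leftarrow> oracle_run (poly (calls A) \<eta>)
       (\<lambda>h'. answer A \<eta> \<omega> (lst [enc_pk \<S> pk, enc_transcript \<S> h, Atom x0, Atom x1, enc_sig \<S> \<sigma>,
          enc_transcript \<S> h'])) orac [];
     return_pmf ({x0, x1} \<union> fst ` set (h @ h') \<subseteq> inputs \<S> sk, b' = Atom (of_bool b))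
   }"

definition input_private ::
    "('f, 'pk, 'sk, 'sig, 'tau, 'prf) vc_scheme \<Rightarrow> (nat \<Rightarrow> 'f) set \<Rightarrow> bool" where
  "input_private \<S> F \<longleftrightarrow> (\<forall>f\<in>F. \<forall>A. ppt A \<and> stays_in_domain (privacy_game \<S> f A) \<longrightarrow>
     (\<exists>\<nu>. negligible \<nu> \<and> (\<forall>\<eta>. success (privacy_game \<S> f A) \<eta> \<le> 1 / 2 + \<nu> \<eta>)))"

text \<open>
  The running times are compared as functions of \<open>n\<close>, hence the schemes and the function families
  are given for all \<open>n\<close>. \<open>t\<close> is the time of the direct computation, which is of order \<open>n\<close>.
\<close>

definition outsourced ::
    "(nat \<Rightarrow> ('f, 'pk, 'sk, 'sig, 'tau, 'prf) vc_scheme) \<Rightarrow> (nat \<Rightarrow> (nat \<Rightarrow> 'f) set) \<Rightarrow> bool" where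
  "outsourced \<S> F \<longleftrightarrow> (\<exists>T t :: nat \<Rightarrow> real. T \<in> o(t) \<and> t \<in> \<Theta>(\<lambda>n. real n) \<and>
     (\<forall>n\<ge>1. \<forall>f\<in>F n. \<forall>\<eta>\<ge>2. \<forall>(pk, sk)\<in>set_pmf (keygen (\<S> n) \<eta> (f \<eta>)). \<forall>x\<in>inputs (\<S> n) sk.
        (\<forall>c\<in>costs (probgen (\<S> n) pk sk x). real c \<le> T n) \<and>
        (\<forall>\<tau> \<rho>\<pi>. \<forall>c\<in>costs (verify (\<S> n) pk sk x \<tau> \<rho>\<pi>). real c \<le> T n) \<and>
        (\<forall>c\<in>costs (direct (\<S> n) sk (f \<eta>) x). real c = t n)))"


section \<open>The scheme for polynomial evaluation\<close>

text \<open>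
  Elements of \<open>\<int>\<^sub>q\<close> are represented by \<open>{0..<q}\<close>. The domain \<open>D q\<close> and the set \<open>M q\<close> of admitted
  results are subsets of \<open>\<int>\<^sub>q\<close> of size polynomial in the number of digits of \<open>q\<close>. For the client to
  be able to decrypt, which amounts to a search through \<open>M q\<close>, the set \<open>M q\<close> has to be listed
  in polynomial time.
\<close>

definition small_subsets :: "(nat \<Rightarrow> int set) \<Rightarrow> bool" where
  "small_subsets S \<longleftrightarrow> (\<exists>B :: nat poly. \<forall>q. prime q \<longrightarrow>
     S q \<subseteq> {0..<int q} \<and> card (S q) \<le> poly B (floorlog 2 q))"

definition listable :: "(nat \<Rightarrow> int set) \<Rightarrow> bool" where
  "listable S \<longleftrightarrow> (\<exists>F. polytime F \<and>
     (\<forall>q. prime q \<longrightarrow> (\<exists>ys. set ys = S q \<and> F (Atom (int q)) = lst (map Atom ys))))"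

text \<open>
  The polynomials: integer representatives of the coefficients are published in the public key
  and are input to the key generation before \<open>q\<close> is chosen, so they may depend on the security
  parameter (efficiently), but not on \<open>q\<close>. The last condition says that the results lie in \<open>M q\<close>.
\<close>

definition pe_family ::
    "generator \<Rightarrow> (nat \<Rightarrow> int set) \<Rightarrow> (nat \<Rightarrow> int set) \<Rightarrow> nat \<Rightarrow> (nat \<Rightarrow> int poly) set" where
  "pe_family \<G> D M n = {f.
     (\<forall>\<eta>. degree (f \<eta>) \<le> n) \<and>
     (\<exists>F. polytime F \<and> (\<forall>\<eta>. F (unary \<eta>) = lst (map Atom (coeffs (f \<eta>))))) \<and>
     (\<forall>\<eta>\<ge>2. \<forall>(p, q, \<Gamma>)\<in>set_pmf (\<G> \<eta> (2 * ceillog2 (n + 1) + 1)). \<forall>\<alpha>\<in>D q.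
        poly (f \<eta>) \<alpha> mod int q \<in> M q)}"

text \<open>
  In the public key, \<open>pk_s\<close> is the list of the \<open>k\<close> elements with exponents \<open>s^(2^0), \<dots>, s^(2^(k-1))\<close>.
\<close>

record pe_pk =
  pk_inst :: mlm
  pk_g :: data
  pk_h :: data
  pk_s :: "data list"
  pk_f :: "int poly"

record pe_sk =
  sk_p :: nat
  sk_q :: nat
  sk_s :: nat
  sk_t :: data

definition pe_enc_pk :: "pe_pk \<Rightarrow> data" where
  "pe_enc_pk pk = lst [enc_mlm (pk_inst pk), pk_g pk, pk_h pk, lst (pk_s pk),
     lst (map Atom (coeffs (pk_f pk)))]"

definition pe_keygen :: "generator \<Rightarrow> nat \<Rightarrow> nat \<Rightarrow> int poly \<Rightarrow> (pe_pk \<times> pe_sk) pmf" where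
  "pe_keygen \<G> k \<eta> f = do {
     (p, q, \<Gamma>) \<leftarrow> \<G> \<eta> (2 * k + 1);
     let G1 = grp \<Gamma> 1;
     let g1 = gen \<Gamma> 1;
     s \<leftarrow> pmf_of_set {0..<modulus \<Gamma>};
     u \<leftarrow> pmf_of_set (carrier G1);
     return_pmf
       (\<lparr>pk_inst = \<Gamma>, pk_g = g1, pk_h = u [^]\<^bsub>G1\<^esub> q,
         pk_s = map (\<lambda>i. g1 [^]\<^bsub>G1\<^esub> (s ^ (2 ^ i))) [0..<k], pk_f = f\<rparr>,
        \<lparr>sk_p = p, sk_q = q, sk_s = s, sk_t = g1 [^]\<^bsub>G1\<^esub> poly f (int s)\<rparr>)
   }"

text \<open>
  \<open>pe_encode pk m a\<close> encodes \<open>a, a^2, a^4, \<dots>\<close> (\<open>m\<close> elements). The successive squares are taken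
  in \<open>\<int>\<^sub>N\<close>, which does not change the powers of \<open>g\<^sub>1\<close>.
\<close>

primrec pe_encode :: "pe_pk \<Rightarrow> nat \<Rightarrow> int \<Rightarrow> data list costed" where
  "pe_encode pk 0 a = result []"
| "pe_encode pk (Suc m) a = do {
     let N = modulus (pk_inst pk);
     let G1 = grp (pk_inst pk) 1;
     r \<leftarrow> sample {0..<N};
     v \<leftarrow> pow_op G1 (pk_g pk) a;
     w \<leftarrow> pow_op G1 (pk_h pk) (int r);
     \<sigma> \<leftarrow> mult_op G1 v w;
     a' \<leftarrow> mult_mod_op (int N) a a;
     \<sigma>s \<leftarrow> pe_encode pk m a';
     result (\<sigma> # \<sigma>s)
   }"

definition pe_probgen :: "nat \<Rightarrow> pe_pk \<Rightarrow> pe_sk \<Rightarrow> int \<Rightarrow> (data list \<times> unit) costed" where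
  "pe_probgen k pk sk \<alpha> = do {
     \<sigma> \<leftarrow> pe_encode pk k \<alpha>;
     result (\<sigma>, ())
   }"

text \<open>
  \<open>select g xs i\<close> is the family with value \<open>\<xi>\<^sub>l\<close> (counted from 1) if the \<open>l\<close>-th binary digit of
  \<open>i\<close> is 1, and with value \<open>g\<close> otherwise.
\<close>

definition select :: "data \<Rightarrow> data list \<Rightarrow> nat \<Rightarrow> nat \<Rightarrow> data" where
  "select g xs i l = (if bit i (l - 1) then xs ! (l - 1) else g)"

definition pe_compute :: "nat \<Rightarrow> nat \<Rightarrow> pe_pk \<Rightarrow> data list \<Rightarrow> data \<times> data" where
  "pe_compute n k pk \<sigma> =
    (let \<Gamma> = pk_inst pk;
         g = pk_g pk;
         f = pk_f pk;
         \<rho>i = (\<lambda>i. induced_map \<Gamma> k (select g \<sigma> i));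
         \<pi>ij = (\<lambda>i j. pairing \<Gamma> k k (induced_map \<Gamma> k (select g \<sigma> j))
                                      (induced_map \<Gamma> k (select g (pk_s pk) (i - j))));
         \<rho> = finprod (grp \<Gamma> k) (\<lambda>i. \<rho>i i [^]\<^bsub>grp \<Gamma> k\<^esub> coeff f i) {0..n};
         \<pi> = finprod (grp \<Gamma> (2 * k)) (\<lambda>i. finprod (grp \<Gamma> (2 * k))
               (\<lambda>j. \<pi>ij i j [^]\<^bsub>grp \<Gamma> (2 * k)\<^esub> coeff f (i + 1)) {0..i}) {0..n - 1}
     in (\<rho>, \<pi>))"

text \<open>
  Decryption yields \<open>None\<close> if no admitted result fits; \<open>verify\<close> rejects in this case,
  and it rejects a pair that does not lie in \<open>G\<^sub>k \<times> G\<^sub>2\<^sub>k\<close>.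
\<close>

definition decrypt_op :: "data monoid \<Rightarrow> int set \<Rightarrow> data \<Rightarrow> data \<Rightarrow> int option costed" where
  "decrypt_op G Y b a = unit_op
     (if \<exists>y\<in>Y. a = b [^]\<^bsub>G\<^esub> y then Some (SOME y. y \<in> Y \<and> a = b [^]\<^bsub>G\<^esub> y) else None)"

definition pe_verify ::
    "(nat \<Rightarrow> int set) \<Rightarrow> nat \<Rightarrow> pe_pk \<Rightarrow> pe_sk \<Rightarrow> int \<Rightarrow> unit \<Rightarrow> data \<times> data \<Rightarrow> int option costed" where
  "pe_verify M k pk sk \<alpha> \<tau> = (\<lambda>(\<rho>, \<pi>).
    let \<Gamma> = pk_inst pk; G = grp \<Gamma>; g1 = pk_g pk; p = int (sk_p sk) in do {
      member_\<rho> \<leftarrow> unit_op (\<rho> \<in> carrier (G k));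
      member_\<pi> \<leftarrow> unit_op (\<pi> \<in> carrier (G (2 * k)));
      if \<not> (member_\<rho> \<and> member_\<pi>) then result None else do {
        \<rho>p \<leftarrow> pow_op (G k) \<rho> p;
        gp \<leftarrow> pow_op (G k) (gen \<Gamma> k) p;
        dec \<leftarrow> decrypt_op (G k) (M (sk_q sk)) gp \<rho>p;
        case dec of
          None \<Rightarrow> result None
        | Some y \<Rightarrow> do {
            g1y \<leftarrow> pow_op (G 1) g1 y;
            quot_y \<leftarrow> div_op (G 1) (sk_t sk) g1y;
            g2kp \<leftarrow> pow_op (G (2 * k)) (gen \<Gamma> (2 * k)) p;
            lhs \<leftarrow> map_op \<Gamma> 1 (2 * k) quot_y g2kp;
            g1s \<leftarrow> pow_op (G 1) g1 (int (sk_s sk));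
            g1\<alpha> \<leftarrow> pow_op (G 1) g1 \<alpha>;
            quot_\<alpha> \<leftarrow> div_op (G 1) g1s g1\<alpha>;
            \<pi>p \<leftarrow> pow_op (G (2 * k)) \<pi> p;
            rhs \<leftarrow> map_op \<Gamma> 1 (2 * k) quot_\<alpha> \<pi>p;
            equal \<leftarrow> unit_op (lhs = rhs);
            result (if equal then Some y else None)
          }
      }
    })"

text \<open>Horner's rule: after \<open>m\<close> rounds from the start value \<open>coeff f n\<close>, with \<open>m \<le> n\<close>.\<close>

primrec horner :: "int \<Rightarrow> int poly \<Rightarrow> int \<Rightarrow> nat \<Rightarrow> nat \<Rightarrow> int costed" where
  "horner q f x n 0 = result (coeff f n mod q)"
| "horner q f x n (Suc m) = do {
     v \<leftarrow> horner q f x n m;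
     w \<leftarrow> mult_mod_op q v x;
     add_mod_op q w (coeff f (n - Suc m))
   }"

definition pe_scheme :: "generator \<Rightarrow> (nat \<Rightarrow> int set) \<Rightarrow> (nat \<Rightarrow> int set) \<Rightarrow> nat \<Rightarrow>
    (int poly, pe_pk, pe_sk, data list, unit, data \<times> data) vc_scheme" where
  "pe_scheme \<G> D M n = (let k = ceillog2 (n + 1) in
     \<lparr>keygen = pe_keygen \<G> k,
      probgen = pe_probgen k,
      compute = (\<lambda>pk \<sigma>. return_pmf (pe_compute n k pk \<sigma>)),
      verify = pe_verify M k,
      inputs = (\<lambda>sk. D (sk_q sk)),
      func = (\<lambda>sk f \<alpha>. poly f \<alpha> mod int (sk_q sk)),
      direct = (\<lambda>sk f \<alpha>. horner (int (sk_q sk)) f \<alpha> n n),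
      enc_pk = pe_enc_pk,
      enc_sig = lst,
      dec_prf = (\<lambda>d. (left d, right d))\<rparr>)"

end

theory Submission
  imports "HOL-Number_Theory.Residues" Defs "HOL-Real_Asymp.Real_Asymp"
begin

text \<open>
  Privacy: by SDA, \<open>h = u^q\<close> may be replaced by a uniform element of \<open>G\<^sub>1\<close>. Such an element is a generator
  except with negligible probability, and then the encodings of all inputs have the same distribution.

  Security: suppose that \<open>y \<noteq> f(\<alpha>)\<close> is accepted. Dividing the verification equation of the forgery by that of
  the honest pair leaves \<open>e(g\<^sub>1^(s - \<alpha>), d^p) = g\<^sub>\<kappa>^(p (f(\<alpha>) - y))\<close> with a known \<open>d\<close>; as \<open>f(\<alpha>) - y\<close> is invertible
  modulo \<open>q\<close>, this gives \<open>g\<^sub>\<kappa>^(p / (s - \<alpha>))\<close>. To make this an MSDHS solution the secret \<open>s\<close> of the challenge is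
  shifted to \<open>s + a\<close>, where \<open>a\<close> must be guessed to be the input under attack. The adversary chooses this
  input only after it has seen the public key, so the reduction takes for \<open>a\<close> the choice of a first run of
  the adversary with fresh keys. As the choice lies in the small domain, a second run on the challenge repeats
  it and wins with probability at least \<open>\<epsilon>^2 / |D|\<close>, where \<open>\<epsilon>\<close> is the probability of a forgery.

  The reductions are deterministic functions of random bits: uniform samples from \<open>\<int>\<^sub>N\<close> are approximated by
  reducing \<open>3\<eta>\<close> random bits modulo \<open>N\<close>.
\<close>

section \<open>Closure properties of polynomial time\<close>

text \<open>All client tests compare p-th powers, so only exponents modulo q count, and the masks
  h^r, whose exponents are multiples of q, disappear. This drives correctness and the algebra of the
  forgery alike. The MSDHS reduction checks neither that the second run repeats the guess nor that
  the forgery is accepted. It computes a candidate root from whatever it receives; the candidate is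
  correct whenever both would have held. For this it must know the accepted y, which it finds by
  searching M with the help of p; hence M has to be listable. Polynomial time is demanded on every
  input, also on strings that describe no group, whereas group elements are known to be short only
  for genuine instances. The loops around the group programs therefore replace a state that outgrows
  a polynomial bound by 0, which never happens on genuine input. That the adversary stays in the
  domain is known for the real game only. With a uniform h it might ask for huge integers, so inputs
  are reduced modulo N throughout; the real game does not notice.\<close>

lemma poly_nat_mono: "x \<le> y \<Longrightarrow> poly (T :: nat poly) x \<le> poly T y"
  by (induction T) (auto intro!: add_mono mult_mono)

lemma bits_ge_1: "1 \<le> bits x"
  by (cases x) auto

text \<open>Every rule of \<open>runs\<close> charges for the data it writes or passes on. A cost
  bound is thus also a bound on intermediate sizes, which composition needs.\<close>

lemma bits_le_cost: "runs P x t y \<Longrightarrow> bits y \<le> t"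
  by (induction rule: runs.induct) auto

text \<open>Cost bounds are arbitrary functions with a polynomial majorant in \<open>bits\<close>,
  so that they combine without exhibiting polynomials.\<close>

definition pbounded :: "(data \<Rightarrow> nat) \<Rightarrow> bool" where
  "pbounded h \<longleftrightarrow> (\<exists>T :: nat poly. \<forall>x. h x \<le> poly T (bits x))"

lemma pbounded_const: "pbounded (\<lambda>_. c)"
  unfolding pbounded_def by (rule exI[of _ "[:c:]"]) simp

lemma pbounded_bits: "pbounded bits"
  unfolding pbounded_def by (rule exI[of _ "[:0, 1:]"]) simp

lemma pbounded_add:
  assumes "pbounded h" "pbounded h'"
  shows "pbounded (\<lambda>x. h x + h' x)"
proof -
  obtain T T' :: "nat poly" where "\<forall>x. h x \<le> poly T (bits x)" "\<forall>x. h' x \<le> poly T' (bits x)"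
    using assms by (auto simp: pbounded_def)
  then show ?thesis
    unfolding pbounded_def by (intro exI[of _ "T + T'"]) (auto intro: add_mono)
qed

lemma pbounded_mult:
  assumes "pbounded h" "pbounded h'"
  shows "pbounded (\<lambda>x. h x * h' x)"
proof -
  obtain T T' :: "nat poly" where "\<forall>x. h x \<le> poly T (bits x)" "\<forall>x. h' x \<le> poly T' (bits x)"
    using assms by (auto simp: pbounded_def)
  then show ?thesis
    unfolding pbounded_def by (intro exI[of _ "T * T'"]) (auto intro: mult_mono)
qed

lemma pbounded_poly:
  assumes "pbounded h"
  shows "pbounded (\<lambda>x. poly (Q :: nat poly) (h x))"
proof -
  obtain T :: "nat poly" where "\<forall>x. h x \<le> poly T (bits x)"
    using assms by (auto simp: pbounded_def)
  then show ?thesis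
    unfolding pbounded_def
    by (intro exI[of _ "pcompose Q T"]) (auto simp: poly_pcompose intro: poly_nat_mono)
qed

lemmas pbounded_intros = pbounded_const pbounded_bits pbounded_add pbounded_mult pbounded_poly

lemma polytimeI:
  assumes "\<And>x. \<exists>t \<le> h x. runs P x t (F x)" "pbounded h"
  shows "polytime F"
  using assms unfolding polytime_def pbounded_def by (meson order_trans)

lemma polytimeE:
  assumes "polytime F"
  obtains P h where "\<And>x. \<exists>t \<le> h x. runs P x t (F x)" "pbounded h"
  using assms unfolding polytime_def pbounded_def by (meson order_refl)

lemma polytime_pbounded:
  assumes "polytime F"
  shows "pbounded (\<lambda>x. bits (F x))"
  using assms unfolding polytime_def pbounded_def by (meson bits_le_cost order_trans)

lemma polytime_const: "polytime (\<lambda>_. d)"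
proof (rule polytimeI)
  show "\<exists>t\<le>1 + bits d. runs (Const d) x t d" for x
    using runs.const by blast
qed (rule pbounded_intros)

lemma polytime_prim: "polytime (apply_primitive f)"
proof -
  have fl0: "floorlog 2 0 = 0"
    by (simp add: floorlog_def)
  have fl1: "floorlog 2 (Suc 0) = 1"
    by (simp add: compute_floorlog)
  have ar: "bits (arith h x) \<le> 10 + 2 * bits x"
    if "\<And>a b. floorlog 2 (nat \<bar>h a b\<bar>) \<le> 2 + 2 * (floorlog 2 (nat \<bar>a\<bar>) + floorlog 2 (nat \<bar>b\<bar>))" for h x
    using that
  proof (induction h x rule: arith.induct)
    case (1 f a b)
    then show ?case
      using le_trans[OF 1[of a b], of "7 + 2 * (floorlog 2 (nat \<bar>a\<bar>) + floorlog 2 (nat \<bar>b\<bar>))"] by simp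
  qed (auto simp: fl0)
  have fl: "floorlog 2 m \<le> j" if "m < 2 ^ j" for m j :: nat
    using that by (simp add: floorlog_leI)
  have bd: "\<bar>a\<bar> < 2 ^ floorlog 2 (nat \<bar>a\<bar>)" for a :: int
    using floorlog_bounds[of "nat \<bar>a\<bar>" 2] by (cases "a = 0") (auto simp: nat_less_iff)
  \<comment> \<open>The hypothesis bounds \<bar>z\<bar> by (\<bar>a\<bar> + 1) (\<bar>b\<bar> + 1),
    one majorant that fits all arithmetic primitives, including the rounding of
    \<open>div\<close>.\<close>
  have nl: "floorlog 2 (nat \<bar>z\<bar>) \<le> 2 + 2 * (floorlog 2 (nat \<bar>a\<bar>) + floorlog 2 (nat \<bar>b\<bar>))"
    if "\<bar>z\<bar> \<le> \<bar>a\<bar> + \<bar>b\<bar> + \<bar>a\<bar> * \<bar>b\<bar> + 1" for z a b :: int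
  proof (rule fl)
    let ?m = "floorlog 2 (nat \<bar>a\<bar>)" and ?l = "floorlog 2 (nat \<bar>b\<bar>)"
    have "\<bar>a\<bar> + 1 \<le> 2 ^ ?m" "\<bar>b\<bar> + 1 \<le> 2 ^ ?l"
      using bd[of a] bd[of b] by linarith+
    then have "(\<bar>a\<bar> + 1) * (\<bar>b\<bar> + 1) \<le> 2 ^ ?m * 2 ^ ?l"
      by (intro mult_mono) auto
    also have "\<dots> = 2 ^ (?m + ?l)"
      by (simp add: power_add)
    also have "\<dots> < (2::int) ^ (2 + 2 * (?m + ?l))"
      by (rule power_strict_increasing) auto
    finally have "\<bar>z\<bar> < 2 ^ (2 + 2 * (?m + ?l))"
      using that by (simp add: algebra_simps)
    then show "nat \<bar>z\<bar> < 2 ^ (2 + 2 * (?m + ?l))"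
      by (simp add: nat_less_iff)
  qed
  have ap: "bits (apply_primitive f x) \<le> 10 + 2 * bits x" for x
  proof (cases f)
    case PId then show ?thesis by simp
  next
    case PLeft then show ?thesis by (cases x) (auto simp: fl0)
  next
    case PRight then show ?thesis by (cases x) (auto simp: fl0)
  next
    case PAdd then show ?thesis
      apply simp
      apply (rule order_trans[OF ar])
       apply (rule nl)
      subgoal for a b using mult_nonneg_nonneg[of "\<bar>a\<bar>" "\<bar>b\<bar>"] by linarith
      by simp
  next
    case PSub then show ?thesis
      apply simp
      apply (rule order_trans[OF ar])
       apply (rule nl)
      subgoal for a b using mult_nonneg_nonneg[of "\<bar>a\<bar>" "\<bar>b\<bar>"] by linarith
      by simp
  next
    case PMul then show ?thesis
      apply simp
      apply (rule order_trans[OF ar])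
       apply (rule nl)
      by (auto simp: abs_mult)
  next
    case PDiv
    have "\<bar>a div b\<bar> \<le> \<bar>a\<bar> + \<bar>b\<bar> + \<bar>a\<bar> * \<bar>b\<bar> + 1" for a b :: int
    proof -
      have "\<bar>a div b\<bar> \<le> \<bar>a\<bar> + 1"
      proof (cases "b = 0")
        case False
        \<comment> \<open>The product of \<open>a div b\<close> and \<open>b\<close> differs from
          \<open>a\<close> by a remainder smaller than \<bar>b\<bar>.\<close>
        have *: "\<bar>a div b\<bar> * \<bar>b\<bar> \<le> \<bar>a\<bar> + \<bar>b\<bar>"
          using mult_div_mod_eq[of b a] abs_mod_less[OF False, of a]
          by (metis abs_mult abs_triangle_ineq4 add_diff_cancel_right' add_left_mono less_imp_le mult.commute order_trans)
        show ?thesis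
        proof (rule ccontr)
          assume "\<not> ?thesis"
          then have "(\<bar>a\<bar> + 2) * \<bar>b\<bar> \<le> \<bar>a div b\<bar> * \<bar>b\<bar>"
            by (intro mult_right_mono) auto
          then have "\<bar>a\<bar> * \<bar>b\<bar> + \<bar>b\<bar> \<le> \<bar>a\<bar>"
            using * by (simp add: algebra_simps)
          moreover have "\<bar>a\<bar> * 1 \<le> \<bar>a\<bar> * \<bar>b\<bar>"
            using False by (intro mult_left_mono) auto
          ultimately show False using False by simp
        qed
      qed auto
      then show ?thesis using mult_nonneg_nonneg[of "\<bar>a\<bar>" "\<bar>b\<bar>"] by linarith
    qed
    then show ?thesis
      unfolding PDiv
      apply simp
      apply (rule order_trans[OF ar])
       apply (rule nl)
      by auto
  next
    case PMod
    have "\<bar>a mod b\<bar> \<le> \<bar>a\<bar> + \<bar>b\<bar> + \<bar>a\<bar> * \<bar>b\<bar> + 1" for a b :: int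
    proof -
      have "\<bar>a mod b\<bar> \<le> \<bar>a\<bar> + \<bar>b\<bar>"
        using abs_mod_less[of b a] by (cases "b = 0") auto
      then show ?thesis using mult_nonneg_nonneg[of "\<bar>a\<bar>" "\<bar>b\<bar>"] by linarith
    qed
    then show ?thesis
      unfolding PMod
      apply simp
      apply (rule order_trans[OF ar])
       apply (rule nl)
      by auto
  next
    case PLess then show ?thesis
      apply simp
      apply (rule order_trans[OF ar])
       apply (rule nl)
      by auto
  next
    case PEqual then show ?thesis by (auto simp: fl0 fl1)
  next
    case PIsAtom then show ?thesis by (auto simp: fl0 fl1)
  qed
  have "1 + bits x + bits (apply_primitive f x) \<le> 11 + 3 * bits x" for x
    using ap[of x] by simp
  then show ?thesis
    using runs.prim by (intro polytimeI[where P = "Prim f" and h = "\<lambda>x. 11 + 3 * bits x"] pbounded_intros) blast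
qed

lemma polytime_comp:
  assumes "polytime F" "polytime G"
  shows "polytime (\<lambda>x. F (G x))"
proof -
  obtain P T where P: "\<And>x. \<exists>t \<le> poly (T :: nat poly) (bits x). runs P x t (F x)"
    using assms(1) by (auto simp: polytime_def)
  obtain Q h where Q: "\<And>x. \<exists>t \<le> h x. runs Q x t (G x)" "pbounded h"
    using assms(2) by (rule polytimeE) blast
  show ?thesis
  proof (rule polytimeI[where P = "Seq Q P" and h = "\<lambda>x. 1 + h x + poly T (h x)"])
    fix x
    obtain t where t: "t \<le> h x" "runs Q x t (G x)" using Q by blast
    obtain u where u: "u \<le> poly T (bits (G x))" "runs P (G x) u (F (G x))" using P by blast
    have "u \<le> poly T (h x)"
      using u(1) poly_nat_mono[of "bits (G x)" "h x" T] bits_le_cost[OF t(2)] t(1) by linarith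
    then show "\<exists>t\<le>1 + h x + poly T (h x). runs (Seq Q P) x t (F (G x))"
      using t u(1) runs.seq[OF t(2) u(2)] by (intro exI[of _ "1 + t + u"]) auto
  qed (intro pbounded_intros Q)
qed

lemma polytime_id: "polytime (\<lambda>x. x)"
proof -
  have "apply_primitive PId = (\<lambda>x. x)"
    by (rule ext) simp
  then show ?thesis
    using polytime_prim[of PId] by simp
qed

lemma polytime_Node:
  assumes "polytime F" "polytime G"
  shows "polytime (\<lambda>x. Node (F x) (G x))"
proof -
  obtain P h where P: "\<And>x. \<exists>t \<le> h x. runs P x t (F x)" "pbounded h"
    using assms(1) by (rule polytimeE) blast
  obtain Q h' where Q: "\<And>x. \<exists>t \<le> h' x. runs Q x t (G x)" "pbounded h'"
    using assms(2) by (rule polytimeE) blast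
  show ?thesis
  proof (rule polytimeI[where P = "Both P Q" and h = "\<lambda>x. 1 + bits x + h x + h' x"])
    fix x
    obtain t where t: "t \<le> h x" "runs P x t (F x)" using P by blast
    obtain u where u: "u \<le> h' x" "runs Q x u (G x)" using Q by blast
    show "\<exists>t\<le>1 + bits x + h x + h' x. runs (Both P Q) x t (Node (F x) (G x))"
      using t u(1) runs.both[OF t(2) u(2)] by (intro exI[of _ "1 + bits x + t + u"]) auto
  qed (intro pbounded_intros P Q)
qed

definition decides :: "(data \<Rightarrow> bool) \<Rightarrow> bool" where
  "decides B \<longleftrightarrow> polytime (\<lambda>x. Atom (of_bool (B x)))"

lemma polytime_if:
  assumes "decides B" "polytime F" "polytime G"
  shows "polytime (\<lambda>x. if B x then F x else G x)"
proof -
  obtain R h0 where R: "\<And>x. \<exists>t \<le> h0 x. runs R x t (Atom (of_bool (B x)))" "pbounded h0"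
    using assms(1) unfolding decides_def by (rule polytimeE) blast
  obtain P h where P: "\<And>x. \<exists>t \<le> h x. runs P x t (F x)" "pbounded h"
    using assms(2) by (rule polytimeE) blast
  obtain Q h' where Q: "\<And>x. \<exists>t \<le> h' x. runs Q x t (G x)" "pbounded h'"
    using assms(3) by (rule polytimeE) blast
  show ?thesis
  proof (rule polytimeI[where P = "Cond R P Q" and h = "\<lambda>x. 1 + bits x + h0 x + h x + h' x"])
    fix x
    obtain w where w: "w \<le> h0 x" "runs R x w (Atom (of_bool (B x)))" using R by blast
    obtain t where t: "t \<le> h x" "runs P x t (F x)" using P by blast
    obtain u where u: "u \<le> h' x" "runs Q x u (G x)" using Q by blast
    show "\<exists>t\<le>1 + bits x + h0 x + h x + h' x. runs (Cond R P Q) x t (if B x then F x else G x)"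
    proof (cases "B x")
      case True
      then have "runs (Cond R P Q) x (1 + bits x + w + t) (F x)"
        using w t by (intro runs.cond_true[where v = "Atom 1"]) auto
      then show ?thesis using w t True by (intro exI[of _ "1 + bits x + w + t"]) auto
    next
      case False
      then have "runs (Cond R P Q) x (1 + bits x + w + u) (G x)"
        using w u by (intro runs.cond_false) auto
      then show ?thesis using w u False by (intro exI[of _ "1 + bits x + w + u"]) auto
    qed
  qed (intro pbounded_intros P Q R)
qed

lemma polytime_left: "polytime F \<Longrightarrow> polytime (\<lambda>x. left (F x))"
  using polytime_comp[OF polytime_prim[of PLeft]] by simp

lemma polytime_right: "polytime F \<Longrightarrow> polytime (\<lambda>x. right (F x))"
  using polytime_comp[OF polytime_prim[of PRight]] by simp

lemma polytime_int_of:
  assumes "polytime F"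
  shows "polytime (\<lambda>x. Atom (int_of (F x)))"
proof -
  \<comment> \<open>There is no primitive for \<open>int_of\<close>. Adding 0 does the same, also on
    a \<open>Node\<close>, where \<open>arith\<close> falls back to \<open>Atom 0\<close>.\<close>
  have "Atom (int_of d) = arith (+) (Node d (Atom 0))" for d
    by (cases d) auto
  then show ?thesis
    using polytime_comp[OF polytime_prim[of PAdd] polytime_Node[OF assms polytime_const]] by simp
qed

lemma polytime_arith:
  assumes "polytime (\<lambda>x. Atom (a x))" "polytime (\<lambda>x. Atom (b x))"
  shows polytime_plus: "polytime (\<lambda>x. Atom (a x + b x))"
    and polytime_minus: "polytime (\<lambda>x. Atom (a x - b x))"
    and polytime_times: "polytime (\<lambda>x. Atom (a x * b x))"
    and polytime_div: "polytime (\<lambda>x. Atom (a x div b x))"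
    and polytime_mod: "polytime (\<lambda>x. Atom (a x mod b x))"
    and decides_less: "decides (\<lambda>x. a x < b x)"
  using polytime_comp[OF polytime_prim[of PAdd] polytime_Node[OF assms]]
    polytime_comp[OF polytime_prim[of PSub] polytime_Node[OF assms]]
    polytime_comp[OF polytime_prim[of PMul] polytime_Node[OF assms]]
    polytime_comp[OF polytime_prim[of PDiv] polytime_Node[OF assms]]
    polytime_comp[OF polytime_prim[of PMod] polytime_Node[OF assms]]
    polytime_comp[OF polytime_prim[of PLess] polytime_Node[OF assms]]
  by (simp_all add: decides_def)

lemma polytime_of_bool: "decides B \<Longrightarrow> polytime (\<lambda>x. Atom (of_bool (B x)))"
  by (simp add: decides_def)

lemma decides_eq:
  assumes "polytime F" "polytime G"
  shows "decides (\<lambda>x. F x = G x)"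
  using polytime_comp[OF polytime_prim[of PEqual] polytime_Node[OF assms]] by (simp add: decides_def)

lemma decides_eq_int:
  assumes "polytime (\<lambda>x. Atom (a x))" "polytime (\<lambda>x. Atom (b x))"
  shows "decides (\<lambda>x. a x = b x)"
  using decides_eq[OF assms] by simp

definition is_atom :: "data \<Rightarrow> bool" where
  "is_atom x \<longleftrightarrow> (\<exists>i. x = Atom i)"

lemma is_atom_simps [simp]: "is_atom (Atom i)" "\<not> is_atom (Node x y)"
  by (auto simp: is_atom_def)

lemma decides_is_atom: "polytime F \<Longrightarrow> decides (\<lambda>x. is_atom (F x))"
  using polytime_comp[OF polytime_prim[of PIsAtom]] by (simp add: decides_def is_atom_def)

text \<open>The exponent is fixed in advance, so the program is a chain of multiplications.
  Exponents that depend on the input need \<open>fast_pow\<close>.\<close>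

lemma polytime_power:
  assumes "polytime (\<lambda>x. Atom (a x))"
  shows "polytime (\<lambda>x. Atom (a x ^ k))"
  by (induction k) (auto intro: polytime_const polytime_times assms)

lemma polytime_sum:
  assumes "finite I" "\<And>i. i \<in> I \<Longrightarrow> polytime (\<lambda>x. Atom (a i x))"
  shows "polytime (\<lambda>x. Atom (\<Sum>i\<in>I. a i x))"
  using assms by (induction I rule: finite_induct) (auto intro: polytime_const polytime_plus)

lemma polytime_lst_Nil: "polytime (\<lambda>x. lst [])"
  by (simp add: lst_def polytime_const)

lemma lst_Cons: "lst (x # xs) = Node x (lst xs)"
  and lst_Nil: "lst [] = Atom 0"
  by (simp_all add: lst_def)

lemma polytime_lst_Cons:
  "polytime F \<Longrightarrow> polytime (\<lambda>x. lst (xs x)) \<Longrightarrow> polytime (\<lambda>x. lst (F x # xs x))"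
  by (simp add: lst_Cons polytime_Node)

lemma polytime_right_pow: "polytime F \<Longrightarrow> polytime (\<lambda>x. (right ^^ m) (F x))"
  by (induction m) (auto intro: polytime_right)

lemmas polytime_intros = polytime_const polytime_id polytime_left polytime_right polytime_int_of
  polytime_plus polytime_minus polytime_times polytime_div polytime_mod polytime_power polytime_of_bool
  polytime_right_pow polytime_if polytime_lst_Nil polytime_lst_Cons polytime_Node
  decides_less decides_eq_int decides_eq decides_is_atom


section \<open>Bounded iteration\<close>

text \<open>Any datum serves as a unary counter through the length of its right spine. Loops of
  \<open>len\<close> rounds stay polynomial because of \<open>len_le_bits\<close>.\<close>

fun len :: "data \<Rightarrow> nat" where
  "len (Node x y) = Suc (len y)"
| "len (Atom i) = 0"

lemma len_le_bits: "len x \<le> bits x"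
  by (induction x) auto

lemma len_lst [simp]: "len (lst xs) = length xs"
  by (induction xs) (auto simp: lst_def)

lemma len_unary [simp]: "len (unary m) = m"
  by (simp add: unary_def)

text \<open>The loop state pairs the counter with the datum, and each round drops one cell of the
  counter. The size of all iterates has to be bounded by hypothesis: a polynomial step may double
  its argument, and iteration would make it exponential.\<close>

lemma polytime_funpow:
  assumes g: "polytime g" and c: "polytime c" and i: "polytime i" and h: "pbounded h"
    and bound: "\<And>x m. m \<le> len (c x) \<Longrightarrow> bits ((g ^^ m) (i x)) \<le> h x"
  shows "polytime (\<lambda>x. (g ^^ len (c x)) (i x))"
proof -
  obtain G T where G: "\<And>x. \<exists>t \<le> poly (T :: nat poly) (bits x). runs G x t (g x)"
    using g by (auto simp: polytime_def)
  obtain C hc where C: "\<And>x. \<exists>t \<le> hc x. runs C x t (c x)" "pbounded hc"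
    using c by (rule polytimeE) blast
  obtain I hi where I: "\<And>x. \<exists>t \<le> hi x. runs I x t (i x)" "pbounded hi"
    using i by (rule polytimeE) blast
  define B where "B = Cond (Seq (Prim PLeft) (Prim PIsAtom)) (Const (Atom 0)) (Const (Atom 1))"
  define P where "P = Both (Seq (Prim PLeft) (Prim PRight)) (Seq (Prim PRight) G)"
  have fl1: "floorlog 2 (Suc 0) = 1"
    by (simp add: compute_floorlog)
  have fl0: "floorlog 2 0 = 0"
    by (simp add: floorlog_def)
  have B: "\<exists>t \<le> 20 + 4 * bits x. runs B x t (Atom (of_bool (\<not> is_atom (left x))))" for x
  proof -
    define w where "w = 1 + (1 + bits x + bits (left x)) +
      (1 + bits (left x) + bits (Atom (of_bool (is_atom (left x)))))"
    have w: "runs (Seq (Prim PLeft) (Prim PIsAtom)) x w (Atom (of_bool (is_atom (left x))))"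
      unfolding w_def
      using runs.seq[OF runs.prim[of PLeft x, unfolded apply_primitive.simps] runs.prim[of PIsAtom "left x", unfolded apply_primitive.simps]]
      by (simp add: is_atom_def)
    have bl: "bits (left x) \<le> bits x"
      by (cases x) (auto simp: fl0)
    have ww: "w \<le> 5 + 3 * bits x"
      using bl by (auto simp: w_def fl1 fl0)
    show ?thesis
    proof (cases "is_atom (left x)")
      case True
      then have "runs B x (1 + bits x + w + (1 + bits (Atom 0))) (Atom 0)"
        unfolding B_def using w by (intro runs.cond_true[where v = "Atom 1"] runs.const) auto
      then show ?thesis using ww True
        by (intro exI[of _ "1 + bits x + w + (1 + bits (Atom 0))"]) (auto simp: fl0)
    next
      case False
      then have "runs B x (1 + bits x + w + (1 + bits (Atom 1))) (Atom 1)"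
        unfolding B_def using w by (intro runs.cond_false runs.const) auto
      then show ?thesis using ww False
        by (intro exI[of _ "1 + bits x + w + (1 + bits (Atom 1))"]) (auto simp: fl1)
    qed
  qed
  have P: "\<exists>t \<le> 20 + 8 * bits x + poly T (bits s). runs P x t (Node l (g s))"
    if x: "x = Node (Node a l) s" for x a l s
  proof -
    obtain u where u: "u \<le> poly T (bits s)" "runs G s u (g s)"
      using G by blast
    have 1: "runs (Seq (Prim PLeft) (Prim PRight)) x
      (1 + (1 + bits x + bits (Node a l)) + (1 + bits (Node a l) + bits l)) l"
      using runs.seq[OF runs.prim[of PLeft x, unfolded apply_primitive.simps] runs.prim[of PRight "left x", unfolded apply_primitive.simps]] by (simp add: x)
    have 2: "runs (Seq (Prim PRight) G) x (1 + (1 + bits x + bits s) + u) (g s)"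
      using runs.seq[OF runs.prim[of PRight x, unfolded apply_primitive.simps], of G u] u(2) by (simp add: x)
    show ?thesis
      using runs.both[OF 1 2] u(1) unfolding P_def
      by (intro exI[of _ "1 + bits x + (1 + (1 + bits x + bits (Node a l)) + (1 + bits (Node a l) + bits l)) +
        (1 + (1 + bits x + bits s) + u)"]) (auto simp: x)
  qed
  \<comment> \<open>A round costs at most 20 + 4 \<open>bits x\<close> for the test, 20 + 8
    \<open>bits x\<close> and the run of \<open>g\<close> for the body, and 1 +
    \<open>bits x\<close> for the loop rule; this gives the 13, and 60 absorbs the constants. The
    atom \<open>a\<close> that ends the counter is discarded.\<close>
  have W: "\<exists>t a. t \<le> (len l + 1) * (60 + 13 * (1 + L + S) + poly T S) \<and>
      runs (While B P) (Node l s) t (Node a ((g ^^ len l) s))"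
    if "\<And>m. m \<le> len l \<Longrightarrow> bits ((g ^^ m) s) \<le> S" "bits l \<le> L" for l s S L
    using that
  proof (induction l arbitrary: s)
    case (Atom j)
    obtain t where t: "t \<le> 20 + 4 * bits (Node (Atom j) s)" "runs B (Node (Atom j) s) t (Atom 0)"
      using B[of "Node (Atom j) s"] by auto
    have "bits s \<le> S" using Atom(1)[of 0] by simp
    then have "1 + bits (Node (Atom j) s) + t \<le> 60 + 13 * (1 + L + S)"
      using t(1) Atom(2) by simp
    then have "1 + bits (Node (Atom j) s) + t \<le> (len (Atom j) + 1) * (60 + 13 * (1 + L + S) + poly T S)"
      by simp
    moreover have "runs (While B P) (Node (Atom j) s) (1 + bits (Node (Atom j) s) + t)
        (Node (Atom j) ((g ^^ len (Atom j)) s))"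
      using runs.while_stop[OF t(2), of P] by simp
    ultimately show ?case by blast
  next
    case (Node b l)
    let ?x = "Node (Node b l) s"
    let ?K = "60 + 13 * (1 + L + S) + poly T S"
    obtain t where t: "t \<le> 20 + 4 * bits ?x" "runs B ?x t (Atom 1)"
      using B[of ?x] by auto
    obtain u where u: "u \<le> 20 + 8 * bits ?x + poly T (bits s)" "runs P ?x u (Node l (g s))"
      using P[OF refl] by blast
    obtain w a where w: "w \<le> (len l + 1) * ?K"
      "runs (While B P) (Node l (g s)) w (Node a ((g ^^ len l) (g s)))"
    proof -
      have "bits ((g ^^ m) (g s)) \<le> S" if "m \<le> len l" for m
        using Node.prems(1)[of "Suc m"] that by (simp add: funpow_swap1)
      moreover have "bits l \<le> L" using Node.prems(2) by simp
      ultimately show ?thesis using Node.IH(2)[of "g s"] that by blast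
    qed
    have s: "bits s \<le> S" using Node.prems(1)[of 0] by simp
    then have "poly T (bits s) \<le> poly T S" by (rule poly_nat_mono)
    then have "1 + bits ?x + t + u + w \<le> (len (Node b l) + 1) * ?K"
      using t(1) u(1) w(1) s Node.prems(2) by simp
    moreover have "runs (While B P) ?x (1 + bits ?x + t + u + w) (Node a ((g ^^ len (Node b l)) s))"
      using runs.while_step[OF t(2) _ u(2) w(2)] by (simp add: funpow_swap1)
    ultimately show ?case by blast
  qed
  let ?w = "\<lambda>x. (bits (c x) + 1) * (60 + 13 * (1 + bits (c x) + h x) + poly T (h x))"
  show ?thesis
  proof (rule polytimeI[where P = "Seq (Both C I) (Seq (While B P) (Prim PRight))" and
        h = "\<lambda>x. 1 + (1 + bits x + hc x + hi x) + (1 + ?w x + (1 + ?w x + ?w x))"])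
    fix x
    obtain t where t: "t \<le> hc x" "runs C x t (c x)" using C by blast
    obtain u where u: "u \<le> hi x" "runs I x u (i x)" using I by blast
    obtain w a where w: "w \<le> (len (c x) + 1) * (60 + 13 * (1 + bits (c x) + h x) + poly T (h x))"
      "runs (While B P) (Node (c x) (i x)) w (Node a ((g ^^ len (c x)) (i x)))"
      using W[of "c x" "i x" "h x", OF bound order_refl] by blast
    let ?r = "(g ^^ len (c x)) (i x)"
    have "(len (c x) + 1) * (60 + 13 * (1 + bits (c x) + h x) + poly T (h x)) \<le> ?w x"
      using len_le_bits[of "c x"] by (intro mult_right_mono) auto
    then have w': "w \<le> ?w x" using w(1) by linarith
    have "bits (Node a ?r) \<le> w" using bits_le_cost[OF w(2)] .
    then have "1 + bits (Node a ?r) + bits ?r \<le> 1 + ?w x + ?w x"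
      using w' by simp
    moreover have "runs (Seq (Both C I) (Seq (While B P) (Prim PRight))) x
      (1 + (1 + bits x + t + u) + (1 + w + (1 + bits (Node a ?r) + bits ?r))) ?r"
      using runs.seq[OF runs.both[OF t(2) u(2)] runs.seq[OF w(2) runs.prim[of PRight]]] by simp
    moreover have "1 + (1 + bits x + t + u) + (1 + w + (1 + bits (Node a ?r) + bits ?r)) \<le>
        1 + (1 + bits x + hc x + hi x) + (1 + ?w x + (1 + ?w x + ?w x))"
      using t(1) u(1) w' calculation(1) by linarith
    ultimately show "\<exists>t\<le>1 + (1 + bits x + hc x + hi x) + (1 + ?w x + (1 + ?w x + ?w x)).
        runs (Seq (Both C I) (Seq (While B P) (Prim PRight))) x t ?r"
      by blast
  next
    show "pbounded (\<lambda>x. 1 + (1 + bits x + hc x + hi x) + (1 + ?w x + (1 + ?w x + ?w x)))"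
      using polytime_pbounded[OF c] C(2) I(2) h by (intro pbounded_intros) 
  qed
qed

lemma bits_Atom_le: "bits (Atom i) \<le> 1 + m" if "\<bar>i\<bar> < 2 ^ m"
proof -
  have "nat \<bar>i\<bar> < 2 ^ m"
    using that by (simp add: nat_less_iff)
  then show ?thesis by (simp add: floorlog_leI)
qed

lemma bits_lst: "bits (lst xs) = 1 + (\<Sum>x\<leftarrow>xs. 1 + bits x)"
  by (induction xs) (auto simp: lst_def floorlog_def)

lemma bits_lst_le:
  assumes "\<And>x. x \<in> set xs \<Longrightarrow> bits x \<le> B" "length xs \<le> m"
  shows "bits (lst xs) \<le> 1 + m * (1 + B)"
proof -
  have "(\<Sum>x\<leftarrow>xs. 1 + bits x) \<le> (\<Sum>x\<leftarrow>xs. 1 + B)"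
    using assms(1) by (intro sum_list_mono) auto
  also have "\<dots> \<le> m * (1 + B)"
    unfolding sum_list_triv of_nat_id using assms(2) by (rule mult_right_mono) simp
  finally show ?thesis by (simp add: bits_lst)
qed

section \<open>Lists and unary arithmetic\<close>

definition move :: "data \<Rightarrow> data" where
  "move z = (if is_atom (left z) then z
     else Node (right (left z)) (Node (left (left z)) (right z)))"

lemma polytime_move: "polytime move"
  unfolding move_def[abs_def] by (intro polytime_intros)

lemma bits_move: "bits (move z) \<le> bits z"
proof (cases z)
  case (Node x y)
  then show ?thesis by (cases x) (auto simp: move_def)
qed (auto simp: move_def)

lemma bits_funpow_le:
  assumes "\<And>z. bits (f z) \<le> bits z"
  shows "bits ((f ^^ m) z) \<le> bits z"
  by (induction m) (auto intro: order_trans[OF assms])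

definition dreverse :: "data \<Rightarrow> data" where
  "dreverse l = right ((move ^^ len l) (Node l (Atom 0)))"

lemma polytime_dreverse:
  assumes "polytime F"
  shows "polytime (\<lambda>x. dreverse (F x))"
  unfolding dreverse_def
  by (rule polytime_right, rule polytime_funpow[where h = "\<lambda>x. bits (Node (F x) (Atom 0))"])
    (intro polytime_move polytime_intros polytime_pbounded bits_funpow_le bits_move assms)+

lemma dreverse_lst: "dreverse (lst xs) = lst (rev xs)"
proof -
  have "(move ^^ length xs) (Node (lst xs) (lst ys)) = Node (Atom 0) (lst (rev xs @ ys))" for ys
  proof (induction xs arbitrary: ys)
    case (Cons x xs)
    have "(move ^^ length (x # xs)) (Node (lst (x # xs)) (lst ys)) =
        (move ^^ length xs) (Node (lst xs) (lst (x # ys)))"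
      by (simp add: funpow_Suc_right move_def lst_Cons del: funpow.simps(2))
    then show ?case using Cons.IH[of "x # ys"] by simp
  qed (simp add: lst_Nil)
  from this[of "[]"] show ?thesis
    by (simp add: dreverse_def lst_Nil)
qed

text \<open>Only the head of a list is directly accessible, so appending takes two
  reversals.\<close>

definition snoc :: "data \<Rightarrow> data \<Rightarrow> data" where
  "snoc l x = dreverse (Node x (dreverse l))"

lemma polytime_snoc: "polytime F \<Longrightarrow> polytime G \<Longrightarrow> polytime (\<lambda>x. snoc (F x) (G x))"
  unfolding snoc_def by (intro polytime_dreverse polytime_Node)

lemma snoc_lst: "snoc (lst xs) x = lst (xs @ [x])"
  by (simp add: snoc_def dreverse_lst flip: lst_Cons)

definition uadd :: "data \<Rightarrow> data \<Rightarrow> data" where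
  "uadd u v = ((\<lambda>s. Node (Atom 1) s) ^^ len u) v"

lemma bits_funpow_Node: "bits ((Node (Atom 1) ^^ m) v) = 3 * m + bits v"
  by (induction m) (auto simp: compute_floorlog)

lemma polytime_uadd: "polytime F \<Longrightarrow> polytime G \<Longrightarrow> polytime (\<lambda>x. uadd (F x) (G x))"
  unfolding uadd_def
  by (rule polytime_funpow[where h = "\<lambda>x. 3 * bits (F x) + bits (G x)"])
    (auto simp: bits_funpow_Node
      intro!: polytime_intros polytime_pbounded pbounded_intros intro: order_trans[OF _ len_le_bits])

lemma len_uadd [simp]: "len (uadd u v) = len u + len v"
proof -
  have "len ((Node (Atom 1) ^^ m) v) = m + len v" for m
    by (induction m) auto
  then show ?thesis by (simp add: uadd_def)
qed

lemma bits_uadd: "bits (uadd u v) = 3 * len u + bits v"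
  by (simp add: uadd_def bits_funpow_Node)

definition umult :: "data \<Rightarrow> data \<Rightarrow> data" where
  "umult u v = left (((\<lambda>s. Node (uadd (right s) (left s)) (right s)) ^^ len u) (Node (Atom 0) v))"

lemma umult_iter:
  "((\<lambda>s. Node (uadd (right s) (left s)) (right s)) ^^ m) (Node w v) =
     Node ((uadd v ^^ m) w) v"
  by (induction m) auto

lemma bits_funpow_uadd: "bits ((uadd v ^^ m) w) = 3 * len v * m + bits w"
  by (induction m) (auto simp: bits_uadd algebra_simps)

lemma polytime_umult:
  assumes "polytime F" "polytime G"
  shows "polytime (\<lambda>x. umult (F x) (G x))"
  unfolding umult_def
proof (rule polytime_left, rule polytime_funpow)
  show "pbounded (\<lambda>x. 2 + 3 * bits (G x) * bits (F x) + bits (G x))"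
    using assms by (intro pbounded_intros polytime_pbounded)
  fix x m assume "m \<le> len (F x)"
  then have "len (G x) * m \<le> bits (G x) * bits (F x)"
    using len_le_bits[of "F x"] len_le_bits[of "G x"] by (intro mult_mono) auto
  then show "bits (((\<lambda>s. Node (uadd (right s) (left s)) (right s)) ^^ m) (Node (Atom 0) (G x)))
      \<le> 2 + 3 * bits (G x) * bits (F x) + bits (G x)"
    by (simp add: umult_iter bits_funpow_uadd floorlog_def)
qed (intro polytime_intros polytime_uadd assms)+

lemma len_umult [simp]: "len (umult u v) = len u * len v"
proof -
  have "len ((uadd v ^^ m) (Atom 0)) = m * len v" for m
    by (induction m) auto
  then show ?thesis by (simp add: umult_def umult_iter)
qed

text \<open>Horner's scheme in unary: \<open>pCons a Q\<close> has the value a + u Q(u).\<close>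

lemma unary_poly_exists:
  "\<exists>F. polytime F \<and> (\<forall>u. len (F u) = poly (Q :: nat poly) (len u))"
proof (induction Q)
  case 0
  show ?case by (intro exI[of _ "\<lambda>_. Atom 0"]) (auto intro: polytime_const)
next
  case (pCons a Q)
  then obtain F where F: "polytime F" "\<And>u. len (F u) = poly Q (len u)" by blast
  then show ?case
    by (intro exI[of _ "\<lambda>u. uadd (unary a) (umult u (F u))"])
      (auto intro!: polytime_uadd polytime_umult polytime_const polytime_id)
qed

text \<open>Supplies loop bounds and tape lengths, which are polynomials in the unary security
  parameter. Only the length of the result matters, hence the choice operator.\<close>

definition unary_poly :: "nat poly \<Rightarrow> data \<Rightarrow> data" where
  "unary_poly Q = (SOME F. polytime F \<and> (\<forall>u. len (F u) = poly Q (len u)))"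

lemma polytime_unary_poly': "polytime (unary_poly Q)"
  and len_unary_poly [simp]: "len (unary_poly Q u) = poly Q (len u)"
  using someI_ex[OF unary_poly_exists[of Q]] by (auto simp: unary_poly_def)

lemma polytime_unary_poly: "polytime F \<Longrightarrow> polytime (\<lambda>x. unary_poly Q (F x))"
  by (rule polytime_comp[OF polytime_unary_poly'])

text \<open>The exponent is the length of a unary counter, so the result has polynomially many
  digits.\<close>

lemma polytime_pow2:
  assumes "polytime F"
  shows "polytime (\<lambda>x. Atom (2 ^ len (F x)))"
proof -
  define g where "g s = Atom (2 * int_of s)" for s
  have it: "(g ^^ m) (Atom 1) = Atom (2 ^ m)" for m
    by (induction m) (auto simp: g_def)
  have "polytime (\<lambda>x. (g ^^ len (F x)) (Atom 1))"
  proof (rule polytime_funpow)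
    show "pbounded (\<lambda>x. bits (F x) + 2)"
      using assms by (intro pbounded_intros polytime_pbounded)
    fix x m assume "m \<le> len (F x)"
    moreover have "bits (Atom (2 ^ m)) \<le> 1 + (m + 1)"
      by (rule bits_Atom_le) simp
    ultimately show "bits ((g ^^ m) (Atom 1)) \<le> bits (F x) + 2"
      unfolding it using len_le_bits[of "F x"] by linarith
  next
    show "polytime g"
      unfolding g_def[abs_def] by (intro polytime_intros)
  qed (intro polytime_intros assms)+
  then show ?thesis by (simp add: it)
qed


subsection \<open>Iteration with a bound on the size of the state\<close>

text \<open>The datum is a stack. One step removes one unit of size: an atom on top is halved, or
  popped once it is 0, and a node on top is replaced by its two children. \<open>weight\<close>
  counts the steps until the stack is empty.\<close>

definition shrink :: "data \<Rightarrow> data" where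
  "shrink z = (if is_atom z then z else if is_atom (left z)
     then (if left z = Atom 0 then right z
       else Node (Atom (\<bar>int_of (left z)\<bar> div 2)) (right z))
     else Node (left (left z)) (Node (right (left z)) (right z)))"

fun weight :: "data \<Rightarrow> nat" where
  "weight (Atom i) = 0"
| "weight (Node x y) = bits x + weight y"

lemma polytime_abs:
  assumes "polytime (\<lambda>x. Atom (a x))"
  shows "polytime (\<lambda>x. Atom \<bar>a x\<bar>)"
proof -
  have "polytime (\<lambda>x. if a x < 0 then Atom (0 - a x) else Atom (a x))"
    by (intro polytime_intros assms)
  moreover have "(if a x < 0 then Atom (0 - a x) else Atom (a x)) = Atom \<bar>a x\<bar>" for x
    by simp
  ultimately show ?thesis by simp
qed

lemma polytime_shrink: "polytime shrink"
  unfolding shrink_def[abs_def] by (intro polytime_intros polytime_abs)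

lemma floorlog_half: "floorlog 2 (m div 2) = floorlog 2 m - 1"
  using compute_floorlog[of 2 m] by (auto simp: floorlog_def)

lemma floorlog_2_pos: "i \<noteq> 0 \<Longrightarrow> 0 < floorlog 2 (nat \<bar>i\<bar>)" for i :: int
  by (auto simp: floorlog_def)

lemma weight_shrink: "weight (shrink z) = weight z - 1" and bits_shrink: "bits (shrink z) \<le> bits z"
proof -
  have "weight (shrink z) = weight z - 1 \<and> bits (shrink z) \<le> bits z"
  proof (cases z)
    case (Node x y)
    show ?thesis
    proof (cases x)
      case (Atom i)
      show ?thesis
      proof (cases "i = 0")
        case False
        then show ?thesis
          using floorlog_2_pos[OF False] floorlog_half[of "nat \<bar>i\<bar>"]
          unfolding Node Atom shrink_def by (simp add: nat_div_distrib)
      qed (simp add: Node Atom shrink_def floorlog_def)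
    qed (simp add: Node shrink_def)
  qed (simp add: shrink_def)
  then show "weight (shrink z) = weight z - 1" "bits (shrink z) \<le> bits z" by auto
qed

lemma weight_eq_0: "weight z = 0 \<longleftrightarrow> is_atom z"
  by (cases z) (use bits_ge_1 in \<open>auto simp: Suc_le_eq\<close>)

definition clamp :: "nat \<Rightarrow> data \<Rightarrow> data" where
  "clamp b x = (if bits x \<le> b then x else Atom 0)"

lemma bits_clamp: "bits (clamp b x) \<le> 1 + b"
  by (auto simp: clamp_def floorlog_def)

text \<open>A datum has at most \<open>b\<close> bits exactly if \<open>b\<close> steps of
  \<open>shrink\<close> empty the stack that holds it. Nothing in this test is larger than the datum
  itself.\<close>

lemma polytime_clamp:
  assumes "polytime B" "polytime F"
  shows "polytime (\<lambda>x. clamp (len (B x)) (F x))"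
proof -
  have weight: "weight ((shrink ^^ m) z) = weight z - m" for m z
    by (induction m) (auto simp: weight_shrink)
  have "polytime (\<lambda>x. (shrink ^^ len (B x)) (Node (F x) (Atom 0)))"
    by (rule polytime_funpow[where h = "\<lambda>x. bits (Node (F x) (Atom 0))"])
      (intro polytime_shrink polytime_intros assms polytime_pbounded
        bits_funpow_le bits_shrink)+
  then have "polytime (\<lambda>x. if is_atom ((shrink ^^ len (B x)) (Node (F x) (Atom 0))) then F x else Atom 0)"
    by (intro polytime_intros assms)
  then show ?thesis
    by (simp add: clamp_def weight flip: weight_eq_0)
qed

text \<open>A loop that is polynomial for every polynomial body: the environment \<open>e\<close> is
  read only, and the new state is clamped after each round. Correctness proofs have to show that the
  clamp never cuts.\<close>

definition cloop :: "(data \<Rightarrow> data) \<Rightarrow> nat \<Rightarrow> data \<Rightarrow> nat \<Rightarrow> data \<Rightarrow> data" where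
  "cloop g b e m s = ((\<lambda>s. clamp b (g (Node e s))) ^^ m) s"

lemma polytime_cloop:
  assumes g: "polytime g" and "polytime B" "polytime E" "polytime C" "polytime S"
  shows "polytime (\<lambda>x. cloop g (len (B x)) (E x) (len (C x)) (S x))"
proof -
  define G where "G z = Node (left z)
    (clamp (len (left (left z))) (g (Node (right (left z)) (right z))))" for z
  have G: "(G ^^ m) (Node (Node b e) s) = Node (Node b e) (cloop g (len b) e m s)" for m b e s
    by (induction m) (auto simp: G_def cloop_def)
  have "polytime (\<lambda>x. (G ^^ len (C x)) (Node (Node (B x) (E x)) (S x)))"
  proof (rule polytime_funpow)
    show "polytime G"
      unfolding G_def[abs_def]
      by (intro polytime_intros polytime_clamp polytime_comp[OF g])
    show "pbounded (\<lambda>x. 3 + bits (B x) + bits (E x) + bits (S x) + bits (B x))"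
      using assms by (intro pbounded_intros polytime_pbounded)
    fix x m
    have "bits (cloop g (len (B x)) (E x) m (S x)) \<le> bits (S x) + (1 + bits (B x))"
    proof (cases m)
      case (Suc m')
      then show ?thesis
        using bits_clamp[of "len (B x)"] len_le_bits[of "B x"]
        by (auto simp: cloop_def intro: order_trans trans_le_add2)
    qed (simp add: cloop_def)
    then show "bits ((G ^^ m) (Node (Node (B x) (E x)) (S x)))
        \<le> 3 + bits (B x) + bits (E x) + bits (S x) + bits (B x)"
      by (simp add: G)
  qed (intro polytime_intros assms)+
  then show ?thesis
    using polytime_right by (fastforce simp: G)
qed

lemma cloop_0 [simp]: "cloop g b e 0 s = s"
  by (simp add: cloop_def)

lemma cloop_Suc: "bits (g (Node e s)) \<le> b \<Longrightarrow> cloop g b e (Suc m) s = cloop g b e m (g (Node e s))"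
  by (simp add: cloop_def clamp_def funpow_Suc_right del: funpow.simps(2))

lemma cloop_eq:
  assumes "\<And>i. i < m \<Longrightarrow> g (Node e (st i)) = st (Suc i)" "\<And>i. i < m \<Longrightarrow> bits (st (Suc i)) \<le> b"
  shows "cloop g b e m (st 0) = st m"
  using assms
proof (induction m arbitrary: st)
  case (Suc m)
  have "cloop g b e (Suc m) (st 0) = cloop g b e m (st (Suc 0))"
    using Suc.prems[of 0] by (subst cloop_Suc) auto
  also have "\<dots> = st (Suc m)"
    using Suc.IH[of "\<lambda>i. st (Suc i)"] Suc.prems by auto
  finally show ?case .
qed simp


subsection \<open>Fast exponentiation\<close>

text \<open>Right-to-left square and multiply on the triple of accumulator, current square and
  remaining exponent. \<open>M\<close> also receives the environment, which names the group.\<close>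

definition pow_step :: "(data \<Rightarrow> data) \<Rightarrow> data \<Rightarrow> data" where
  "pow_step M z = Node
     (if int_of (right (right (right z))) mod 2 = 1
      then M (Node (left z) (Node (left (right z)) (left (right (right z))))) else left (right z))
     (Node (M (Node (left z) (Node (left (right (right z))) (left (right (right z))))))
       (Atom (int_of (right (right (right z))) div 2)))"

text \<open>
  There is no neutral element to start from, so the result is \<open>x * x^c\<close>.
\<close>

definition fast_pow :: "(data \<Rightarrow> data) \<Rightarrow> nat \<Rightarrow> data \<Rightarrow> data \<Rightarrow> int \<Rightarrow> data" where
  "fast_pow M b e x c = left (cloop (pow_step M) b e b (Node x (Node x (Atom c))))"

lemma polytime_fast_pow:
  assumes "polytime M" "polytime B" "polytime E" "polytime F" "polytime (\<lambda>x. Atom (c x))"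
  shows "polytime (\<lambda>x. fast_pow M (len (B x)) (E x) (F x) (c x))"
proof -
  have "polytime (pow_step M)"
    unfolding pow_step_def[abs_def] by (intro polytime_intros polytime_comp[OF assms(1)])
  then show ?thesis
    unfolding fast_pow_def by (intro polytime_intros polytime_cloop assms)
qed

text \<open>\<open>val\<close> abstracts from the structure, so that the lemma covers powers in a
  group as well as powers modulo q. The bound 3 + 2 \<open>B\<close> + \<open>m\<close> is the size
  of a state: two nodes, two values and an exponent of at most \<open>m\<close> digits.\<close>

lemma fast_pow_eq:
  assumes M: "\<And>i j. 0 < i \<Longrightarrow> 0 < j \<Longrightarrow> M (Node e (Node (val i) (val j))) = val (i + j)"
    and bits: "\<And>i. 0 < i \<Longrightarrow> bits (val i) \<le> B"
    and c: "c < 2 ^ m" "m \<le> b" "3 + 2 * B + m \<le> b"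
  shows "fast_pow M b e (val 1) (int c) = val (Suc c)"
proof -
  \<comment> \<open>The loop invariant: digits below position i are already in the accumulator,
    which starts at \<open>val 1\<close> instead of a neutral element.\<close>
  define st where "st i = Node (val (1 + c mod 2 ^ i)) (Node (val (2 ^ i)) (Atom (int (c div 2 ^ i))))" for i
  have step: "pow_step M (Node e (st i)) = st (Suc i)" for i
  proof -
    have "c mod 2 ^ Suc i = (if c div 2 ^ i mod 2 = 1 then c mod 2 ^ i + 2 ^ i else c mod 2 ^ i)"
      using mod_mult2_eq[of c "2 ^ i" 2] by (auto simp: mult.commute mod2_eq_if split: if_splits)
    moreover have "c div 2 ^ Suc i = c div 2 ^ i div 2"
      by (simp only: power_Suc2 div_mult2_eq)
    moreover have "int (c div 2 ^ i) mod 2 = 1 \<longleftrightarrow> c div 2 ^ i mod 2 = 1"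
      by (metis of_nat_1 of_nat_eq_iff of_nat_mod of_nat_numeral)
    moreover have "2 ^ i + 2 ^ i = (2::nat) ^ Suc i" by simp
    moreover have "M (Node e (Node (val (2 ^ i)) (val (2 ^ i)))) = val (2 ^ i + 2 ^ i)"
      "M (Node e (Node (val (1 + c mod 2 ^ i)) (val (2 ^ i)))) = val (1 + c mod 2 ^ i + 2 ^ i)"
      by (rule M; simp)+
    ultimately show ?thesis
      unfolding st_def pow_step_def by (simp add: zdiv_int del: power_Suc)
  qed
  have size: "bits (st i) \<le> b" for i
  proof -
    have "bits (Atom (int (c div 2 ^ i))) \<le> 1 + m"
    proof (rule bits_Atom_le)
      have "c div 2 ^ i < 2 ^ m"
        using c(1) by (meson div_le_dividend le_less_trans)
      then show "\<bar>int (c div 2 ^ i)\<bar> < 2 ^ m"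
        by (metis abs_of_nat of_nat_less_iff of_nat_numeral of_nat_power)
    qed
    moreover have "bits (val (1 + c mod 2 ^ i)) \<le> B" "bits (val (2 ^ i)) \<le> B"
      by (auto intro: bits)
    ultimately show ?thesis using c(3) by (simp add: st_def)
  qed
  have "c < 2 ^ b"
    using c(1,2) by (meson less_le_trans one_le_numeral power_increasing)
  \<comment> \<open>The loop runs \<open>b\<close> rounds, at least the number of digits of
    \<open>c\<close>. Surplus rounds see the exponent 0 and leave the accumulator alone.\<close>
  have "cloop (pow_step M) b e b (st 0) = st b"
    using step size by (intro cloop_eq) auto
  then show ?thesis
    using \<open>c < 2 ^ b\<close> by (simp add: fast_pow_def st_def)
qed

section \<open>Costed computations\<close>

lemma outcome_bind [simp]: "outcome (bind_costed m g) = bind_pmf (outcome m) (\<lambda>x. outcome (g x))"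
  by (simp add: outcome_def bind_costed_def map_bind_pmf bind_map_pmf case_prod_beta map_pmf_def
      bind_assoc_pmf bind_return_pmf)

lemma outcome_result [simp]: "outcome (result x) = return_pmf x"
  and outcome_unit_op [simp]: "outcome (unit_op x) = return_pmf x"
  and outcome_sample [simp]: "outcome (sample S) = pmf_of_set S"
  by (simp_all add: outcome_def result_def unit_op_def sample_def map_pmf_comp)

lemma costs_bind:
  assumes "costs m \<subseteq> A" "\<And>x. costs (g x) \<subseteq> B" "\<And>a b. a \<in> A \<Longrightarrow> b \<in> B \<Longrightarrow> a + b \<in> C"
  shows "costs (bind_costed m g) \<subseteq> C"
  using assms by (fastforce simp: costs_def bind_costed_def)

lemma costs_result [simp]: "costs (result x) = {0}"
  and costs_unit_op [simp]: "costs (unit_op x) = {1}"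
  and costs_sample [simp]: "costs (sample S) = {1}"
  by (auto simp: costs_def result_def unit_op_def sample_def set_pmf_not_empty image_image
      image_constant_conv)

lemma costs_op_le:
  "costs (mult_op G x y) \<subseteq> {..1}" "costs (div_op G x y) \<subseteq> {..1}" "costs (pow_op G x a) \<subseteq> {..1}"
  "costs (map_op \<Gamma> i j x y) \<subseteq> {..1}" "costs (mult_mod_op m c d) \<subseteq> {..1}"
  "costs (unit_op z) \<subseteq> {..1}" "costs (decrypt_op G Y x y) \<subseteq> {..1}" "costs (sample S) \<subseteq> {..1}"
  "costs (result z) \<subseteq> {..0}"
  by (simp_all add: mult_op_def div_op_def pow_op_def map_op_def mult_mod_op_def decrypt_op_def)

lemma costs_bind_le:
  assumes "costs m \<subseteq> {..c}" "\<And>x. costs (g x) \<subseteq> {..d}"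
  shows "costs (bind_costed m g) \<subseteq> {..c + d}"
  by (rule costs_bind[OF assms]) auto

lemma costs_mono: "costs m \<subseteq> {..c} \<Longrightarrow> c \<le> d \<Longrightarrow> costs m \<subseteq> {..d}"
  by auto

lemma costs_pe_encode: "costs (pe_encode pk m a) \<subseteq> {..5 * m}"
proof (induction m arbitrary: a)
  case (Suc m)
  have "costs (pe_encode pk (Suc m) a) \<subseteq> {..1 + (1 + (1 + (1 + (1 + (5 * m + 0)))))}"
    unfolding pe_encode.simps Let_def by (intro costs_bind_le costs_op_le Suc)
  then show ?case by (rule costs_mono) simp
qed simp

lemma costs_pe_probgen: "costs (pe_probgen k pk sk x) \<subseteq> {..5 * k}"
  using costs_bind_le[OF costs_pe_encode costs_op_le(9)] unfolding pe_probgen_def by fastforce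

lemma costs_pe_verify: "costs (pe_verify M k pk sk x \<tau> \<rho>\<pi>) \<subseteq> {..15}"
proof -
  have opt: "costs (case d of None \<Rightarrow> result None | Some y \<Rightarrow> g y) \<subseteq> {..c}"
    if "\<And>y. costs (g y) \<subseteq> {..c}" for d :: "'a option" and g :: "'a \<Rightarrow> 'b option costed" and c
    using that by (cases d) auto
  have cond: "costs (if b then result None else m) \<subseteq> {..c}" if "costs m \<subseteq> {..c}"
    for b and m :: "'b option costed" and c
    using that by auto
  obtain \<rho> \<pi> where [simp]: "\<rho>\<pi> = (\<rho>, \<pi>)" by (cases \<rho>\<pi>)
  have "costs (pe_verify M k pk sk x \<tau> \<rho>\<pi>) \<subseteq>
      {..1 + (1 + (1 + (1 + (1 + (1 + (1 + (1 + (1 + (1 + (1 + (1 + (1 + (1 + (1 + 0))))))))))))))}"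
    unfolding pe_verify_def \<open>\<rho>\<pi> = (\<rho>, \<pi>)\<close> prod.case Let_def
    by (intro costs_bind_le costs_op_le opt cond)
  then show ?thesis by (rule costs_mono) simp
qed

lemma costs_horner: "costs (horner q f x n m) \<subseteq> {2 * m}"
proof (induction m)
  case (Suc m)
  show ?case
    unfolding horner.simps mult_mod_op_def add_mod_op_def
    by (rule costs_bind[OF Suc], rule costs_bind[of _ "{1}" _ "{1}" "{2}"]) auto
qed simp

text \<open>Encoding costs 5 operations for each of the k levels, verification at most 15 in all,
  and Horner's rule exactly 2n. One logarithmic \<open>T\<close> bounds both client tasks; its extra
  1 pays for rounding the logarithm up.\<close>

lemma pe_outsourced: "outsourced (pe_scheme \<G> D M) (pe_family \<G> D M)"
proof -
  define T where "T n = 5 * (log 2 (real n + 1) + 1) + 20" for n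
  define t where "t n = 2 * real n" for n :: nat
  have "T \<in> o(t)"
    unfolding T_def[abs_def] t_def[abs_def] by real_asymp
  moreover have "t \<in> \<Theta>(\<lambda>n. real n)"
    unfolding t_def[abs_def] by real_asymp
  moreover have T: "real (5 * ceillog2 (n + 1) + 15) \<le> T n" if "n \<ge> 1" for n
    using ceillog2_less_log[of "n + 1"] that by (simp add: T_def add.commute)
  have "real c \<le> T n" if "c \<in> costs (pe_probgen (ceillog2 (n + 1)) pk sk x)" "n \<ge> 1" for c n pk sk x
    using costs_pe_probgen that T[OF that(2)] by fastforce
  moreover have "real c \<le> T n"
    if "c \<in> costs (pe_verify M (ceillog2 (n + 1)) pk sk x \<tau> \<rho>\<pi>)" "n \<ge> 1" for c n pk sk x \<tau> \<rho>\<pi>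
    using costs_pe_verify that T[OF that(2)] by fastforce
  moreover have "real c = t n" if "c \<in> costs (horner (int (sk_q sk)) f x n n)" for c n sk f x
    using costs_horner that by (fastforce simp: t_def)
  ultimately show ?thesis
    unfolding outsourced_def
    by (intro exI[of _ T] exI[of _ t]) (auto simp: pe_scheme_def Let_def)
qed


section \<open>Exponents\<close>

locale mlm_instance =
  fixes \<Gamma> :: mlm and p q \<kappa> :: nat
  assumes primes: "prime p" "prime q" "p \<noteq> q"
    and modulus: "modulus \<Gamma> = p * q"
    and is_mlm: "is_mlm \<kappa> \<Gamma>"
begin

definition N :: nat where "N = p * q"

text \<open>Every element of G_i is \<open>ex i a\<close> with a unique modulo N. All statements
  about groups and maps become congruences of exponents.\<close>

definition ex :: "nat \<Rightarrow> int \<Rightarrow> data" where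
  "ex i a = gen \<Gamma> i [^]\<^bsub>grp \<Gamma> i\<^esub> a"

lemma modulus_eq: "modulus \<Gamma> = N"
  by (simp add: N_def modulus)

lemma N_pos: "0 < N"
  using primes by (simp add: N_def prime_gt_0_nat)

lemma grp:
  assumes "1 \<le> i" "i \<le> \<kappa>"
  shows group_grp: "group (grp \<Gamma> i)" and gen_closed: "gen \<Gamma> i \<in> carrier (grp \<Gamma> i)"
    and generate_gen: "generate (grp \<Gamma> i) {gen \<Gamma> i} = carrier (grp \<Gamma> i)"
    and order_grp: "Coset.order (grp \<Gamma> i) = N"
  using is_mlm assms by (auto simp: is_mlm_def modulus_eq)

lemma ex_closed: "1 \<le> i \<Longrightarrow> i \<le> \<kappa> \<Longrightarrow> ex i a \<in> carrier (grp \<Gamma> i)"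
  unfolding ex_def using group.int_pow_closed[OF group_grp gen_closed] by blast

lemma carrier_ex: "1 \<le> i \<Longrightarrow> i \<le> \<kappa> \<Longrightarrow> carrier (grp \<Gamma> i) = range (ex i)"
  unfolding ex_def using group.generate_pow[OF group_grp gen_closed] generate_gen by auto

lemma ex_mult: "1 \<le> i \<Longrightarrow> i \<le> \<kappa> \<Longrightarrow> ex i a \<otimes>\<^bsub>grp \<Gamma> i\<^esub> ex i b = ex i (a + b)"
  unfolding ex_def using group.int_pow_mult[OF group_grp gen_closed] by simp

lemma ex_pow: "1 \<le> i \<Longrightarrow> i \<le> \<kappa> \<Longrightarrow> ex i a [^]\<^bsub>grp \<Gamma> i\<^esub> (b :: int) = ex i (a * b)"
  unfolding ex_def using group.int_pow_pow[OF group_grp gen_closed] by simp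

lemma ex_pow_nat: "1 \<le> i \<Longrightarrow> i \<le> \<kappa> \<Longrightarrow> ex i a [^]\<^bsub>grp \<Gamma> i\<^esub> (b :: nat) = ex i (a * int b)"
  using ex_pow[of i a "int b"] by (simp add: int_pow_int)

lemma ex_inv: "1 \<le> i \<Longrightarrow> i \<le> \<kappa> \<Longrightarrow> inv\<^bsub>grp \<Gamma> i\<^esub> (ex i a) = ex i (- a)"
  unfolding ex_def using group.int_pow_neg[OF group_grp gen_closed] by simp

lemma gen_eq: "1 \<le> i \<Longrightarrow> i \<le> \<kappa> \<Longrightarrow> gen \<Gamma> i = ex i 1"
  unfolding ex_def using group.int_pow_1[OF group_grp gen_closed] by simp

lemma gen_pow_nat: "1 \<le> i \<Longrightarrow> i \<le> \<kappa> \<Longrightarrow> gen \<Gamma> i [^]\<^bsub>grp \<Gamma> i\<^esub> (m :: nat) = ex i (int m)"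
  by (simp add: ex_def int_pow_int)

lemma ex_eq_iff: "1 \<le> i \<Longrightarrow> i \<le> \<kappa> \<Longrightarrow> ex i a = ex i b \<longleftrightarrow> [a = b] (mod int N)"
proof -
  assume i: "1 \<le> i" "i \<le> \<kappa>"
  have "group.ord (grp \<Gamma> i) (gen \<Gamma> i) = N"
    using group.generate_pow_card[OF group_grp gen_closed, OF i i] generate_gen[OF i] order_grp[OF i]
    by (simp add: Coset.order_def)
  then show ?thesis
    unfolding ex_def using group.int_pow_eq[OF group_grp gen_closed, OF i i, of a b]
    by (simp add: cong_iff_dvd_diff dvd_diff_commute)
qed

lemma ex_cong: "1 \<le> i \<Longrightarrow> i \<le> \<kappa> \<Longrightarrow> [a = b] (mod int N) \<Longrightarrow> ex i a = ex i b"
  by (simp add: ex_eq_iff)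

lemma ex_mod: "1 \<le> i \<Longrightarrow> i \<le> \<kappa> \<Longrightarrow> ex i (a mod int N) = ex i a"
  by (simp add: ex_eq_iff)

lemma pairing_ex:
  assumes "1 \<le> i" "1 \<le> j" "i + j \<le> \<kappa>"
  shows "pairing \<Gamma> i j (ex i a) (ex j b) = ex (i + j) (a * b)"
proof -
  \<comment> \<open>The map is specified on natural exponents only; integers are first replaced by
    their residues modulo N.\<close>
  have nn: "\<exists>m :: nat. ex l c = gen \<Gamma> l [^]\<^bsub>grp \<Gamma> l\<^esub> m \<and> [int m = c] (mod int N)"
    if "1 \<le> l" "l \<le> \<kappa>" for l c
    using that N_pos ex_mod[OF that, of c] gen_pow_nat[OF that, of "nat (c mod int N)"]
    by (intro exI[of _ "nat (c mod int N)"]) (auto simp: unique_euclidean_semiring_class.cong_def)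
  obtain m where m: "ex i a = gen \<Gamma> i [^]\<^bsub>grp \<Gamma> i\<^esub> m" "[int m = a] (mod int N)"
    using nn[of i a] assms by auto
  obtain m' where m': "ex j b = gen \<Gamma> j [^]\<^bsub>grp \<Gamma> j\<^esub> m'" "[int m' = b] (mod int N)"
    using nn[of j b] assms by auto
  have "pairing \<Gamma> i j (ex i a) (ex j b) = gen \<Gamma> (i + j) [^]\<^bsub>grp \<Gamma> (i + j)\<^esub> (m * m')"
    using is_mlm assms unfolding m(1) m'(1) by (auto simp: is_mlm_def)
  also have "\<dots> = ex (i + j) (int m * int m')"
    using assms by (subst gen_pow_nat) auto
  also have "\<dots> = ex (i + j) (a * b)"
    using assms m(2) m'(2) by (intro ex_cong cong_mult) auto
  finally show ?thesis .
qed

lemma comm_grp: "1 \<le> i \<Longrightarrow> i \<le> \<kappa> \<Longrightarrow> comm_group (grp \<Gamma> i)"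
  by (rule group.group_comm_groupI[OF group_grp]) (auto simp: carrier_ex ex_mult add.commute)

lemma finprod_ex:
  assumes "1 \<le> i" "i \<le> \<kappa>" "finite A"
  shows "finprod (grp \<Gamma> i) (\<lambda>j. ex i (c j)) A = ex i (\<Sum>j\<in>A. c j)"
proof -
  interpret comm_group "grp \<Gamma> i" using comm_grp assms by simp
  have one: "\<one>\<^bsub>grp \<Gamma> i\<^esub> = ex i 0" by (simp add: ex_def)
  show ?thesis
    using assms(3)
    by induction (auto simp: one ex_mult[OF assms(1,2)] ex_closed[OF assms(1,2)])
qed

lemma induced_map_ex:
  assumes "1 \<le> m" "m \<le> \<kappa>" "\<And>l. 1 \<le> l \<Longrightarrow> l \<le> m \<Longrightarrow> \<phi> l = ex 1 (a l)"
  shows "induced_map \<Gamma> m \<phi> = ex m (\<Prod>l=1..m. a l)"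
  using assms
proof (induction \<Gamma>\<equiv>\<Gamma> m \<phi> rule: induced_map.induct)
  case (2 i \<phi>)
  then have "induced_map \<Gamma> (Suc i) \<phi> = ex (Suc i) (\<Prod>l=1..Suc i. a l)" by simp
  then show ?case
    using 2(4)[of "Suc (Suc i)"] 2(2,3) pairing_ex[of "Suc i" 1] by (simp add: mult.commute)
qed auto

text \<open>The factors x^(2^(l - 1)) at the binary digits of i multiply to x^i;
  \<open>take_bit\<close> keeps the induction on the number of digits going.\<close>

lemma prod_bits: "(\<Prod>l=1..m. if bit i (l - 1) then x ^ 2 ^ (l - 1) else 1) = x ^ take_bit m i"
  for x :: int and i :: nat
proof (induction m)
  case (Suc m)
  then show ?case
    by (simp add: take_bit_Suc_from_most power_add mult.commute)
qed simp

lemma mod_N_imp_mod_q: "[a = b] (mod int N) \<Longrightarrow> [a = b] (mod int q)"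
  by (rule cong_dvd_modulus[of _ _ "int N"]) (auto simp: N_def)

text \<open>Cancelling p turns congruence modulo N = pq into congruence modulo q. It expresses that
  raising to the power p removes masks whose exponents are multiples of q.\<close>

lemma cong_p_mult: "[int p * a = int p * b] (mod int N) \<longleftrightarrow> [a = b] (mod int q)"
proof -
  have "int p \<noteq> 0" using primes(1) by auto
  have "int p * a - int p * b = int p * (a - b)" by (simp add: algebra_simps)
  then show ?thesis
    unfolding cong_iff_dvd_diff N_def of_nat_mult using \<open>int p \<noteq> 0\<close> by simp
qed

text \<open>The exponents are only congruent, not equal, to powers of x, since encodings carry an
  unknown multiple of q.\<close>

lemma induced_select:
  assumes "1 \<le> k" "k \<le> \<kappa>" "i < 2 ^ k" "length \<xi> = k"
    and "\<And>l. l < k \<Longrightarrow> \<exists>b. \<xi> ! l = ex 1 b \<and> [b = x ^ 2 ^ l] (mod m)"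
  shows "\<exists>b. induced_map \<Gamma> k (select (gen \<Gamma> 1) \<xi> i) = ex k b \<and> [b = x ^ i] (mod m)"
proof -
  obtain b where b: "\<And>l. l < k \<Longrightarrow> \<xi> ! l = ex 1 (b l) \<and> [b l = x ^ 2 ^ l] (mod m)"
    using assms(5) by metis
  let ?a = "\<lambda>l. if bit i (l - 1) then b (l - 1) else 1"
  have "induced_map \<Gamma> k (select (gen \<Gamma> 1) \<xi> i) = ex k (\<Prod>l=1..k. ?a l)"
    using assms b by (intro induced_map_ex) (auto simp: select_def gen_eq)
  moreover have "[(\<Prod>l=1..k. ?a l) = (\<Prod>l=1..k. if bit i (l - 1) then x ^ 2 ^ (l - 1) else 1)] (mod m)"
    using b by (intro cong_prod) auto
  moreover have "take_bit k i = i"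
    using assms(3) by (simp add: take_bit_nat_eq_self)
  ultimately show ?thesis
    by (metis prod_bits)
qed

end

section \<open>Keys, verification and honest computation in the exponent\<close>

definition pe_pub :: "mlm \<Rightarrow> nat \<Rightarrow> int poly \<Rightarrow> nat \<Rightarrow> data \<Rightarrow> pe_pk" where
  "pe_pub \<Gamma> k f s h = \<lparr>pk_inst = \<Gamma>, pk_g = gen \<Gamma> 1, pk_h = h,
     pk_s = map (\<lambda>i. gen \<Gamma> 1 [^]\<^bsub>grp \<Gamma> 1\<^esub> (s ^ (2 ^ i))) [0..<k], pk_f = f\<rparr>"

definition pe_sec :: "mlm \<Rightarrow> nat \<Rightarrow> nat \<Rightarrow> int poly \<Rightarrow> nat \<Rightarrow> pe_sk" where
  "pe_sec \<Gamma> p q f s = \<lparr>sk_p = p, sk_q = q, sk_s = s, sk_t = gen \<Gamma> 1 [^]\<^bsub>grp \<Gamma> 1\<^esub> poly f (int s)\<rparr>"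

lemma pe_pub_sel [simp]:
  "pk_inst (pe_pub \<Gamma> k f s h) = \<Gamma>" "pk_g (pe_pub \<Gamma> k f s h) = gen \<Gamma> 1" "pk_h (pe_pub \<Gamma> k f s h) = h"
  "pk_s (pe_pub \<Gamma> k f s h) = map (\<lambda>i. gen \<Gamma> 1 [^]\<^bsub>grp \<Gamma> 1\<^esub> (s ^ (2 ^ i))) [0..<k]"
  "pk_f (pe_pub \<Gamma> k f s h) = f"
  by (simp_all add: pe_pub_def)

lemma pe_sec_sel [simp]:
  "sk_p (pe_sec \<Gamma> p q f s) = p" "sk_q (pe_sec \<Gamma> p q f s) = q" "sk_s (pe_sec \<Gamma> p q f s) = s"
  "sk_t (pe_sec \<Gamma> p q f s) = gen \<Gamma> 1 [^]\<^bsub>grp \<Gamma> 1\<^esub> poly f (int s)"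
  by (simp_all add: pe_sec_def)

text \<open>Presents the keys as functions of s and h, so that a reduction can supply its own s or
  an h from another distribution.\<close>

lemma pe_keygen_eq: "pe_keygen \<G> k \<eta> f = do {
    (p, q, \<Gamma>) \<leftarrow> \<G> \<eta> (2 * k + 1);
    s \<leftarrow> pmf_of_set {0..<modulus \<Gamma>};
    u \<leftarrow> pmf_of_set (carrier (grp \<Gamma> 1));
    return_pmf (pe_pub \<Gamma> k f s (u [^]\<^bsub>grp \<Gamma> 1\<^esub> q), pe_sec \<Gamma> p q f s)
  }"
  by (simp add: pe_keygen_def pe_pub_def pe_sec_def Let_def)

definition pe_verdict :: "(nat \<Rightarrow> int set) \<Rightarrow> nat \<Rightarrow> pe_pk \<Rightarrow> pe_sk \<Rightarrow> int \<Rightarrow> data \<times> data \<Rightarrow> int option" where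
  "pe_verdict M k pk sk \<alpha> \<rho>\<pi> = (let \<Gamma> = pk_inst pk; G = grp \<Gamma>; g1 = pk_g pk; p = int (sk_p sk);
     \<rho> = fst \<rho>\<pi>; \<pi> = snd \<rho>\<pi>; fits = (\<lambda>y. y \<in> M (sk_q sk) \<and>
       \<rho> [^]\<^bsub>G k\<^esub> p = (gen \<Gamma> k [^]\<^bsub>G k\<^esub> p) [^]\<^bsub>G k\<^esub> y); y = (SOME y. fits y) in
     if \<rho> \<in> carrier (G k) \<and> \<pi> \<in> carrier (G (2 * k)) \<and> (\<exists>y. fits y) \<and>
       pairing \<Gamma> 1 (2 * k) (sk_t sk \<otimes>\<^bsub>G 1\<^esub> inv\<^bsub>G 1\<^esub> (g1 [^]\<^bsub>G 1\<^esub> y))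
         (gen \<Gamma> (2 * k) [^]\<^bsub>G (2 * k)\<^esub> p) =
       pairing \<Gamma> 1 (2 * k) ((g1 [^]\<^bsub>G 1\<^esub> int (sk_s sk)) \<otimes>\<^bsub>G 1\<^esub> inv\<^bsub>G 1\<^esub> (g1 [^]\<^bsub>G 1\<^esub> \<alpha>))
         (\<pi> [^]\<^bsub>G (2 * k)\<^esub> p)
     then Some y else None)"

lemma outcome_pe_verify:
  "outcome (pe_verify M k pk sk \<alpha> \<tau> \<rho>\<pi>) = return_pmf (pe_verdict M k pk sk \<alpha> \<rho>\<pi>)"
proof -
  obtain \<rho> \<pi> where [simp]: "\<rho>\<pi> = (\<rho>, \<pi>)" by (cases \<rho>\<pi>)
  show ?thesis
    by (auto simp: pe_verify_def pe_verdict_def Let_def bind_return_pmf mult_op_def div_op_def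
        pow_op_def map_op_def decrypt_op_def split: option.splits)
qed

context mlm_instance
begin

text \<open>Both tests of the client equate p-th powers, hence amount to congruences modulo q of the
  exponents. This criterion serves correctness, where it is verified, and security, where it is
  exploited.\<close>

lemma pe_verdict_eq_Some_iff:
  assumes k: "1 \<le> k" "\<kappa> = 2 * k + 1" and M: "M q \<subseteq> {0..<int q}"
  shows "pe_verdict M k (pe_pub \<Gamma> k f s h) (pe_sec \<Gamma> p q f s) \<alpha> (ex k r, ex (2 * k) w) = Some y \<longleftrightarrow>
    y \<in> M q \<and> [r = y] (mod int q) \<and> [poly f (int s) - y = (int s - \<alpha>) * w] (mod int q)"
proof -
  define fits where "fits y \<longleftrightarrow> y \<in> M q \<and>
      ex k r [^]\<^bsub>grp \<Gamma> k\<^esub> int p = (gen \<Gamma> k [^]\<^bsub>grp \<Gamma> k\<^esub> int p) [^]\<^bsub>grp \<Gamma> k\<^esub> y" for y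
  have fits: "fits y \<longleftrightarrow> y \<in> M q \<and> [r = y] (mod int q)" for y
    using k unfolding fits_def
    by (simp add: gen_eq ex_pow ex_eq_iff mult.commute[of r] cong_p_mult)
  \<comment> \<open>Decryption is unambiguous: \<open>M q\<close> consists of least residues, so two
    fitting values are equal. This disposes of the choice operator.\<close>
  have unique: "y = y'" if "fits y" "fits y'" for y y'
  proof -
    have "[y = y'] (mod int q)"
      using that fits by (meson cong_sym cong_trans)
    moreover have "y \<in> {0..<int q}" "y' \<in> {0..<int q}"
      using that fits M by auto
    ultimately show ?thesis
      by (auto simp: unique_euclidean_semiring_class.cong_def)
  qed
  have chosen: "(SOME y. fits y) = y" if "fits y" for y
    using that unique by (metis someI)
  have eq: "pairing \<Gamma> 1 (2 * k)
      ((gen \<Gamma> 1 [^]\<^bsub>grp \<Gamma> 1\<^esub> poly f (int s)) \<otimes>\<^bsub>grp \<Gamma> 1\<^esub> inv\<^bsub>grp \<Gamma> 1\<^esub> (gen \<Gamma> 1 [^]\<^bsub>grp \<Gamma> 1\<^esub> y))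
        (gen \<Gamma> (2 * k) [^]\<^bsub>grp \<Gamma> (2 * k)\<^esub> int p) =
      pairing \<Gamma> 1 (2 * k)
      ((gen \<Gamma> 1 [^]\<^bsub>grp \<Gamma> 1\<^esub> int s) \<otimes>\<^bsub>grp \<Gamma> 1\<^esub> inv\<^bsub>grp \<Gamma> 1\<^esub> (gen \<Gamma> 1 [^]\<^bsub>grp \<Gamma> 1\<^esub> \<alpha>))
        (ex (2 * k) w [^]\<^bsub>grp \<Gamma> (2 * k)\<^esub> int p) \<longleftrightarrow>
      [poly f (int s) - y = (int s - \<alpha>) * w] (mod int q)" for y
  proof -
    have "ex (1 + 2 * k) ((poly f (int s) - y) * int p) = ex (1 + 2 * k) ((int s - \<alpha>) * (w * int p)) \<longleftrightarrow>
        [int p * (poly f (int s) - y) = int p * ((int s - \<alpha>) * w)] (mod int N)"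
      using k by (subst ex_eq_iff) (auto simp: mult.commute mult.left_commute)
    then show ?thesis
      using k unfolding cong_p_mult by (simp add: gen_eq ex_pow ex_inv ex_mult pairing_ex)
  qed
  have "pe_verdict M k (pe_pub \<Gamma> k f s h) (pe_sec \<Gamma> p q f s) \<alpha> (ex k r, ex (2 * k) w) = Some y \<longleftrightarrow>
      (\<exists>y. fits y) \<and> (SOME y. fits y) = y \<and> [poly f (int s) - (SOME y. fits y) = (int s - \<alpha>) * w] (mod int q)"
    unfolding pe_verdict_def Let_def pe_pub_sel pe_sec_sel fst_conv snd_conv fits_def[symmetric] eq
    using k by (auto simp: ex_closed)
  also have "\<dots> \<longleftrightarrow> fits y \<and> [poly f (int s) - y = (int s - \<alpha>) * w] (mod int q)"
    using chosen by (metis someI_ex)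
  finally show ?thesis
    by (simp add: fits)
qed

lemma pe_verdict_imp_carrier:
  assumes "pe_verdict M k (pe_pub \<Gamma> k f s h) sk \<alpha> (\<rho>, \<pi>) \<noteq> None"
  shows "\<rho> \<in> carrier (grp \<Gamma> k)" "\<pi> \<in> carrier (grp \<Gamma> (2 * k))"
  using assms by (auto simp: pe_verdict_def Let_def split: if_splits)

text \<open>The hypothesis that q divides c says that h lies in the subgroup of q-th powers; a mask
  then changes the exponent by a multiple of q only.\<close>

lemma set_pmf_pe_encode:
  assumes "\<sigma> \<in> set_pmf (outcome (pe_encode (pe_pub \<Gamma> k f s (ex 1 c)) m a))" "int q dvd c" "1 \<le> \<kappa>"
  shows "length \<sigma> = m \<and> (\<forall>l<m. \<exists>b. \<sigma> ! l = ex 1 b \<and> [b = a ^ 2 ^ l] (mod int q))"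
  using assms(1)
proof (induction m arbitrary: a \<sigma>)
  case (Suc m)
  then obtain r \<sigma>' where r: "\<sigma> = ex 1 (a + c * int r) # \<sigma>'"
    and \<sigma>': "\<sigma>' \<in> set_pmf (outcome (pe_encode (pe_pub \<Gamma> k f s (ex 1 c)) m ((a * a) mod int N)))"
    using assms(3) by (auto simp: Let_def pow_op_def mult_op_def mult_mod_op_def bind_return_pmf
        modulus_eq gen_eq ex_pow ex_mult)
  note IH = Suc.IH[OF \<sigma>']
  have "\<exists>b. \<sigma> ! l = ex 1 b \<and> [b = a ^ 2 ^ l] (mod int q)" if "l < Suc m" for l
  proof (cases l)
    case 0
    have "[a + c * int r = a] (mod int q)"
      using assms(2) by (simp add: cong_iff_dvd_diff)
    then show ?thesis using 0 r by auto
  next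
    case (Suc l')
    then have "l' < m" using that by simp
    then obtain b where b: "\<sigma>' ! l' = ex 1 b" "[b = (a * a mod int N) ^ 2 ^ l'] (mod int q)"
      using IH by blast
    have "[(a * a mod int N) ^ 2 ^ l' = (a * a) ^ 2 ^ l'] (mod int q)"
      by (intro cong_pow mod_N_imp_mod_q) auto
    moreover have "(a * a) ^ 2 ^ l' = a ^ 2 ^ l"
      by (simp add: Suc power_mult power2_eq_square)
    ultimately show ?thesis
      using b Suc r by (metis cong_trans nth_Cons_Suc)
  qed
  then show ?case using IH r by simp
qed simp

text \<open>
  The exponents of the honest pair satisfy \<open>f(s) - f(\<alpha>) = (s - \<alpha>) c(s)\<close> modulo \<open>q\<close>, where
  \<open>c(s) = (\<Sum>i<n. \<Sum>j\<le>i. f\<^sub>i\<^sub>+\<^sub>1 \<alpha>^j s^(i - j))\<close>.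
\<close>

lemma poly_diff_factor:
  fixes f :: "int poly"
  assumes "degree f \<le> n" "1 \<le> n"
  shows "poly f x - poly f a =
    (x - a) * (\<Sum>i=0..n - 1. \<Sum>j=0..i. a ^ j * x ^ (i - j) * coeff f (i + 1))"
proof -
  have altdef: "poly f y = (\<Sum>i\<le>n. coeff f i * y ^ i)" for y
    unfolding poly_altdef using assms(1)
    by (intro sum.mono_neutral_left) (auto intro: coeff_eq_0)
  have "poly f x - poly f a = (\<Sum>i\<le>n. coeff f i * (x ^ i - a ^ i))"
    by (simp add: altdef sum_subtractf right_diff_distrib)
  also have "\<dots> = (\<Sum>i\<le>n - 1. coeff f (Suc i) * (x ^ Suc i - a ^ Suc i))"
    using assms(2) sum.atMost_Suc_shift[of "\<lambda>i. coeff f i * (x ^ i - a ^ i)" "n - 1"] by simp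
  also have "\<dots> = (\<Sum>i\<le>n - 1. (x - a) * (\<Sum>j\<le>i. a ^ j * x ^ (i - j) * coeff f (i + 1)))"
  proof (rule sum.cong[OF refl])
    fix i
    have "x ^ Suc i - a ^ Suc i = (x - a) * (\<Sum>j\<le>i. a ^ j * x ^ (i - j))"
      using diff_power_eq_sum[of x i a] sum.nat_diff_reindex[of "\<lambda>j. x ^ j * a ^ (i - j)" "Suc i"]
      by (simp add: lessThan_Suc_atMost mult.commute)
    then show "coeff f (Suc i) * (x ^ Suc i - a ^ Suc i) =
        (x - a) * (\<Sum>j\<le>i. a ^ j * x ^ (i - j) * coeff f (i + 1))"
      by (simp add: sum_distrib_right sum_distrib_left mult.commute mult.left_commute)
  qed
  finally show ?thesis
    by (simp add: atLeast0AtMost sum_distrib_left)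
qed

text \<open>Modulo q the masks vanish and the pair is the one computed from the bare powers of
  \<alpha> and s. The last congruence is the factorization of f(s) - f(\<alpha>) by s -
  \<alpha>.\<close>

lemma pe_compute_ex:
  assumes n: "1 \<le> n" "n < 2 ^ k" and k: "1 \<le> k" "\<kappa> = 2 * k + 1" and f: "degree f \<le> n"
    and \<sigma>: "length \<sigma> = k" "\<And>l. l < k \<Longrightarrow> \<exists>b. \<sigma> ! l = ex 1 b \<and> [b = \<alpha> ^ 2 ^ l] (mod int q)"
  obtains r w where "pe_compute n k (pe_pub \<Gamma> k f s h) \<sigma> = (ex k r, ex (2 * k) w)"
    "[r = poly f \<alpha>] (mod int q)" "[poly f (int s) - poly f \<alpha> = (int s - \<alpha>) * w] (mod int q)"
proof -
  let ?S = "map (\<lambda>i. gen \<Gamma> 1 [^]\<^bsub>grp \<Gamma> 1\<^esub> (s ^ (2 ^ i))) [0..<k]"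
  have "\<exists>b. induced_map \<Gamma> k (select (gen \<Gamma> 1) \<sigma> i) = ex k b \<and> [b = \<alpha> ^ i] (mod int q)" if "i \<le> n" for i
    using that n k \<sigma> by (intro induced_select) auto
  then obtain a where a: "\<And>i. i \<le> n \<Longrightarrow> induced_map \<Gamma> k (select (gen \<Gamma> 1) \<sigma> i) = ex k (a i)"
      "\<And>i. i \<le> n \<Longrightarrow> [a i = \<alpha> ^ i] (mod int q)"
    by metis
  have "\<exists>b. induced_map \<Gamma> k (select (gen \<Gamma> 1) ?S i) = ex k b \<and> [b = int s ^ i] (mod int q)" if "i \<le> n" for i
    using that n k by (intro induced_select) (auto simp: gen_pow_nat)
  then obtain b where b: "\<And>i. i \<le> n \<Longrightarrow> induced_map \<Gamma> k (select (gen \<Gamma> 1) ?S i) = ex k (b i)"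
      "\<And>i. i \<le> n \<Longrightarrow> [b i = int s ^ i] (mod int q)"
    by metis
  define r where "r = (\<Sum>i=0..n. a i * coeff f i)"
  define w where "w = (\<Sum>i=0..n - 1. \<Sum>j=0..i. a j * b (i - j) * coeff f (i + 1))"
  interpret Gk: comm_group "grp \<Gamma> k" using comm_grp k by simp
  interpret G2k: comm_group "grp \<Gamma> (2 * k)" using comm_grp k by simp
  have \<rho>: "finprod (grp \<Gamma> k) (\<lambda>i. induced_map \<Gamma> k (select (gen \<Gamma> 1) \<sigma> i) [^]\<^bsub>grp \<Gamma> k\<^esub> coeff f i) {0..n}
      = ex k r"
  proof -
    have "finprod (grp \<Gamma> k) (\<lambda>i. induced_map \<Gamma> k (select (gen \<Gamma> 1) \<sigma> i) [^]\<^bsub>grp \<Gamma> k\<^esub> coeff f i) {0..n} =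
        finprod (grp \<Gamma> k) (\<lambda>i. ex k (a i * coeff f i)) {0..n}"
      using k by (intro Gk.finprod_cong') (auto simp: a[unfolded One_nat_def] ex_pow ex_closed)
    then show ?thesis
      unfolding r_def using k by (simp add: finprod_ex)
  qed
  have \<pi>: "finprod (grp \<Gamma> (2 * k)) (\<lambda>i. finprod (grp \<Gamma> (2 * k))
      (\<lambda>j. pairing \<Gamma> k k (induced_map \<Gamma> k (select (gen \<Gamma> 1) \<sigma> j))
         (induced_map \<Gamma> k (select (gen \<Gamma> 1) ?S (i - j))) [^]\<^bsub>grp \<Gamma> (2 * k)\<^esub> coeff f (i + 1)) {0..i}) {0..n - 1}
      = ex (2 * k) w"
  proof -
    have inner: "finprod (grp \<Gamma> (2 * k))
      (\<lambda>j. pairing \<Gamma> k k (induced_map \<Gamma> k (select (gen \<Gamma> 1) \<sigma> j))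
         (induced_map \<Gamma> k (select (gen \<Gamma> 1) ?S (i - j))) [^]\<^bsub>grp \<Gamma> (2 * k)\<^esub> coeff f (i + 1)) {0..i}
      = ex (2 * k) (\<Sum>j=0..i. a j * b (i - j) * coeff f (i + 1))" if "i \<le> n - 1" for i
    proof -
      have "finprod (grp \<Gamma> (2 * k))
      (\<lambda>j. pairing \<Gamma> k k (induced_map \<Gamma> k (select (gen \<Gamma> 1) \<sigma> j))
         (induced_map \<Gamma> k (select (gen \<Gamma> 1) ?S (i - j))) [^]\<^bsub>grp \<Gamma> (2 * k)\<^esub> coeff f (i + 1)) {0..i} =
        finprod (grp \<Gamma> (2 * k)) (\<lambda>j. ex (2 * k) (a j * b (i - j) * coeff f (i + 1))) {0..i}"
        using that k n pairing_ex[of k k]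
        by (intro G2k.finprod_cong') (auto simp: a[unfolded One_nat_def] b[unfolded One_nat_def] ex_pow ex_closed mult_2)
      then show ?thesis
        using k by (simp add: finprod_ex)
    qed
    then show ?thesis
      unfolding w_def using k
      by (subst G2k.finprod_cong'[OF refl, where g = "\<lambda>i. ex (2 * k) (\<Sum>j=0..i. a j * b (i - j) * coeff f (i + 1))"])
        (auto simp: ex_closed finprod_ex)
  qed
  have "pe_compute n k (pe_pub \<Gamma> k f s h) \<sigma> = (ex k r, ex (2 * k) w)"
    unfolding pe_compute_def Let_def pe_pub_sel \<rho> \<pi> ..
  moreover have "[r = poly f \<alpha>] (mod int q)"
  proof -
    have "poly f \<alpha> = (\<Sum>i=0..n. \<alpha> ^ i * coeff f i)"
      unfolding poly_altdef atLeast0AtMost using f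
      by (intro sum.mono_neutral_cong_left) (auto intro: coeff_eq_0)
    then show ?thesis
      unfolding r_def using a(2) by (auto intro!: cong_sum cong_mult)
  qed
  moreover have "[poly f (int s) - poly f \<alpha> = (int s - \<alpha>) * w] (mod int q)"
    unfolding poly_diff_factor[OF f n(1)] w_def using a(2) b(2) n(1)
    by (intro cong_mult cong_sum cong_refl) (auto intro: cong_sym)
  ultimately show ?thesis by (rule that)
qed

end

lemma enc_levels: "n \<ge> 1 \<Longrightarrow> 1 \<le> ceillog2 (n + 1) \<and> n < 2 ^ ceillog2 (n + 1)"
  using ceillog2_ge_iff[of "n + 1" 1] le_two_power_ceillog2[of "n + 1"] by simp

lemma multilinear_generatorD:
  assumes "multilinear_generator \<G> \<kappa>" "\<eta> \<ge> 2" "(p, q, \<Gamma>) \<in> set_pmf (\<G> \<eta> \<kappa>)"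
  shows "mlm_instance \<Gamma> p q \<kappa>" "floorlog 2 p = \<eta>" "floorlog 2 q = \<eta>"
  using assms by (auto simp: multilinear_generator_def mlm_instance_def)

lemma pe_correct:
  assumes "n \<ge> 1" "multilinear_generator \<G> (2 * ceillog2 (n + 1) + 1)" "small_subsets M"
  shows "correct (pe_scheme \<G> D M n) (pe_family \<G> D M n)"
proof -
  define k where "k = ceillog2 (n + 1)"
  have k: "1 \<le> k" "n < 2 ^ k"
    using enc_levels[OF assms(1)] by (auto simp: k_def)
  have "pe_verdict M k pk sk x (pe_compute n k pk \<sigma>) = Some (poly (f \<eta>) x mod int (sk_q sk))"
    if f: "f \<in> pe_family \<G> D M n" and \<eta>: "\<eta> \<ge> 2" and key: "(pk, sk) \<in> set_pmf (pe_keygen \<G> k \<eta> (f \<eta>))"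
      and x: "x \<in> D (sk_q sk)" and \<sigma>: "\<sigma> \<in> set_pmf (outcome (pe_encode pk k x))" for f \<eta> pk sk x \<sigma>
  proof -
    obtain p q \<Gamma> s u where G: "(p, q, \<Gamma>) \<in> set_pmf (\<G> \<eta> (2 * k + 1))"
      and u: "u \<in> set_pmf (pmf_of_set (carrier (grp \<Gamma> 1)))"
      and pk: "pk = pe_pub \<Gamma> k (f \<eta>) s (u [^]\<^bsub>grp \<Gamma> 1\<^esub> q)" and sk: "sk = pe_sec \<Gamma> p q (f \<eta>) s"
      using key by (auto simp: pe_keygen_eq)
    interpret mlm_instance \<Gamma> p q "2 * k + 1"
      using multilinear_generatorD[OF assms(2) \<eta>] G by (auto simp: k_def)
    have "finite (carrier (grp \<Gamma> 1))"
      using order_grp[of 1] N_pos by (auto simp: Coset.order_def intro: card_ge_0_finite)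
    moreover have "carrier (grp \<Gamma> 1) \<noteq> {}"
      using gen_closed[of 1] by auto
    ultimately obtain c where c: "u = ex 1 c"
      using u carrier_ex[of 1] by auto
    have pk': "pk = pe_pub \<Gamma> k (f \<eta>) s (ex 1 (c * int q))"
      by (simp add: pk c ex_pow_nat)
    have enc: "length \<sigma> = k" "\<And>l. l < k \<Longrightarrow> \<exists>b. \<sigma> ! l = ex 1 b \<and> [b = x ^ 2 ^ l] (mod int q)"
      using set_pmf_pe_encode[OF \<sigma>[unfolded pk']] by auto
    have deg: "degree (f \<eta>) \<le> n"
      using f by (simp add: pe_family_def)
    obtain r w where rw: "pe_compute n k pk \<sigma> = (ex k r, ex (2 * k) w)"
      "[r = poly (f \<eta>) x] (mod int q)" "[poly (f \<eta>) (int s) - poly (f \<eta>) x = (int s - x) * w] (mod int q)"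
      unfolding pk' by (rule pe_compute_ex[OF assms(1) k(2) k(1) refl deg enc])
    have "poly (f \<eta>) x mod int q \<in> M q"
      using f G \<eta> x by (fastforce simp: pe_family_def sk k_def)
    moreover have "M q \<subseteq> {0..<int q}"
      using assms(3) primes(2) by (auto simp: small_subsets_def)
    moreover have "[r = poly (f \<eta>) x mod int q] (mod int q)"
      using rw(2) by (simp add: unique_euclidean_semiring_class.cong_def)
    moreover have "[poly (f \<eta>) (int s) - poly (f \<eta>) x mod int q = (int s - x) * w] (mod int q)"
      using rw(3) by (simp add: unique_euclidean_semiring_class.cong_def mod_diff_right_eq)
    ultimately show ?thesis
      unfolding rw(1) unfolding pk' sk pe_sec_sel using k(1) by (subst pe_verdict_eq_Some_iff) auto
  qed
  then show ?thesis
    unfolding correct_def pe_scheme_def Let_def k_def[symmetric]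
    by (auto simp: outcome_pe_verify pe_probgen_def)
qed

section \<open>Sampling with random bits\<close>

text \<open>\<open>covers c P Q\<close> says that \<open>P\<close> is at least \<open>c\<close> times \<open>Q\<close>, pointwise. The random bits of a
  reduction only approximate uniform samples from \<open>\<int>\<^sub>N\<close>; the multiplicative form of the error is
  stable under composition.\<close>

definition covers :: "real \<Rightarrow> 'a pmf \<Rightarrow> 'a pmf \<Rightarrow> bool" where
  "covers c P Q \<longleftrightarrow> 0 \<le> c \<and> (\<forall>x. c * pmf Q x \<le> pmf P x)"

lemma covers_refl: "covers 1 P P"
  by (simp add: covers_def)

lemma covers_nonneg: "covers c P Q \<Longrightarrow> 0 \<le> c"
  by (simp add: covers_def)

lemma covers_mono: "covers c P Q \<Longrightarrow> 0 \<le> d \<Longrightarrow> d \<le> c \<Longrightarrow> covers d P Q"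
  unfolding covers_def by (meson mult_right_mono order_trans pmf_nonneg)

text \<open>A sum of products of nonnegative terms, so the two factors simply multiply. The second
  comparison is needed only on the support of the ideal distribution.\<close>

lemma covers_bind:
  assumes "covers c P Q" "\<And>x. x \<in> set_pmf Q \<Longrightarrow> covers d (F x) (G x)" "0 \<le> d"
  shows "covers (c * d) (bind_pmf P F) (bind_pmf Q G)"
  unfolding covers_def
proof (intro conjI allI)
  show "0 \<le> c * d"
    using assms(1,3) by (simp add: covers_def)
  fix y
  have c: "0 \<le> c" using assms(1) by (simp add: covers_def)
  have "ennreal (c * d * pmf (bind_pmf Q G) y) = ennreal (c * d) * (\<integral>\<^sup>+x. pmf (G x) y \<partial>measure_pmf Q)"
    using c assms(3) by (simp add: ennreal_mult ennreal_pmf_bind)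
  also have "\<dots> = (\<integral>\<^sup>+x. ennreal (c * d) * (ennreal (pmf Q x) * ennreal (pmf (G x) y)) \<partial>count_space UNIV)"
    by (simp add: nn_integral_measure_pmf nn_integral_cmult)
  also have "\<dots> \<le> (\<integral>\<^sup>+x. ennreal (pmf P x) * ennreal (pmf (F x) y) \<partial>count_space UNIV)"
  proof (rule nn_integral_mono)
    fix x
    have "c * d * (pmf Q x * pmf (G x) y) \<le> pmf P x * pmf (F x) y"
    proof (cases "x \<in> set_pmf Q")
      case True
      then have "(c * pmf Q x) * (d * pmf (G x) y) \<le> pmf P x * pmf (F x) y"
        using assms(1) assms(2)[OF True] assms(3) by (intro mult_mono) (auto simp: covers_def)
      then show ?thesis by (simp add: mult_ac)
    qed (simp add: set_pmf_iff)
    then show "ennreal (c * d) * (ennreal (pmf Q x) * ennreal (pmf (G x) y)) \<le>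
        ennreal (pmf P x) * ennreal (pmf (F x) y)"
      using c assms(3) by (simp flip: ennreal_mult)
  qed
  also have "\<dots> = ennreal (pmf (bind_pmf P F) y)"
    by (simp add: ennreal_pmf_bind nn_integral_measure_pmf)
  finally show "c * d * pmf (bind_pmf Q G) y \<le> pmf (bind_pmf P F) y"
    by simp
qed

lemma covers_bind_same:
  assumes "\<And>x. x \<in> set_pmf P \<Longrightarrow> covers d (F x) (G x)" "0 \<le> d"
  shows "covers d (bind_pmf P F) (bind_pmf P G)"
  using covers_bind[OF covers_refl assms] by simp

lemma covers_map: "covers c P Q \<Longrightarrow> covers c (map_pmf f P) (map_pmf f Q)"
  using covers_bind[of c P Q 1 "\<lambda>x. return_pmf (f x)" "\<lambda>x. return_pmf (f x)"]
  by (simp add: covers_refl map_pmf_def)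

text \<open>The bound from below at \<open>False\<close> is a bound from above at
  \<open>True\<close>. Multiplicative covering thus yields the usual additive distance in both
  directions.\<close>

lemma covers_True_le:
  fixes P Q :: "bool pmf"
  assumes "covers c P Q" "c \<le> 1"
  shows "pmf P True \<le> pmf Q True + (1 - c)" "pmf Q True \<le> pmf P True + (1 - c)"
proof -
  have sum: "pmf S True + pmf S False = 1" for S :: "bool pmf"
    using pmf_False_conv_True[of S] by simp
  have "c * pmf Q True \<le> pmf P True" "c * pmf Q False \<le> pmf P False"
    using assms(1) by (auto simp: covers_def)
  moreover have "(1 - c) * pmf Q True \<le> (1 - c) * 1" "(1 - c) * pmf Q False \<le> (1 - c) * 1"
    using assms(2) by (intro mult_left_mono; simp add: pmf_le_1)+
  moreover note sum[of P] sum[of Q]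
  ultimately show "pmf P True \<le> pmf Q True + (1 - c)" "pmf Q True \<le> pmf P True + (1 - c)"
    by (simp_all add: algebra_simps)
qed

lemma bernoulli_power: "1 - real m * e \<le> (1 - e) ^ m" if "e \<le> 1" "0 \<le> e" for e :: real
  using Bernoulli_inequality[of "- e" m] that by simp

definition uniform :: "int \<Rightarrow> int pmf" where
  "uniform m = pmf_of_set {0..<m}"

lemma set_uniform: "0 < m \<Longrightarrow> set_pmf (uniform m) = {0..<m}"
  by (simp add: uniform_def)

lemma uniform_1: "uniform 1 = return_pmf 0"
proof -
  have "{0..<1} = {0::int}" by auto
  then show ?thesis by (simp add: uniform_def pmf_of_set_singleton)
qed

lemma toss_uniform: "toss A \<eta> = uniform (2 ^ poly (coins A) \<eta>)"
  by (simp add: toss_def uniform_def)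

text \<open>Each residue modulo N has at least R div N representatives below R, and R div N is at
  least R/N - 1. Dividing by R gives (1 - N/R)/N.\<close>

lemma covers_uniform_mod:
  assumes "0 < N" "int N \<le> R"
  shows "covers (1 - real N / real_of_int R) (map_pmf (\<lambda>w. nat (w mod int N)) (uniform R))
    (pmf_of_set {0..<N})"
  unfolding covers_def
proof (intro conjI allI)
  have R: "0 < R" using assms by linarith
  have "real N \<le> real_of_int R" using assms(2) by linarith
  then show "0 \<le> 1 - real N / real_of_int R"
    using R by simp
  fix x
  show "(1 - real N / real_of_int R) * pmf (pmf_of_set {0..<N}) x
      \<le> pmf (map_pmf (\<lambda>w. nat (w mod int N)) (uniform R)) x"
  proof (cases "x < N")
    case True
    \<comment> \<open>The representatives x, x + N, ..., x + (j - 1) N all lie below R.\<close>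
    define j where "j = nat (R div int N)"
    have "(\<lambda>i. int x + int N * int i) ` {..<j} \<subseteq> {0..<R} \<inter> (\<lambda>w. nat (w mod int N)) -` {x}"
    proof (rule image_subsetI)
      fix i assume "i \<in> {..<j}"
      then have "int i + 1 \<le> R div int N" by (auto simp: j_def)
      then have "int N * (int i + 1) \<le> int N * (R div int N)"
        by (intro mult_left_mono) auto
      also have "\<dots> \<le> R"
        using R assms(1) by (metis mult.commute div_mod_decomp_int le_add_same_cancel1 of_nat_0_less_iff pos_mod_sign)
      finally have "int x + int N * int i < R"
        using True by (simp add: algebra_simps)
      moreover have "nat ((int x + int N * int i) mod int N) = x"
        using True by simp
      ultimately show "int x + int N * int i \<in> {0..<R} \<inter> (\<lambda>w. nat (w mod int N)) -` {x}"
        by simp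
    qed
    then have "card ((\<lambda>i. int x + int N * int i) ` {..<j}) \<le>
        card ({0..<R} \<inter> (\<lambda>w. nat (w mod int N)) -` {x})"
      by (intro card_mono) auto
    moreover have "card ((\<lambda>i. int x + int N * int i) ` {..<j}) = j"
      using assms(1) by (subst card_image) (auto simp: inj_on_def)
    ultimately have j: "real j \<le> card ({0..<R} \<inter> (\<lambda>w. nat (w mod int N)) -` {x})" by simp
    have "real_of_int R / real N - 1 \<le> real j"
    proof -
      have "real_of_int R / real_of_int (int N) - 1 \<le> real_of_int (R div int N)"
        using real_of_int_div3[of R "int N"] by linarith
      moreover have "0 \<le> R div int N"
        using R by (simp add: pos_imp_zdiv_nonneg_iff assms(1))
      ultimately show ?thesis by (simp add: j_def)
    qed
    then have "(real_of_int R / real N - 1) / real_of_int R \<le>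
        card ({0..<R} \<inter> (\<lambda>w. nat (w mod int N)) -` {x}) / real_of_int R"
      using j R by (intro divide_right_mono) auto
    moreover have "(real_of_int R / real N - 1) / real_of_int R = (1 - real N / real_of_int R) * (1 / real N)"
      using R assms(1) by (simp add: field_simps)
    ultimately show ?thesis
      using True R assms(1) by (simp add: pmf_map uniform_def measure_pmf_of_set)
  qed (use assms in simp)
qed

section \<open>Digits of a uniform integer\<close>

lemma div_bounds:
  fixes a b w :: int
  assumes "0 \<le> w" "w < a * b" "0 < a"
  shows "0 \<le> w div a \<and> w div a < b"
proof -
  have "w div a < b"
  proof (rule ccontr)
    assume "\<not> w div a < b"
    then have "a * b \<le> a * (w div a)" using assms by (intro mult_left_mono) auto
    also have "\<dots> \<le> w" using mult_div_mod_eq[of a w] pos_mod_sign[OF assms(3), of w] by linarith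
    finally show False using assms by simp
  qed
  then show ?thesis
    using assms by (simp add: pos_imp_zdiv_nonneg_iff)
qed

text \<open>The coins of a reduction come as one integer. Its digits in a mixed radix are
  independent and uniform, because quotient and remainder form a bijection onto the
  rectangle.\<close>

lemma uniform_split:
  assumes "0 < a" "0 < b"
  shows "bind_pmf (uniform (a * b)) (\<lambda>w. F (w mod a) (w div a)) =
    bind_pmf (uniform a) (\<lambda>x. bind_pmf (uniform b) (F x))"
proof -
  have "bij_betw (\<lambda>w. (w mod a, w div a)) {0..<a * b} ({0..<a} \<times> {0..<b})"
  proof (rule bij_betw_byWitness[where f' = "\<lambda>(x, y). x + a * y"])
    show "(\<lambda>w. (w mod a, w div a)) ` {0..<a * b} \<subseteq> {0..<a} \<times> {0..<b}"
    proof (rule image_subsetI)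
      fix w assume "w \<in> {0..<a * b}"
      then have w: "0 \<le> w" "w < a * b" by auto
      then show "(w mod a, w div a) \<in> {0..<a} \<times> {0..<b}"
        using div_bounds[OF w] assms by simp
    qed
    show "(\<lambda>(x, y). x + a * y) ` ({0..<a} \<times> {0..<b}) \<subseteq> {0..<a * b}"
    proof (rule image_subsetI)
      fix z assume "z \<in> {0..<a} \<times> {0..<b}"
      then obtain x y where z: "z = (x, y)" and *: "0 \<le> x" "x < a" "0 \<le> y" "y < b" by auto
      then have "a * (y + 1) \<le> a * b" using assms by (intro mult_left_mono) auto
      then show "(case z of (x, y) \<Rightarrow> x + a * y) \<in> {0..<a * b}"
        using * assms by (simp add: z algebra_simps)
    qed
  qed auto
  then have "map_pmf (\<lambda>w. (w mod a, w div a)) (uniform (a * b)) = pmf_of_set ({0..<a} \<times> {0..<b})"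
    unfolding uniform_def using assms by (intro map_pmf_of_set_bij_betw) auto
  also have "\<dots> = pair_pmf (uniform a) (uniform b)"
    unfolding uniform_def using assms
    by (intro pmf_eqI) (auto simp: pmf_pair indicator_def)
  finally have "bind_pmf (map_pmf (\<lambda>w. (w mod a, w div a)) (uniform (a * b))) (\<lambda>(x, y). F x y) =
      bind_pmf (pair_pmf (uniform a) (uniform b)) (\<lambda>(x, y). F x y)"
    by simp
  then show ?thesis
    by (simp add: bind_map_pmf pair_pmf_def bind_assoc_pmf bind_return_pmf)
qed


text \<open>Six is what the SDA distinguisher consumes: the secret s, the coins of the adversary, a
  transcript, the challenge bit, the challenge encoding and a second transcript.\<close>

lemma uniform_split6:
  assumes "0 < a1" "0 < a2" "0 < a3" "0 < a4" "0 < a5" "0 < a6"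
  shows "bind_pmf (uniform (a1 * (a2 * (a3 * (a4 * (a5 * a6))))))
      (\<lambda>w. F (w mod a1) (w div a1 mod a2) (w div a1 div a2 mod a3) (w div a1 div a2 div a3 mod a4)
         (w div a1 div a2 div a3 div a4 mod a5) (w div a1 div a2 div a3 div a4 div a5)) =
    bind_pmf (uniform a1) (\<lambda>x1. bind_pmf (uniform a2) (\<lambda>x2. bind_pmf (uniform a3) (\<lambda>x3.
      bind_pmf (uniform a4) (\<lambda>x4. bind_pmf (uniform a5) (\<lambda>x5. bind_pmf (uniform a6) (F x1 x2 x3 x4 x5))))))"
proof -
  have s5: "bind_pmf (uniform (a5 * a6)) (\<lambda>w. G (w mod a5) (w div a5)) =
      bind_pmf (uniform a5) (\<lambda>x5. bind_pmf (uniform a6) (G x5))" for G :: "int \<Rightarrow> int \<Rightarrow> 'a pmf"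
    using assms by (intro uniform_split) auto
  have s4: "bind_pmf (uniform (a4 * (a5 * a6))) (\<lambda>w. G (w mod a4) (w div a4 mod a5) (w div a4 div a5)) =
      bind_pmf (uniform a4) (\<lambda>x4. bind_pmf (uniform a5) (\<lambda>x5. bind_pmf (uniform a6) (G x4 x5)))"
    for G :: "int \<Rightarrow> int \<Rightarrow> int \<Rightarrow> 'a pmf"
    using assms s5 by (subst uniform_split[where F = "\<lambda>x w. G x (w mod a5) (w div a5)"]) auto
  have s3: "bind_pmf (uniform (a3 * (a4 * (a5 * a6))))
        (\<lambda>w. G (w mod a3) (w div a3 mod a4) (w div a3 div a4 mod a5) (w div a3 div a4 div a5)) =
      bind_pmf (uniform a3) (\<lambda>x3. bind_pmf (uniform a4) (\<lambda>x4. bind_pmf (uniform a5) (\<lambda>x5.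
        bind_pmf (uniform a6) (G x3 x4 x5))))"
    for G :: "int \<Rightarrow> int \<Rightarrow> int \<Rightarrow> int \<Rightarrow> 'a pmf"
    using assms s4 by (subst uniform_split[where F = "\<lambda>x w. G x (w mod a4) (w div a4 mod a5) (w div a4 div a5)"]) auto
  have s2: "bind_pmf (uniform (a2 * (a3 * (a4 * (a5 * a6)))))
        (\<lambda>w. G (w mod a2) (w div a2 mod a3) (w div a2 div a3 mod a4) (w div a2 div a3 div a4 mod a5)
           (w div a2 div a3 div a4 div a5)) =
      bind_pmf (uniform a2) (\<lambda>x2. bind_pmf (uniform a3) (\<lambda>x3. bind_pmf (uniform a4) (\<lambda>x4.
        bind_pmf (uniform a5) (\<lambda>x5. bind_pmf (uniform a6) (G x2 x3 x4 x5)))))"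
    for G :: "int \<Rightarrow> int \<Rightarrow> int \<Rightarrow> int \<Rightarrow> int \<Rightarrow> 'a pmf"
    using assms s3
    by (subst uniform_split[where F = "\<lambda>x w. G x (w mod a3) (w div a3 mod a4) (w div a3 div a4 mod a5)
          (w div a3 div a4 div a5)"]) auto
  show ?thesis
    using assms s2
    by (subst uniform_split[where F = "\<lambda>x w. F x (w mod a2) (w div a2 mod a3) (w div a2 div a3 mod a4)
          (w div a2 div a3 div a4 mod a5) (w div a2 div a3 div a4 div a5)"]) auto
qed


section \<open>Negligible functions\<close>

lemma poly_le_power: "\<exists>d. \<forall>\<^sub>F \<eta> in sequentially. poly (Q :: nat poly) \<eta> \<le> \<eta> ^ d"
proof (induction Q)
  case (pCons a Q)
  then obtain d where d: "\<forall>\<^sub>F \<eta> in sequentially. poly Q \<eta> \<le> \<eta> ^ d" by blast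
  have "\<forall>\<^sub>F \<eta> in sequentially. poly (pCons a Q) \<eta> \<le> \<eta> ^ (d + 2)"
    using d eventually_ge_at_top[of "a + 2"]
  proof eventually_elim
    case (elim \<eta>)
    have "poly (pCons a Q) \<eta> = a + \<eta> * poly Q \<eta>" by simp
    also have "\<dots> \<le> \<eta> + \<eta> * \<eta> ^ d"
      using elim by (intro add_mono mult_left_mono) auto
    also have "\<dots> \<le> \<eta> * \<eta> ^ d + \<eta> * \<eta> ^ d"
      using elim by (intro add_mono) auto
    also have "\<dots> = 2 * \<eta> ^ (d + 1)" by simp
    also have "\<dots> \<le> \<eta> * \<eta> ^ (d + 1)"
      using elim by (intro mult_right_mono) auto
    finally show ?case by simp
  qed
  then show ?case by blast
qed auto

lemma negligible_mono:
  assumes "negligible \<nu>" "\<forall>\<^sub>F \<eta> in sequentially. \<bar>\<mu> \<eta>\<bar> \<le> \<bar>\<nu> \<eta>\<bar>"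
  shows "negligible \<mu>"
  unfolding negligible_def
proof
  fix c
  have "\<forall>\<^sub>F \<eta> in sequentially. \<bar>\<nu> \<eta>\<bar> < 1 / real \<eta> ^ c"
    using assms(1) by (simp add: negligible_def)
  with assms(2) show "\<forall>\<^sub>F \<eta> in sequentially. \<bar>\<mu> \<eta>\<bar> < 1 / real \<eta> ^ c"
    by eventually_elim linarith
qed

lemma negligible_poly_mult:
  assumes "negligible \<nu>"
  shows "negligible (\<lambda>\<eta>. real (poly (Q :: nat poly) \<eta>) * \<nu> \<eta>)"
  unfolding negligible_def
proof
  fix c
  obtain d where d: "\<forall>\<^sub>F \<eta> in sequentially. poly Q \<eta> \<le> \<eta> ^ d"
    using poly_le_power by blast
  have "\<forall>\<^sub>F \<eta> in sequentially. \<bar>\<nu> \<eta>\<bar> < 1 / real \<eta> ^ (c + d)"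
    using assms unfolding negligible_def by blast
  with d eventually_gt_at_top[of 0] show "\<forall>\<^sub>F \<eta> in sequentially. \<bar>real (poly Q \<eta>) * \<nu> \<eta>\<bar> < 1 / real \<eta> ^ c"
  proof eventually_elim
    case (elim \<eta>)
    have "\<bar>real (poly Q \<eta>) * \<nu> \<eta>\<bar> \<le> real (\<eta> ^ d) * \<bar>\<nu> \<eta>\<bar>"
      unfolding abs_mult using elim by (intro mult_right_mono) (auto simp del: of_nat_power)
    also have "\<dots> < real (\<eta> ^ d) * (1 / real \<eta> ^ (c + d))"
      using elim by (intro mult_strict_left_mono) auto
    also have "\<dots> = 1 / real \<eta> ^ c"
      using elim by (simp add: power_add)
    finally show ?case .
  qed
qed

text \<open>The sum is at most twice the maximum, and the factor 2 is a polynomial.\<close>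

lemma negligible_add:
  assumes "negligible \<nu>" "negligible \<mu>"
  shows "negligible (\<lambda>\<eta>. \<nu> \<eta> + \<mu> \<eta>)"
proof -
  have max: "negligible (\<lambda>\<eta>. max \<bar>\<nu> \<eta>\<bar> \<bar>\<mu> \<eta>\<bar>)"
    unfolding negligible_def
  proof
    fix c
    have "\<forall>\<^sub>F \<eta> in sequentially. \<bar>\<nu> \<eta>\<bar> < 1 / real \<eta> ^ c" "\<forall>\<^sub>F \<eta> in sequentially. \<bar>\<mu> \<eta>\<bar> < 1 / real \<eta> ^ c"
      using assms by (auto simp: negligible_def)
    then show "\<forall>\<^sub>F \<eta> in sequentially. \<bar>max \<bar>\<nu> \<eta>\<bar> \<bar>\<mu> \<eta>\<bar>\<bar> < 1 / real \<eta> ^ c"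
      by eventually_elim auto
  qed
  show ?thesis
    by (rule negligible_mono[OF negligible_poly_mult[OF max, of "[:2:]"]])
      (auto intro!: always_eventually)
qed

text \<open>Needed because the two runs of the adversary bound only the square of its success. The
  exponent 2c of the hypothesis pays for the root.\<close>

lemma negligible_sqrt:
  assumes "negligible \<nu>"
  shows "negligible (\<lambda>\<eta>. sqrt (\<nu> \<eta>))"
  unfolding negligible_def
proof
  fix c
  have "\<forall>\<^sub>F \<eta> in sequentially. \<bar>\<nu> \<eta>\<bar> < 1 / real \<eta> ^ (2 * c)"
    using assms unfolding negligible_def by blast
  then show "\<forall>\<^sub>F \<eta> in sequentially. \<bar>sqrt (\<nu> \<eta>)\<bar> < 1 / real \<eta> ^ c"
  proof eventually_elim
    case (elim \<eta>)
    have "sqrt \<bar>\<nu> \<eta>\<bar> < sqrt ((1 / real \<eta> ^ c)\<^sup>2)"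
      using elim by (intro real_sqrt_less_mono) (simp add: power_divide power_mult[symmetric] mult.commute)
    moreover have "sqrt ((1 / real \<eta> ^ c)\<^sup>2) = 1 / real \<eta> ^ c"
      by (rule real_sqrt_unique) auto
    moreover have "\<bar>sqrt (\<nu> \<eta>)\<bar> = sqrt \<bar>\<nu> \<eta>\<bar>"
      by (simp add: sqrt_def real_root_abs)
    ultimately show ?case by linarith
  qed
qed

lemma negligible_inverse_power2: "negligible (\<lambda>\<eta>. 1 / 2 ^ \<eta>)"
  unfolding negligible_def
proof
  fix c :: nat
  have "((\<lambda>\<eta>. real \<eta> ^ c / 2 ^ \<eta>) \<longlongrightarrow> 0) sequentially"
    by real_asymp
  then have "\<forall>\<^sub>F \<eta> in sequentially. real \<eta> ^ c / 2 ^ \<eta> < 1"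
    by (rule order_tendstoD) simp
  with eventually_gt_at_top[of 0] show "\<forall>\<^sub>F \<eta> in sequentially. \<bar>1 / 2 ^ \<eta> :: real\<bar> < 1 / real \<eta> ^ c"
    by eventually_elim (simp add: field_simps)
qed


section \<open>Histories of oracle calls\<close>

definition final :: "data \<Rightarrow> data" where
  "final d = (if asks d then Atom 0 else right d)"

text \<open>An oracle run without its output, which is a function of the transcript. In this form
  the oracle phases of the privacy game and the query phase of the security game become the same
  object.\<close>

primrec history ::
    "nat \<Rightarrow> ((int \<times> 's) list \<Rightarrow> data) \<Rightarrow> (int \<Rightarrow> 's pmf) \<Rightarrow> (int \<times> 's) list \<Rightarrow> (int \<times> 's) list pmf" where
  "history 0 nx orac h = return_pmf h"
| "history (Suc m) nx orac h =
     (if asks (nx h) then bind_pmf (orac (int_of (right (nx h))))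
        (\<lambda>\<sigma>. history m nx orac (h @ [(int_of (right (nx h)), \<sigma>)]))
      else return_pmf h)"

lemma oracle_run_history:
  "oracle_run m nx orac h = map_pmf (\<lambda>h. (final (nx h), h)) (history m nx orac h)"
  by (induction m arbitrary: h) (auto simp: final_def Let_def map_bind_pmf)

text \<open>\<open>history\<close> unfolds at the first question, the query phase of the security
  game at the last. They agree for an algorithm that never stops asking.\<close>

lemma history_Suc_right:
  assumes "\<And>h. asks (nx h)"
  shows "history (Suc m) nx orac h = bind_pmf (history m nx orac h)
    (\<lambda>h. map_pmf (\<lambda>\<sigma>. h @ [(int_of (right (nx h)), \<sigma>)]) (orac (int_of (right (nx h)))))"
proof (induction m arbitrary: h)
  case (Suc m)
  let ?x = "\<lambda>h. int_of (right (nx h))"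
  let ?K = "\<lambda>h. map_pmf (\<lambda>\<sigma>. h @ [(?x h, \<sigma>)]) (orac (?x h))"
  have "history (Suc (Suc m)) nx orac h =
      bind_pmf (orac (?x h)) (\<lambda>\<sigma>. history (Suc m) nx orac (h @ [(?x h, \<sigma>)]))"
    by (subst history.simps(2)) (simp only: assms if_True)
  also have "\<dots> = bind_pmf (bind_pmf (orac (?x h)) (\<lambda>\<sigma>. history m nx orac (h @ [(?x h, \<sigma>)]))) ?K"
    by (simp only: Suc bind_assoc_pmf)
  also have "bind_pmf (orac (?x h)) (\<lambda>\<sigma>. history m nx orac (h @ [(?x h, \<sigma>)])) = history (Suc m) nx orac h"
    by (simp add: assms)
  finally show ?case .
qed (simp add: assms bind_return_pmf map_pmf_def)

definition question :: "data \<Rightarrow> data" where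
  "question d = Node (Atom 1) d"

lemma question_simps [simp]: "asks (question d)" "right (question d) = d"
  by (simp_all add: question_def asks_def)

lemma query_phase_history:
  "query_phase \<S> A \<eta> \<omega> pk sk m = history m
     (\<lambda>h. question (answer A \<eta> \<omega> (lst [enc_pk \<S> pk, enc_transcript \<S> h])))
     (\<lambda>x. map_pmf fst (outcome (probgen \<S> pk sk x))) []"
proof (induction m)
  case (Suc m)
  then show ?case
    by (subst history_Suc_right) (auto simp: Let_def map_pmf_def bind_assoc_pmf bind_return_pmf case_prod_unfold)
qed simp

text \<open>Reducing the questions modulo \<open>N\<close> bounds the length of the transcripts also when the
  algorithm asks for inputs outside the domain.\<close>

definition reduced :: "int \<Rightarrow> data \<Rightarrow> data" where
  "reduced N d = (if asks d then question (Atom (int_of (right d) mod N)) else d)"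

lemma asks_reduced [simp]: "asks (reduced N d) = asks d"
  and int_of_reduced: "asks d \<Longrightarrow> int_of (right (reduced N d)) = int_of (right d) mod N"
  and final_reduced [simp]: "final (reduced N d) = final d"
  by (auto simp: reduced_def final_def)

lemma history_extends: "h' \<in> set_pmf (history m nx orac h) \<Longrightarrow> set h \<subseteq> set h'"
  by (induction m arbitrary: h) (fastforce split: if_splits)+

text \<open>Transfers to the real game: questions that already lie in the range are fixed by the
  reduction, and by induction so is everything that follows.\<close>

lemma history_reduced:
  assumes "\<And>h'. h' \<in> set_pmf (history m nx orac h) \<Longrightarrow> fst ` set h' \<subseteq> {0..<N}"
  shows "history m (\<lambda>h. reduced N (nx h)) orac h = history m nx orac h"
  using assms
proof (induction m arbitrary: h)
  case (Suc m)
  show ?case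
  proof (cases "asks (nx h)")
    case True
    define x where "x = int_of (right (nx h))"
    have sub: "h' \<in> set_pmf (history (Suc m) nx orac h)"
      if "\<sigma> \<in> set_pmf (orac x)" "h' \<in> set_pmf (history m nx orac (h @ [(x, \<sigma>)]))" for \<sigma> h'
      using that True by (auto simp: x_def)
    \<comment> \<open>The hypothesis speaks about complete transcripts only, so the question
      \<open>x\<close> is first extended to one; supports are never empty.\<close>
    obtain \<sigma> where \<sigma>: "\<sigma> \<in> set_pmf (orac x)"
      using set_pmf_not_empty[of "orac x"] by blast
    obtain h' where h': "h' \<in> set_pmf (history m nx orac (h @ [(x, \<sigma>)]))"
      using set_pmf_not_empty[of "history m nx orac (h @ [(x, \<sigma>)])"] by blast
    have "x \<in> {0..<N}"
      using Suc.prems[OF sub[OF \<sigma> h']] history_extends[OF h'] by force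
    then have "x mod N = x" by simp
    moreover have "history m (\<lambda>h. reduced N (nx h)) orac (h @ [(x, \<sigma>)]) = history m nx orac (h @ [(x, \<sigma>)])"
      if "\<sigma> \<in> set_pmf (orac x)" for \<sigma>
      using that by (intro Suc.IH Suc.prems sub)
    ultimately show ?thesis
      using True by (auto simp: int_of_reduced x_def[symmetric] intro: bind_pmf_cong)
  qed simp
qed simp

section \<open>Runs on a tape of random digits\<close>

primrec tape_history ::
    "(int \<Rightarrow> int \<Rightarrow> 's) \<Rightarrow> int \<Rightarrow> nat \<Rightarrow> ((int \<times> 's) list \<Rightarrow> data) \<Rightarrow> (int \<times> 's) list \<Rightarrow> int \<Rightarrow>
     (int \<times> 's) list" where
  "tape_history enc B 0 nx h w = h"
| "tape_history enc B (Suc m) nx h w =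
     (if asks (nx h) then tape_history enc B m nx
        (h @ [(int_of (right (nx h)), enc (int_of (right (nx h))) (w mod B))]) (w div B)
      else h)"

text \<open>Every answered question loses one factor c, and at most m are asked. A run that stops
  early is reproduced exactly and is only weakened to the common factor.\<close>

lemma covers_history:
  assumes "\<And>x. covers c (map_pmf (enc x) (uniform B)) (orac x)" "0 < B" "c \<le> 1"
  shows "covers (c ^ m) (map_pmf (tape_history enc B m nx h) (uniform (B ^ m))) (history m nx orac h)"
proof (induction m arbitrary: h)
  case 0
  show ?case by (simp add: uniform_1 covers_refl)
next
  case (Suc m)
  have c: "0 \<le> c" using assms(1) covers_nonneg by blast
  show ?case
  proof (cases "asks (nx h)")
    case True
    define x where "x = int_of (right (nx h))"
    have "map_pmf (tape_history enc B (Suc m) nx h) (uniform (B ^ Suc m)) =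
        bind_pmf (uniform (B * B ^ m)) (\<lambda>w. return_pmf
          (tape_history enc B m nx (h @ [(x, enc x (w mod B))]) (w div B)))"
      using True by (simp add: map_pmf_def x_def)
    also have "\<dots> = bind_pmf (uniform B) (\<lambda>w. map_pmf (tape_history enc B m nx (h @ [(x, enc x w)])) (uniform (B ^ m)))"
      unfolding map_pmf_def using assms(2)
      by (subst uniform_split[where F = "\<lambda>a b. return_pmf (tape_history enc B m nx (h @ [(x, enc x a)]) b)"]) auto
    also have "\<dots> = bind_pmf (map_pmf (enc x) (uniform B))
        (\<lambda>\<sigma>. map_pmf (tape_history enc B m nx (h @ [(x, \<sigma>)])) (uniform (B ^ m)))"
      by (simp add: bind_map_pmf)
    finally have "map_pmf (tape_history enc B (Suc m) nx h) (uniform (B ^ Suc m)) =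
        bind_pmf (map_pmf (enc x) (uniform B))
          (\<lambda>\<sigma>. map_pmf (tape_history enc B m nx (h @ [(x, \<sigma>)])) (uniform (B ^ m)))" .
    moreover have "history (Suc m) nx orac h = bind_pmf (orac x) (\<lambda>\<sigma>. history m nx orac (h @ [(x, \<sigma>)]))"
      using True by (simp add: x_def)
    ultimately show ?thesis
      using c covers_bind[OF assms(1)[of x] Suc.IH, of "\<lambda>\<sigma>. h @ [(x, \<sigma>)]"]
      by (simp only: power_Suc zero_le_power)
  next
    case False
    then have "tape_history enc B (Suc m) nx h = (\<lambda>_. h)" "history (Suc m) nx orac h = return_pmf h"
      by (auto simp: fun_eq_iff)
    then have "covers 1 (map_pmf (tape_history enc B (Suc m) nx h) (uniform (B ^ Suc m)))
        (history (Suc m) nx orac h)"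
      by (simp add: covers_refl map_pmf_const)
    then show ?thesis
      by (rule covers_mono) (use c assms(3) in \<open>auto simp: power_le_one simp del: power_Suc\<close>)
  qed
qed

primrec tape_encode :: "mlm \<Rightarrow> data \<Rightarrow> int \<Rightarrow> nat \<Rightarrow> int \<Rightarrow> int \<Rightarrow> data list" where
  "tape_encode \<Gamma> h R 0 a w = []"
| "tape_encode \<Gamma> h R (Suc m) a w =
     ((gen \<Gamma> 1 [^]\<^bsub>grp \<Gamma> 1\<^esub> a) \<otimes>\<^bsub>grp \<Gamma> 1\<^esub> (h [^]\<^bsub>grp \<Gamma> 1\<^esub> int (nat ((w mod R) mod int (modulus \<Gamma>))))) #
     tape_encode \<Gamma> h R m ((a * a) mod int (modulus \<Gamma>)) (w div R)"

text \<open>Each of the m components draws one exponent of h, hence m factors. Squaring modulo N is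
  deterministic and loses nothing.\<close>

lemma covers_pe_encode:
  assumes "0 < modulus (pk_inst pk)" "int (modulus (pk_inst pk)) \<le> R" "pk_g pk = gen (pk_inst pk) 1"
  shows "covers ((1 - real (modulus (pk_inst pk)) / real_of_int R) ^ m)
    (map_pmf (tape_encode (pk_inst pk) (pk_h pk) R m a) (uniform (R ^ m))) (outcome (pe_encode pk m a))"
proof (induction m arbitrary: a)
  case 0
  show ?case by (simp add: uniform_1 covers_refl)
next
  case (Suc m)
  let ?\<Gamma> = "pk_inst pk"
  let ?N = "modulus (pk_inst pk)"
  let ?hd = "\<lambda>r. (gen ?\<Gamma> 1 [^]\<^bsub>grp ?\<Gamma> 1\<^esub> a) \<otimes>\<^bsub>grp ?\<Gamma> 1\<^esub> (pk_h pk [^]\<^bsub>grp ?\<Gamma> 1\<^esub> int r)"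
  let ?t = "tape_encode ?\<Gamma> (pk_h pk) R m ((a * a) mod int ?N)"
  have R: "0 < R" using assms by linarith
  have c: "0 \<le> (1 - real ?N / real_of_int R) ^ m"
    using covers_nonneg[OF covers_uniform_mod[OF assms(1,2)]] by (rule zero_le_power)
  have "map_pmf (tape_encode ?\<Gamma> (pk_h pk) R (Suc m) a) (uniform (R ^ Suc m)) =
      bind_pmf (uniform (R * R ^ m)) (\<lambda>w. return_pmf (?hd (nat ((w mod R) mod int ?N)) # ?t (w div R)))"
    by (simp add: map_pmf_def)
  also have "\<dots> = bind_pmf (uniform R) (\<lambda>r. bind_pmf (uniform (R ^ m))
      (\<lambda>w. return_pmf (?hd (nat (r mod int ?N)) # ?t w)))"
    using R by (subst uniform_split[where F = "\<lambda>r w. return_pmf (?hd (nat (r mod int ?N)) # ?t w)"]) auto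
  also have "\<dots> = bind_pmf (map_pmf (\<lambda>w. nat (w mod int ?N)) (uniform R))
      (\<lambda>r. map_pmf (\<lambda>\<sigma>. ?hd r # \<sigma>) (map_pmf ?t (uniform (R ^ m))))"
    by (simp add: bind_map_pmf map_pmf_def bind_assoc_pmf bind_return_pmf)
  also have "covers ((1 - real ?N / real_of_int R) * (1 - real ?N / real_of_int R) ^ m) \<dots>
      (bind_pmf (pmf_of_set {0..<?N}) (\<lambda>r. map_pmf (\<lambda>\<sigma>. ?hd r # \<sigma>)
        (outcome (pe_encode pk m ((a * a) mod int ?N)))))"
    by (intro covers_bind covers_uniform_mod covers_map Suc.IH c assms)
  finally show ?case
    by (simp add: Let_def pow_op_def mult_op_def mult_mod_op_def bind_return_pmf assms(3) map_pmf_def)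
qed

section \<open>Simulation of the client in polynomial time\<close>

text \<open>A local definition is compiled by pairing the input with the value; the body reads the
  value as the right component. This keeps long simulators provable line by line.\<close>

lemma polytime_Let:
  assumes "polytime F" "polytime (\<lambda>z. G (left z) (right z))"
  shows "polytime (\<lambda>x. let y = F x in G x y)"
  using polytime_comp[OF assms(2) polytime_Node[OF polytime_id assms(1)]] by simp

lemma polytime_Let_int:
  assumes "polytime (\<lambda>x. Atom (f x))" "polytime (\<lambda>z. G (left z) (int_of (right z)))"
  shows "polytime (\<lambda>x. let y = f x in G x y)"
  using polytime_comp[OF assms(2) polytime_Node[OF polytime_id assms(1)]] by simp

lemma decides_asks: "polytime F \<Longrightarrow> decides (\<lambda>x. asks (F x))"
  unfolding asks_def by (intro polytime_intros)

lemma polytime_final: "polytime F \<Longrightarrow> polytime (\<lambda>x. final (F x))"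
  unfolding final_def by (intro polytime_intros decides_asks)

lemma polytime_if_int:
  assumes "decides B" "polytime (\<lambda>x. Atom (a x))" "polytime (\<lambda>x. Atom (b x))"
  shows "polytime (\<lambda>x. Atom (if B x then a x else b x))"
  using polytime_if[OF assms] by (simp add: if_distrib)

text \<open>An environment consists of the description of \<open>\<Gamma>\<close>, the bound in unary on the size of the
  intermediate data, and the size of the set from which approximately uniform elements of \<open>\<int>\<^sub>N\<close>
  are drawn.\<close>

definition env :: "nat poly \<Rightarrow> data \<Rightarrow> data \<Rightarrow> data" where
  "env Q un enc = Node enc (Node (unary_poly Q un) (Atom (2 ^ len (unary_poly [:0, 3:] un))))"

definition env_bound :: "data \<Rightarrow> data" where "env_bound E = left (right E)"
definition env_range :: "data \<Rightarrow> int" where "env_range E = int_of (right (right E))"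
definition env_mod :: "data \<Rightarrow> int" where "env_mod E = int_of (left (left E))"
definition env_gen :: "nat \<Rightarrow> data \<Rightarrow> data" where
  "env_gen i E = left ((right ^^ (i - 1)) (left (right (right (left E)))))"

lemma polytime_env:
  assumes "polytime U" "polytime G"
  shows "polytime (\<lambda>x. env Q (U x) (G x))"
  unfolding env_def by (intro polytime_intros polytime_unary_poly polytime_pow2 assms)

lemma polytime_env_access:
  assumes "polytime E"
  shows "polytime (\<lambda>x. env_bound (E x))" "polytime (\<lambda>x. Atom (env_range (E x)))"
    "polytime (\<lambda>x. Atom (env_mod (E x)))" "polytime (\<lambda>x. env_gen i (E x))"
  unfolding env_bound_def env_range_def env_mod_def env_gen_def
  by (intro polytime_intros assms)+

definition sim_mult :: "(data \<Rightarrow> data) \<Rightarrow> nat \<Rightarrow> data \<Rightarrow> data \<Rightarrow> data \<Rightarrow> data" where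
  "sim_mult mul i E x y = mul (lst [left E, Atom (int i), x, y])"

definition sim_pair :: "(data \<Rightarrow> data) \<Rightarrow> nat \<Rightarrow> nat \<Rightarrow> data \<Rightarrow> data \<Rightarrow> data \<Rightarrow> data" where
  "sim_pair e i j E x y = e (lst [left E, Atom (int i), Atom (int j), x, y])"

text \<open>The exponent a - 1 compensates for the extra factor in the result of
  \<open>fast_pow\<close>. Its residue modulo N is nonnegative, so negative powers and the power 0
  are covered as well.\<close>

definition sim_pow :: "(data \<Rightarrow> data) \<Rightarrow> nat \<Rightarrow> data \<Rightarrow> data \<Rightarrow> int \<Rightarrow> data" where
  "sim_pow mul i E x a = fast_pow (\<lambda>z. sim_mult mul i (left z) (left (right z)) (right (right z)))
     (len (env_bound E)) E x ((a - 1) mod env_mod E)"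

lemma polytime_sim_mult:
  assumes "polytime mul" "polytime E" "polytime X" "polytime Y"
  shows "polytime (\<lambda>x. sim_mult mul i (E x) (X x) (Y x))"
  unfolding sim_mult_def by (intro polytime_comp[OF assms(1)] polytime_intros assms)

lemma polytime_sim_pair:
  assumes "polytime e" "polytime E" "polytime X" "polytime Y"
  shows "polytime (\<lambda>x. sim_pair e i j (E x) (X x) (Y x))"
  unfolding sim_pair_def by (intro polytime_comp[OF assms(1)] polytime_intros assms)

lemma polytime_sim_pow:
  assumes "polytime mul" "polytime E" "polytime X" "polytime (\<lambda>x. Atom (a x))"
  shows "polytime (\<lambda>x. sim_pow mul i (E x) (X x) (a x))"
  unfolding sim_pow_def
  by (intro polytime_fast_pow polytime_sim_mult polytime_intros polytime_env_access assms)

text \<open>k depends on n but not on the security parameter. The recursion is therefore unrolled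
  into a fixed program.\<close>

primrec sim_encode :: "(data \<Rightarrow> data) \<Rightarrow> nat \<Rightarrow> data \<Rightarrow> data \<Rightarrow> int \<Rightarrow> int \<Rightarrow> data" where
  "sim_encode mul 0 E h a w = Atom 0"
| "sim_encode mul (Suc m) E h a w = Node
     (sim_mult mul 1 E (sim_pow mul 1 E (env_gen 1 E) a)
       (sim_pow mul 1 E h ((w mod env_range E) mod env_mod E)))
     (sim_encode mul m E h ((a * a) mod env_mod E) (w div env_range E))"

lemma polytime_sim_encode:
  assumes "polytime mul" "polytime E" "polytime H"
  shows "polytime (\<lambda>x. Atom (a x)) \<Longrightarrow> polytime (\<lambda>x. Atom (w x)) \<Longrightarrow>
    polytime (\<lambda>x. sim_encode mul m (E x) (H x) (a x) (w x))"
proof (induction m arbitrary: a w)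
  case (Suc m)
  show ?case
    unfolding sim_encode.simps
    by (intro Suc polytime_sim_mult polytime_sim_pow polytime_intros polytime_env_access assms)
qed (simp add: polytime_const)

primrec sim_powers :: "(data \<Rightarrow> data) \<Rightarrow> nat \<Rightarrow> data \<Rightarrow> int \<Rightarrow> data" where
  "sim_powers mul 0 E a = Atom 0"
| "sim_powers mul (Suc m) E a = Node (sim_pow mul 1 E (env_gen 1 E) a)
     (sim_powers mul m E ((a * a) mod env_mod E))"

lemma polytime_sim_powers:
  assumes "polytime mul" "polytime E"
  shows "polytime (\<lambda>x. Atom (a x)) \<Longrightarrow> polytime (\<lambda>x. sim_powers mul m (E x) (a x))"
proof (induction m arbitrary: a)
  case (Suc m)
  show ?case
    unfolding sim_powers.simps
    by (intro Suc polytime_sim_pow polytime_intros polytime_env_access assms)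
qed (simp add: polytime_const)

text \<open>The fixed part of the argument holds the environment, h and the context of the
  algorithm; the state is the transcript so far with the unread rest of the tape. Without a question
  the state stays as it is.\<close>

definition sim_step :: "(data \<Rightarrow> data) \<Rightarrow> nat \<Rightarrow> (data \<Rightarrow> data) \<Rightarrow> data \<Rightarrow> data" where
  "sim_step mul k nx z =
    (let E = left (left z); h = left (right (left z)); tr = left (right z); w = int_of (right (right z));
         d = reduced (env_mod E) (nx (Node (right (right (left z))) tr)); x = int_of (right d)
     in if asks d then Node (snoc tr (Node (Atom x) (sim_encode mul k E h x (w mod env_range E ^ k))))
          (Atom (w div env_range E ^ k))
        else right z)"

definition sim_history ::
    "(data \<Rightarrow> data) \<Rightarrow> nat \<Rightarrow> (data \<Rightarrow> data) \<Rightarrow> nat \<Rightarrow> data \<Rightarrow> data \<Rightarrow> data \<Rightarrow> int \<Rightarrow> data" where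
  "sim_history mul k nx m E h C w = left (cloop (sim_step mul k nx) (len (env_bound E))
     (Node E (Node h C)) m (Node (Atom 0) (Atom w)))"

lemma polytime_reduced:
  assumes "polytime (\<lambda>x. Atom (N x))" "polytime F"
  shows "polytime (\<lambda>x. reduced (N x) (F x))"
  unfolding reduced_def question_def by (intro polytime_intros decides_asks assms)

lemma polytime_sim_history:
  assumes "polytime mul" "polytime nx" "polytime M" "polytime E" "polytime H" "polytime C"
    "polytime (\<lambda>x. Atom (w x))"
  shows "polytime (\<lambda>x. sim_history mul k nx (len (M x)) (E x) (H x) (C x) (w x))"
proof -
  have "polytime (sim_step mul k nx)"
    unfolding sim_step_def
    by (intro polytime_Let polytime_Let_int polytime_intros polytime_snoc polytime_sim_encode
        polytime_env_access polytime_reduced polytime_comp[OF assms(2)] decides_asks assms(1))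
  then show ?thesis
    unfolding sim_history_def
    by (intro polytime_intros polytime_cloop polytime_env_access assms)
qed

text \<open>The messages of an algorithm depend on a transcript and on a context, which consists of the
  security parameter, the random bits and the preceding part of the input.\<close>

definition next_message :: "alg \<Rightarrow> data \<Rightarrow> data" where
  "next_message A z = prog A (lst [left (left z), left (right (left z)),
     snoc (right (right (left z))) (right z)])"

definition context_of :: "nat \<Rightarrow> int \<Rightarrow> data list \<Rightarrow> data" where
  "context_of \<eta> \<omega> args = Node (unary \<eta>) (Node (Atom \<omega>) (lst args))"

lemma next_message_answer:
  "next_message A (Node (context_of \<eta> \<omega> args) tr) = answer A \<eta> \<omega> (lst (args @ [tr]))"
  by (simp add: next_message_def context_of_def answer_def snoc_lst)

lemma polytime_next_message:
  assumes "ppt A" "polytime F"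
  shows "polytime (\<lambda>x. next_message A (F x))"
  unfolding next_message_def
  by (intro polytime_comp[OF assms(1)[unfolded ppt_def]] polytime_intros polytime_snoc assms(2))

definition enc_history :: "(int \<times> data list) list \<Rightarrow> data" where
  "enc_history h = lst (map (\<lambda>(x, \<sigma>). Node (Atom x) (lst \<sigma>)) h)"

lemma enc_transcript_pe: "enc_transcript (pe_scheme \<G> D M n) = enc_history"
  by (simp add: fun_eq_iff enc_transcript_def enc_history_def pe_scheme_def Let_def)

text \<open>\<open>B\<close> bounds the size of group elements and \<open>b\<close> is the clamp;
  the last assumption makes room for a state of \<open>fast_pow\<close>, with two elements and an
  exponent below N. Since N < 2^(2\<eta>), the choice R = 2^(3\<eta>) makes N/R at most
  2^(-\<eta>).\<close>

locale simulation = mlm_instance +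
  fixes mul e :: "data \<Rightarrow> data" and B b \<eta> :: nat and R :: int and E :: data
  assumes size: "floorlog 2 p = \<eta>" "floorlog 2 q = \<eta>"
    and \<kappa>: "1 \<le> \<kappa>"
    and mul: "\<And>i x y. 1 \<le> i \<Longrightarrow> i \<le> \<kappa> \<Longrightarrow> x \<in> carrier (grp \<Gamma> i) \<Longrightarrow> y \<in> carrier (grp \<Gamma> i) \<Longrightarrow>
      mul (lst [enc_mlm \<Gamma>, Atom (int i), x, y]) = x \<otimes>\<^bsub>grp \<Gamma> i\<^esub> y"
    and e: "\<And>i j x y. 1 \<le> i \<Longrightarrow> 1 \<le> j \<Longrightarrow> i + j \<le> \<kappa> \<Longrightarrow> x \<in> carrier (grp \<Gamma> i) \<Longrightarrow>
      y \<in> carrier (grp \<Gamma> j) \<Longrightarrow> e (lst [enc_mlm \<Gamma>, Atom (int i), Atom (int j), x, y]) = pairing \<Gamma> i j x y"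
    and B: "\<And>i x. 1 \<le> i \<Longrightarrow> i \<le> \<kappa> \<Longrightarrow> x \<in> carrier (grp \<Gamma> i) \<Longrightarrow> bits x \<le> B"
    and R_eq: "R = 2 ^ (3 * \<eta>)"
    and E: "left E = enc_mlm \<Gamma>" "len (env_bound E) = b" "env_range E = R"
    and b: "3 + 2 * B + 2 * \<eta> \<le> b"
begin

lemma p_less: "p < 2 ^ \<eta>" and q_less: "q < 2 ^ \<eta>"
  using floorlog_bounds[of p 2] floorlog_bounds[of q 2] primes size
  by (auto simp: prime_gt_0_nat)

lemma N_less: "N < 2 ^ (2 * \<eta>)"
  using mult_strict_mono'[OF p_less q_less] by (simp add: N_def mult_2 power_add)

lemma R_pos: "0 < R"
  by (simp add: R_eq)

lemma env_mod_E [simp]: "env_mod E = int N"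
  by (simp add: env_mod_def E enc_mlm_def lst_Cons modulus_eq)

lemma env_gen_E: "1 \<le> i \<Longrightarrow> i \<le> \<kappa> \<Longrightarrow> env_gen i E = ex i 1"
proof -
  assume i: "1 \<le> i" "i \<le> \<kappa>"
  have drop: "(right ^^ m) (lst xs) = lst (drop m xs)" if "m \<le> length xs" for m and xs :: "data list"
    using that
  proof (induction m)
    case (Suc m)
    then show ?case
      by (cases "drop m xs") (auto simp: lst_Cons drop_Suc simp flip: tl_drop)
  qed simp
  have "levels \<Gamma> = \<kappa>" using is_mlm by (simp add: is_mlm_def)
  then have "env_gen i E = left (lst (drop (i - 1) (map (gen \<Gamma>) [1..<Suc \<kappa>])))"
    unfolding env_gen_def using i by (simp add: E enc_mlm_def lst_Cons drop del: upt_Suc)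
  also have "drop (i - 1) (map (gen \<Gamma>) [1..<Suc \<kappa>]) = gen \<Gamma> i # drop i (map (gen \<Gamma>) [1..<Suc \<kappa>])"
    using i by (subst Cons_nth_drop_Suc[symmetric]) (auto simp del: upt_Suc)
  finally show ?thesis
    using i by (simp add: lst_Cons gen_eq)
qed

lemma sim_mult_ex: "1 \<le> i \<Longrightarrow> i \<le> \<kappa> \<Longrightarrow> sim_mult mul i E (ex i a) (ex i c) = ex i (a + c)"
  unfolding sim_mult_def using mul[of i] ex_closed ex_mult by (simp add: E)

lemma sim_pair_ex: "1 \<le> i \<Longrightarrow> 1 \<le> j \<Longrightarrow> i + j \<le> \<kappa> \<Longrightarrow>
    sim_pair e i j E (ex i a) (ex j c) = ex (i + j) (a * c)"
  unfolding sim_pair_def using e[of i j "ex i a" "ex j c"] ex_closed pairing_ex[of i j] by (simp add: E)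

lemma sim_pow_ex:
  assumes "1 \<le> i" "i \<le> \<kappa>"
  shows "sim_pow mul i E (ex i a) c = ex i (a * c)"
proof -
  define c' where "c' = nat ((c - 1) mod int N)"
  have c': "int c' = (c - 1) mod int N" "c' < N"
    using N_pos by (auto simp: c'_def nat_less_iff)
  have "sim_pow mul i E (ex i a) c = (\<lambda>m. ex i (a * int m)) (Suc c')"
    unfolding sim_pow_def env_mod_E c'(1)[symmetric] E(2)
  proof (subst fast_pow_eq[where val = "\<lambda>m. ex i (a * int m)", simplified])
    show "c' < 2 ^ (2 * \<eta>)" "2 * \<eta> \<le> b" "3 + 2 * B + 2 * \<eta> \<le> b"
      using c'(2) N_less b by linarith+
  qed (use assms in \<open>auto simp: sim_mult_ex algebra_simps B ex_closed\<close>)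
  also have "\<dots> = ex i (a * c)"
  proof (rule ex_cong[OF assms])
    have "[1 + int c' = 1 + (c - 1)] (mod int N)"
      unfolding c'(1) by (intro cong_add) auto
    then have "[a * (1 + int c') = a * c] (mod int N)"
      by (intro cong_mult) auto
    then show "[a * int (Suc c') = a * c] (mod int N)" by simp
  qed
  finally show ?thesis .
qed

lemma sim_encode_eq:
  assumes "h \<in> carrier (grp \<Gamma> 1)"
  shows "sim_encode mul m E h a w = lst (tape_encode \<Gamma> h R m a w)"
proof (induction m arbitrary: a w)
  case (Suc m)
  obtain c where h: "h = ex 1 c"
    using assms carrier_ex[of 1] \<kappa> by auto
  show ?case
    using \<kappa> N_pos Suc
    by (simp add: h lst_Cons E env_gen_E sim_pow_ex sim_mult_ex gen_eq ex_pow ex_mult modulus_eq)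
qed (simp add: lst_Nil)

lemma tape_encode_carrier:
  assumes "h \<in> carrier (grp \<Gamma> 1)"
  shows "length (tape_encode \<Gamma> h R m a w) = m" "set (tape_encode \<Gamma> h R m a w) \<subseteq> carrier (grp \<Gamma> 1)"
proof -
  obtain c where h: "h = ex 1 c"
    using assms carrier_ex[of 1] \<kappa> by auto
  show "length (tape_encode \<Gamma> h R m a w) = m"
    by (induction m arbitrary: a w) auto
  show "set (tape_encode \<Gamma> h R m a w) \<subseteq> carrier (grp \<Gamma> 1)"
    using \<kappa> by (induction m arbitrary: a w) (auto simp: h gen_eq ex_pow ex_mult ex_closed)
qed

lemma sim_powers_eq: "sim_powers mul m E a = lst (map (\<lambda>i. ex 1 (a ^ 2 ^ i)) [0..<m])"
proof (induction m arbitrary: a)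
  case (Suc m)
  have "ex 1 ((a * a mod int N) ^ 2 ^ i) = ex 1 (a ^ 2 ^ Suc i)" for i
  proof (rule ex_cong)
    have "[(a * a mod int N) ^ 2 ^ i = (a * a) ^ 2 ^ i] (mod int N)"
      by (intro cong_pow) auto
    then show "[(a * a mod int N) ^ 2 ^ i = a ^ 2 ^ Suc i] (mod int N)"
      by (simp add: power_mult power2_eq_square)
  qed (use \<kappa> in auto)
  moreover have "map f [0..<Suc m] = f 0 # map (\<lambda>i. f (Suc i)) [0..<m]" for f :: "nat \<Rightarrow> data"
    by (simp add: map_upt_Suc del: upt_Suc)
  ultimately show ?case
    using Suc \<kappa> by (simp add: lst_Cons env_gen_E sim_pow_ex del: upt_Suc)
qed (simp add: lst_Nil)

text \<open>The size of a question below N with its k group elements: one node, 1 + 2\<eta> for the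
  atom and 1 + k (1 + \<open>B\<close>) for the list.\<close>

definition entry_bound :: "nat \<Rightarrow> nat" where
  "entry_bound k = 3 + 2 * \<eta> + k * (1 + B)"

text \<open>The clamp never cuts: reduced questions and encodings are short, there are at most m of
  them, and the unread tape only becomes shorter.\<close>

lemma sim_history_eq:
  assumes h: "h \<in> carrier (grp \<Gamma> 1)" and w: "0 \<le> w" "w < 2 ^ W"
    and size: "3 + m * (1 + entry_bound k) + W \<le> b"
  shows "sim_history mul k nx m E h C w = enc_history
    (tape_history (\<lambda>x. tape_encode \<Gamma> h R k x) (R ^ k) m (\<lambda>h. reduced (int N) (nx (Node C (enc_history h)))) [] w)"
proof -
  let ?nx = "\<lambda>h. reduced (int N) (nx (Node C (enc_history h)))"
  let ?enc = "\<lambda>x. tape_encode \<Gamma> h R k x"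
  define good where "good hs \<longleftrightarrow> (\<forall>(x, \<sigma>)\<in>set hs. bits (Node (Atom x) (lst \<sigma>)) \<le> entry_bound k)"
    for hs :: "(int \<times> data list) list"
  have bits_state: "bits (Node (enc_history hs) (Atom w)) \<le> b"
    if "good hs" "length hs \<le> m" "0 \<le> w" "w < 2 ^ W" for hs w
  proof -
    have "bits (enc_history hs) \<le> 1 + m * (1 + entry_bound k)"
      unfolding enc_history_def using that by (intro bits_lst_le) (auto simp: good_def)
    moreover have "bits (Atom w) \<le> 1 + W"
      using that by (intro bits_Atom_le) auto
    ultimately show ?thesis using size by simp
  qed
  \<comment> \<open>Only the transcript is tracked; membership in a range leaves the remainder of
    the tape unspecified.\<close>
  have "cloop (sim_step mul k nx) b (Node E (Node h C)) j (Node (enc_history hs) (Atom w)) \<in>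
      range (Node (enc_history (tape_history ?enc (R ^ k) j ?nx hs w)))"
    if "length hs + j \<le> m" "good hs" "0 \<le> w" "w < 2 ^ W" for j hs w
    using that
  proof (induction j arbitrary: hs w)
    case (Suc j)
    let ?d = "reduced (int N) (nx (Node C (enc_history hs)))"
    let ?x = "int_of (right ?d)"
    show ?case
    proof (cases "asks ?d")
      case True
      let ?hs = "hs @ [(?x, ?enc ?x (w mod R ^ k))]"
      have step: "sim_step mul k nx (Node (Node E (Node h C)) (Node (enc_history hs) (Atom w))) =
          Node (enc_history ?hs) (Atom (w div R ^ k))"
        using True by (simp add: sim_step_def Let_def sim_encode_eq[OF h] E enc_history_def snoc_lst)
      have x: "?x \<in> {0..<int N}"
        using True N_pos int_of_reduced[of "nx (Node C (enc_history hs))"] by simp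
      have "bits (Atom ?x) \<le> 1 + 2 * \<eta>"
      proof (rule bits_Atom_le)
        have "int N < 2 ^ (2 * \<eta>)"
          using N_less by (metis of_nat_less_iff of_nat_numeral of_nat_power)
        then show "\<bar>?x\<bar> < 2 ^ (2 * \<eta>)" using x by (simp only: atLeastLessThan_iff) linarith
      qed
      moreover have "bits (lst (?enc ?x (w mod R ^ k))) \<le> 1 + k * (1 + B)"
        using tape_encode_carrier(1)[OF h] subsetD[OF tape_encode_carrier(2)[OF h]] \<kappa>
        by (intro bits_lst_le B[of 1]) (assumption | simp only: order_refl)+
      ultimately have good: "good ?hs"
        using Suc.prems(2) by (auto simp: good_def entry_bound_def)
      have "0 \<le> w div R ^ k" "w div R ^ k \<le> w"
        using Suc.prems(3) R_pos zdiv_mono2[of w 1 "R ^ k"]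
        by (auto simp: pos_imp_zdiv_nonneg_iff int_one_le_iff_zero_less)
      then have w': "0 \<le> w div R ^ k" "w div R ^ k < 2 ^ W"
        using Suc.prems(4) by auto
      have "bits (Node (enc_history ?hs) (Atom (w div R ^ k))) \<le> b"
        using Suc.prems(1) w' by (intro bits_state good) auto
      then show ?thesis
        using Suc.IH[of ?hs "w div R ^ k"] good w' Suc.prems(1) True
        by (subst cloop_Suc) (auto simp: step)
    next
      case False
      have step: "sim_step mul k nx (Node (Node E (Node h C)) (Node (enc_history hs) (Atom w))) =
          Node (enc_history hs) (Atom w)"
        using False by (simp add: sim_step_def Let_def)
      have "tape_history ?enc (R ^ k) j ?nx hs w = hs"
        using False by (cases j) auto
      moreover have "bits (Node (enc_history hs) (Atom w)) \<le> b"
        using Suc.prems by (intro bits_state) auto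
      ultimately show ?thesis
        using Suc.IH[of hs w] Suc.prems False by (subst cloop_Suc) (auto simp: step)
    qed
  qed auto
  from this[of "[]" m w] show ?thesis
    using w by (auto simp: sim_history_def E good_def enc_history_def lst_Nil)
qed

end

text \<open>The programs and \<open>B\<close> are fixed once for all security parameters, while the
  polynomial \<open>Q\<close> behind the clamp stays free, since each reduction needs its own amount
  of room.\<close>

lemma simulation_exists:
  assumes "multilinear_generator \<G> \<kappa>" "1 \<le> \<kappa>"
  obtains mul e and B :: "nat poly" where "polytime mul" "polytime e"
    "\<And>\<eta> p q \<Gamma> Q. \<eta> \<ge> 2 \<Longrightarrow> (p, q, \<Gamma>) \<in> set_pmf (\<G> \<eta> \<kappa>) \<Longrightarrow> 3 + 2 * poly B \<eta> + 2 * \<eta> \<le> poly Q \<eta> \<Longrightarrow>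
       simulation \<Gamma> p q \<kappa> mul e (poly B \<eta>) (poly Q \<eta>) \<eta> (2 ^ (3 * \<eta>)) (env Q (unary \<eta>) (enc_mlm \<Gamma>))"
proof -
  obtain mul e and B :: "nat poly" where "polytime mul" "polytime e" and eff0:
    "\<forall>\<eta>\<ge>2. \<forall>(p, q, \<Gamma>)\<in>set_pmf (\<G> \<eta> \<kappa>). bits (descr \<Gamma>) \<le> poly B \<eta> \<and>
        (\<forall>i\<in>{1..\<kappa>}. \<forall>x\<in>carrier (grp \<Gamma> i). bits x \<le> poly B \<eta> \<and>
          (\<forall>y\<in>carrier (grp \<Gamma> i).
             mul (lst [enc_mlm \<Gamma>, Atom (int i), x, y]) = x \<otimes>\<^bsub>grp \<Gamma> i\<^esub> y) \<and>
          (\<forall>j\<in>{1..\<kappa>}. i + j \<le> \<kappa> \<longrightarrow> (\<forall>y\<in>carrier (grp \<Gamma> j).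
             e (lst [enc_mlm \<Gamma>, Atom (int i), Atom (int j), x, y]) = pairing \<Gamma> i j x y)))"
    using assms(1) unfolding multilinear_generator_def efficient_generator_def by (elim conjE exE)
  show ?thesis
  proof (rule that[of mul e B])
    fix \<eta> p q \<Gamma> and Q :: "nat poly"
    assume *: "\<eta> \<ge> 2" "(p, q, \<Gamma>) \<in> set_pmf (\<G> \<eta> \<kappa>)" "3 + 2 * poly B \<eta> + 2 * \<eta> \<le> poly Q \<eta>"
    note gen = multilinear_generatorD[OF assms(1) *(1,2)]
    show "simulation \<Gamma> p q \<kappa> mul e (poly B \<eta>) (poly Q \<eta>) \<eta> (2 ^ (3 * \<eta>)) (env Q (unary \<eta>) (enc_mlm \<Gamma>))"
    proof (rule simulation.intro[OF gen(1)], unfold_locales)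
      show "floorlog 2 p = \<eta>" "floorlog 2 q = \<eta>" "1 \<le> \<kappa>"
        using gen assms by auto
      show "left (env Q (unary \<eta>) (enc_mlm \<Gamma>)) = enc_mlm \<Gamma>"
        "len (env_bound (env Q (unary \<eta>) (enc_mlm \<Gamma>))) = poly Q \<eta>"
        "env_range (env Q (unary \<eta>) (enc_mlm \<Gamma>)) = 2 ^ (3 * \<eta>)"
        by (simp_all add: env_def env_bound_def env_range_def mult.commute)
      have eff: "bits x \<le> poly B \<eta> \<and>
          (\<forall>y\<in>carrier (grp \<Gamma> i).
             mul (lst [enc_mlm \<Gamma>, Atom (int i), x, y]) = x \<otimes>\<^bsub>grp \<Gamma> i\<^esub> y) \<and>
          (\<forall>j\<in>{1..\<kappa>}. i + j \<le> \<kappa> \<longrightarrow> (\<forall>y\<in>carrier (grp \<Gamma> j).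
             e (lst [enc_mlm \<Gamma>, Atom (int i), Atom (int j), x, y]) = pairing \<Gamma> i j x y))"
        if "1 \<le> i" "i \<le> \<kappa>" "x \<in> carrier (grp \<Gamma> i)" for i x
        using eff0[rule_format, OF *(1,2), unfolded prod.case, THEN conjunct2, rule_format, of i x] that by simp
      show "mul (lst [enc_mlm \<Gamma>, Atom (int i), x, y]) = x \<otimes>\<^bsub>grp \<Gamma> i\<^esub> y"
        if "1 \<le> i" "i \<le> \<kappa>" "x \<in> carrier (grp \<Gamma> i)" "y \<in> carrier (grp \<Gamma> i)" for i x y
        using eff[OF that(1-3)] that(4) by blast
      show "e (lst [enc_mlm \<Gamma>, Atom (int i), Atom (int j), x, y]) = pairing \<Gamma> i j x y"
        if "1 \<le> i" "1 \<le> j" "i + j \<le> \<kappa>" "x \<in> carrier (grp \<Gamma> i)" "y \<in> carrier (grp \<Gamma> j)" for i j x y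
      proof -
        have "i \<le> \<kappa>" "j \<in> {1..\<kappa>}" using that by auto
        then show ?thesis using eff[OF that(1) _ that(4)] that(3,5) by blast
      qed
      show "bits x \<le> poly B \<eta>" if "1 \<le> i" "i \<le> \<kappa>" "x \<in> carrier (grp \<Gamma> i)" for i x
        using eff[OF that] by blast
      show "3 + 2 * poly B \<eta> + 2 * \<eta> \<le> poly Q \<eta>" "2 ^ (3 * \<eta>) = (2 ^ (3 * \<eta>) :: int)"
        using *(3) by auto
    qed
  qed fact+
qed

section \<open>Uniform group elements and perfect hiding\<close>

context mlm_instance
begin

text \<open>Multiplication by a unit is injective modulo N, and both sets have N elements.\<close>

lemma bij_betw_ex:
  assumes "1 \<le> i" "i \<le> \<kappa>" "coprime c (int N)"
  shows "bij_betw (\<lambda>r. ex i (a + c * int r)) {0..<N} (carrier (grp \<Gamma> i))"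
proof -
  have "card (carrier (grp \<Gamma> i)) = N"
    using order_grp[OF assms(1,2)] by (simp add: Coset.order_def)
  moreover have "inj_on (\<lambda>r. ex i (a + c * int r)) {0..<N}"
  proof (rule inj_onI)
    fix r s assume "r \<in> {0..<N}" "s \<in> {0..<N}" "ex i (a + c * int r) = ex i (a + c * int s)"
    then show "r = s"
      using assms by (simp add: ex_eq_iff cong_add_lcancel cong_mult_lcancel cong_int_iff cong_less_modulus_unique_nat)
  qed
  moreover have "(\<lambda>r. ex i (a + c * int r)) ` {0..<N} \<subseteq> carrier (grp \<Gamma> i)"
    using assms ex_closed by auto
  moreover have "finite (carrier (grp \<Gamma> i))"
    using calculation(1) N_pos by (auto intro: card_ge_0_finite)
  ultimately show ?thesis
    unfolding bij_betw_def by (metis card_atLeastLessThan card_image card_subset_eq diff_zero)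
qed

lemma map_pmf_ex:
  assumes "1 \<le> i" "i \<le> \<kappa>" "coprime c (int N)"
  shows "map_pmf (\<lambda>r. ex i (a + c * int r)) (pmf_of_set {0..<N}) = pmf_of_set (carrier (grp \<Gamma> i))"
  using bij_betw_ex[OF assms] N_pos by (intro map_pmf_of_set_bij_betw) auto

text \<open>If h = g^c is a generator, then h^r is uniform in G_1 and hides its cofactor perfectly.
  Every component is a fresh uniform element, whatever is encoded.\<close>

lemma outcome_pe_encode_generator:
  assumes "1 \<le> \<kappa>" "coprime c (int N)"
  shows "outcome (pe_encode (pe_pub \<Gamma> k f s (ex 1 c)) m a) = outcome (pe_encode (pe_pub \<Gamma> k f s (ex 1 c)) m a')"
proof (induction m arbitrary: a a')
  case (Suc m)
  let ?pk = "pe_pub \<Gamma> k f s (ex 1 c)"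
  have step: "outcome (pe_encode ?pk (Suc m) a) = bind_pmf (pmf_of_set (carrier (grp \<Gamma> 1)))
      (\<lambda>x. map_pmf (\<lambda>\<sigma>. x # \<sigma>) (outcome (pe_encode ?pk m ((a * a) mod int N))))" for a
  proof -
    have "outcome (pe_encode ?pk (Suc m) a) =
        bind_pmf (map_pmf (\<lambda>r. ex 1 (a + c * int r)) (pmf_of_set {0..<N}))
          (\<lambda>x. map_pmf (\<lambda>\<sigma>. x # \<sigma>) (outcome (pe_encode ?pk m ((a * a) mod int N))))"
      unfolding bind_map_pmf using assms(1)
      by (simp add: Let_def pow_op_def mult_op_def mult_mod_op_def bind_return_pmf
          modulus_eq gen_eq ex_pow ex_mult map_pmf_def)
    then show ?thesis
      using assms by (simp add: map_pmf_ex)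
  qed
  show ?case
    unfolding step using Suc by (intro bind_pmf_cong arg_cong[of _ _ "map_pmf _"]) auto
qed simp

text \<open>Below N there are q multiples of p and p multiples of q; a residue outside both is a
  unit.\<close>

lemma measure_not_coprime:
  "measure_pmf.prob (pmf_of_set {0..<N}) {r. \<not> coprime N r} \<le> 1 / real p + 1 / real q"
proof -
  have sub: "{0..<N} \<inter> {r. \<not> coprime N r} \<subseteq> (\<lambda>j. p * j) ` {0..<q} \<union> (\<lambda>j. q * j) ` {0..<p}"
  proof
    fix r assume "r \<in> {0..<N} \<inter> {r. \<not> coprime N r}"
    then have r: "r < p * q" "\<not> coprime p r \<or> \<not> coprime q r"
      by (auto simp: N_def)
    then have "p dvd r \<or> q dvd r"
      using primes prime_imp_coprime by blast
    then show "r \<in> (\<lambda>j. p * j) ` {0..<q} \<union> (\<lambda>j. q * j) ` {0..<p}"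
      using r(1) by (auto elim!: dvdE simp: mult.commute)
  qed
  have "card ({0..<N} \<inter> {r. \<not> coprime N r}) \<le> card ((\<lambda>j. p * j) ` {0..<q} \<union> (\<lambda>j. q * j) ` {0..<p})"
    using sub by (intro card_mono) auto
  also have "\<dots> \<le> card ((\<lambda>j. p * j) ` {0..<q}) + card ((\<lambda>j. q * j) ` {0..<p})"
    by (rule card_Un_le)
  also have "\<dots> \<le> q + p"
    using card_image_le[of "{0..<q}" "\<lambda>j. p * j"] card_image_le[of "{0..<p}" "\<lambda>j. q * j"] by simp
  finally have "real (card ({0..<N} \<inter> {r. \<not> coprime N r})) / real N \<le> real (q + p) / real N"
    by (intro divide_right_mono) (auto simp: of_nat_le_iff simp del: of_nat_add)
  moreover have "real (q + p) / real N = 1 / real p + 1 / real q"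
    using primes by (simp add: N_def field_simps prime_gt_0_nat)
  ultimately show ?thesis
    using N_pos by (simp add: measure_pmf_of_set)
qed

end

context simulation
begin

text \<open>Primes with \<eta> digits are at least 2^(\<eta> - 1), so each of the two reciprocals is
  at most 2/2^\<eta>.\<close>

lemma prob_not_coprime: "measure_pmf.prob (pmf_of_set {0..<N}) {r. \<not> coprime N r} \<le> 4 / 2 ^ \<eta>"
proof -
  have "2 ^ \<eta> / 2 \<le> real p'" if "prime p'" "floorlog 2 p' = \<eta>" for p'
  proof -
    have "2 ^ (\<eta> - 1) \<le> p'" "0 < \<eta>"
      using floorlog_bounds[of p' 2] that by (auto simp: prime_gt_0_nat floorlog_def)
    then have "real (2 ^ (\<eta> - 1)) \<le> real p'" "2 ^ \<eta> = 2 * (2::real) ^ (\<eta> - 1)"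
      by (simp_all only: of_nat_le_iff flip: power_Suc) simp
    then show ?thesis by simp
  qed
  then have "1 / real p \<le> 1 / (2 ^ \<eta> / 2)" "1 / real q \<le> 1 / (2 ^ \<eta> / 2)"
    using primes size by (intro divide_left_mono; simp add: prime_gt_0_nat)+
  then show ?thesis
    using measure_not_coprime by simp
qed

lemma N_le_R: "int N \<le> R"
  and N_div_R: "real N / real_of_int R \<le> 1 / 2 ^ \<eta>"
proof -
  have N: "real N \<le> 2 ^ (2 * \<eta>)"
    using N_less by (metis less_imp_le of_nat_le_iff of_nat_numeral of_nat_power)
  have "2 ^ (2 * \<eta>) * 2 ^ \<eta> = real_of_int R"
    by (simp add: R_eq flip: power_add)
  then have "real_of_int R = 2 ^ (2 * \<eta>) * 2 ^ \<eta>" by simp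
  then show "real N / real_of_int R \<le> 1 / 2 ^ \<eta>"
    using N by (simp add: field_simps)
  have "real N * 1 \<le> 2 ^ (2 * \<eta>) * 2 ^ \<eta>"
    using N by (intro mult_mono) auto
  then show "int N \<le> R"
    using \<open>real_of_int R = 2 ^ (2 * \<eta>) * 2 ^ \<eta>\<close> by linarith
qed

lemma covers_uniform_N: "covers (1 - 1 / 2 ^ \<eta>) (map_pmf (\<lambda>w. nat (w mod int N)) (uniform R)) (pmf_of_set {0..<N})"
  using N_div_R by (intro covers_mono[OF covers_uniform_mod[OF N_pos N_le_R]]) auto

lemma covers_tape_encode:
  "covers ((1 - 1 / 2 ^ \<eta>) ^ m) (map_pmf (tape_encode \<Gamma> h R m a) (uniform (R ^ m)))
     (outcome (pe_encode (pe_pub \<Gamma> k f s h) m a))"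
proof -
  have "covers ((1 - real N / real_of_int R) ^ m) (map_pmf (tape_encode \<Gamma> h R m a) (uniform (R ^ m)))
      (outcome (pe_encode (pe_pub \<Gamma> k f s h) m a))"
    using covers_pe_encode[of "pe_pub \<Gamma> k f s h" R m a] N_pos N_le_R by (simp add: modulus_eq)
  then show ?thesis
    by (rule covers_mono) (use N_div_R in \<open>auto intro!: power_mono\<close>)
qed

lemma covers_tape_history:
  "covers ((1 - 1 / 2 ^ \<eta>) ^ (k * m))
     (map_pmf (tape_history (\<lambda>x. tape_encode \<Gamma> h R k x) (R ^ k) m nx []) (uniform ((R ^ k) ^ m)))
     (history m nx (\<lambda>x. outcome (pe_encode (pe_pub \<Gamma> k f s h) k x)) [])"
  unfolding power_mult using R_pos
  by (intro covers_history covers_tape_encode) (auto intro!: power_le_one)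

end


section \<open>Input privacy\<close>

definition encoding_message :: "alg \<Rightarrow> nat \<Rightarrow> int \<Rightarrow> nat \<Rightarrow> data list \<Rightarrow> (int \<times> data list) list \<Rightarrow> data" where
  "encoding_message A \<eta> \<omega> N args h = reduced (int N) (answer A \<eta> \<omega> (lst (args @ [enc_history h])))"

text \<open>The privacy experiment as a function of the public key alone. It makes sense for any h,
  with or without a known secret key; the domain check is replaced by reduction modulo N.\<close>

definition privacy_ideal :: "alg \<Rightarrow> nat \<Rightarrow> nat \<Rightarrow> pe_pk \<Rightarrow> bool pmf" where
  "privacy_ideal A \<eta> k pk = do {
     \<omega> \<leftarrow> toss A \<eta>;
     let N = modulus (pk_inst pk);
     h \<leftarrow> history (poly (calls A) \<eta>) (encoding_message A \<eta> \<omega> N [pe_enc_pk pk])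
       (\<lambda>x. outcome (pe_encode pk k x)) [];
     let d = final (encoding_message A \<eta> \<omega> N [pe_enc_pk pk] h);
     let x0 = int_of (left d) mod int N;
     let x1 = int_of (right d) mod int N;
     b \<leftarrow> pmf_of_set (UNIV :: bool set);
     \<sigma> \<leftarrow> outcome (pe_encode pk k (if b then x1 else x0));
     let args = [pe_enc_pk pk, enc_history h, Atom x0, Atom x1, lst \<sigma>];
     h' \<leftarrow> history (poly (calls A) \<eta>) (encoding_message A \<eta> \<omega> N args)
       (\<lambda>x. outcome (pe_encode pk k x)) [];
     return_pmf (final (encoding_message A \<eta> \<omega> N args h') = Atom (of_bool b))
   }"

lemma outcome_pe_probgen: "outcome (pe_probgen k pk sk x) = map_pmf (\<lambda>\<sigma>. (\<sigma>, ())) (outcome (pe_encode pk k x))"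
  by (simp add: pe_probgen_def map_pmf_def)

lemma map_fst_pe_probgen: "map_pmf fst (outcome (pe_probgen k pk sk x)) = outcome (pe_encode pk k x)"
  by (simp add: outcome_pe_probgen map_pmf_comp)

text \<open>Along the support of the game all chosen inputs lie in D, hence below N, and every
  reduction modulo N is the identity there.\<close>

lemma privacy_real_ideal:
  fixes A \<eta> k pk D
  defines "m \<equiv> poly (calls A) \<eta>" and "N \<equiv> modulus (pk_inst pk)" and "orac \<equiv> (\<lambda>x. outcome (pe_encode pk k x))"
  defines "nx \<equiv> (\<lambda>\<omega> args h. answer A \<eta> \<omega> (lst (args @ [enc_history h])))"
  defines "game \<equiv> do {
     \<omega> \<leftarrow> toss A \<eta>;
     h \<leftarrow> history m (nx \<omega> [pe_enc_pk pk]) orac [];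
     let d = final (nx \<omega> [pe_enc_pk pk] h);
     let x0 = int_of (left d);
     let x1 = int_of (right d);
     b \<leftarrow> pmf_of_set (UNIV :: bool set);
     \<sigma> \<leftarrow> orac (if b then x1 else x0);
     let args = [pe_enc_pk pk, enc_history h, Atom x0, Atom x1, lst \<sigma>];
     h' \<leftarrow> history m (nx \<omega> args) orac [];
     return_pmf ({x0, x1} \<union> fst ` set (h @ h') \<subseteq> D, final (nx \<omega> args h') = Atom (of_bool b))
   }"
  assumes dom: "\<And>r. r \<in> set_pmf game \<Longrightarrow> fst r" and D: "D \<subseteq> {0..<int N}"
  shows "map_pmf snd game = privacy_ideal A \<eta> k pk"
proof -
  have em: "encoding_message A \<eta> \<omega> N args = (\<lambda>h. reduced (int N) (nx \<omega> args h))" for \<omega> args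
    by (simp add: fun_eq_iff encoding_message_def nx_def)
  define d where "d \<omega> h = final (nx \<omega> [pe_enc_pk pk] h)" for \<omega> h
  define args where "args \<omega> h \<sigma> = [pe_enc_pk pk, enc_history h, Atom (int_of (left (d \<omega> h))),
      Atom (int_of (right (d \<omega> h))), lst \<sigma>]" for \<omega> h \<sigma>
  have inD: "{int_of (left (d \<omega> h)), int_of (right (d \<omega> h))} \<union> fst ` set (h @ h') \<subseteq> {0..<int N}"
    if "\<omega> \<in> set_pmf (toss A \<eta>)" "h \<in> set_pmf (history m (nx \<omega> [pe_enc_pk pk]) orac [])"
      "\<sigma> \<in> set_pmf (orac (if b then int_of (right (d \<omega> h)) else int_of (left (d \<omega> h))))"
      "h' \<in> set_pmf (history m (nx \<omega> (args \<omega> h \<sigma>)) orac [])" for \<omega> h b \<sigma> h'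
  proof -
    have "({int_of (left (d \<omega> h)), int_of (right (d \<omega> h))} \<union> fst ` set (h @ h') \<subseteq> D,
        final (nx \<omega> (args \<omega> h \<sigma>) h') = Atom (of_bool b)) \<in> set_pmf game"
      unfolding game_def Let_def set_bind_pmf UN_iff set_return_pmf d_def[symmetric] args_def[symmetric]
      by (rule bexI[OF _ that(1)], rule bexI[OF _ that(2)], rule bexI[of _ b],
          rule bexI[OF _ that(3)], rule bexI[OF _ that(4)]) simp_all
    from dom[OF this] show ?thesis using D by auto
  qed
  have ne: "\<exists>y. y \<in> set_pmf P" for P :: "'z pmf"
    using set_pmf_not_empty[of P] by blast
  have o: "outcome (pe_encode pk k x) = orac x" for x
    by (simp add: orac_def)
  show ?thesis
    unfolding game_def privacy_ideal_def Let_def map_bind_pmf map_return_pmf snd_conv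
      N_def[symmetric] m_def[symmetric] o em final_reduced d_def[symmetric] args_def[symmetric]
  proof (intro bind_pmf_cong refl)
    fix \<omega> assume \<omega>: "\<omega> \<in> set_pmf (toss A \<eta>)"
    show "history m (nx \<omega> [pe_enc_pk pk]) orac [] =
        history m (\<lambda>h. reduced (int N) (nx \<omega> [pe_enc_pk pk] h)) orac []"
    proof (rule history_reduced[symmetric])
      fix h assume h: "h \<in> set_pmf (history m (nx \<omega> [pe_enc_pk pk]) orac [])"
      \<comment> \<open>\<open>inD\<close> speaks about complete runs; any prefix extends to one, as
        supports are nonempty.\<close>
      obtain \<sigma> where \<sigma>: "\<sigma> \<in> set_pmf (orac (if True then int_of (right (d \<omega> h)) else int_of (left (d \<omega> h))))"
        by (rule exE[OF ne])
      obtain h' where "h' \<in> set_pmf (history m (nx \<omega> (args \<omega> h \<sigma>)) orac [])"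
        by (rule exE[OF ne])
      from inD[OF \<omega> h \<sigma> this] show "fst ` set h \<subseteq> {0..<int N}" by auto
    qed
    fix h assume "h \<in> set_pmf (history m (\<lambda>h. reduced (int N) (nx \<omega> [pe_enc_pk pk] h)) orac [])"
    then have h: "h \<in> set_pmf (history m (nx \<omega> [pe_enc_pk pk]) orac [])"
      using \<open>history m (nx \<omega> [pe_enc_pk pk]) orac [] = _\<close> by simp
    have x: "int_of (left (d \<omega> h)) mod int N = int_of (left (d \<omega> h))"
      "int_of (right (d \<omega> h)) mod int N = int_of (right (d \<omega> h))"
    proof -
      obtain \<sigma> where \<sigma>: "\<sigma> \<in> set_pmf (orac (if True then int_of (right (d \<omega> h)) else int_of (left (d \<omega> h))))"
        by (rule exE[OF ne])
      obtain h' where "h' \<in> set_pmf (history m (nx \<omega> (args \<omega> h \<sigma>)) orac [])"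
        by (rule exE[OF ne])
      from inD[OF \<omega> h \<sigma> this] show "int_of (left (d \<omega> h)) mod int N = int_of (left (d \<omega> h))"
        "int_of (right (d \<omega> h)) mod int N = int_of (right (d \<omega> h))" by auto
    qed
    fix b
    show "orac (if b then int_of (right (d \<omega> h)) else int_of (left (d \<omega> h))) =
        orac (if b then int_of (right (d \<omega> h)) mod int N else int_of (left (d \<omega> h)) mod int N)"
      by (simp add: x)
    fix \<sigma> assume "\<sigma> \<in> set_pmf (orac (if b then int_of (right (d \<omega> h)) mod int N else int_of (left (d \<omega> h)) mod int N))"
    then have \<sigma>: "\<sigma> \<in> set_pmf (orac (if b then int_of (right (d \<omega> h)) else int_of (left (d \<omega> h))))"
      by (simp only: x)
    show "history m (nx \<omega> (args \<omega> h \<sigma>)) orac [] =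
        history m (\<lambda>h'. reduced (int N) (nx \<omega> [pe_enc_pk pk, enc_history h, Atom (int_of (left (d \<omega> h)) mod int N),
          Atom (int_of (right (d \<omega> h)) mod int N), lst \<sigma>] h')) orac []"
      unfolding x args_def[symmetric] using inD[OF \<omega> h \<sigma>]
      by (intro history_reduced[symmetric]) auto
    show "return_pmf (final (nx \<omega> (args \<omega> h \<sigma>) h') = Atom (of_bool b)) =
        return_pmf (final (nx \<omega> [pe_enc_pk pk, enc_history h, Atom (int_of (left (d \<omega> h)) mod int N),
          Atom (int_of (right (d \<omega> h)) mod int N), lst \<sigma>] h') = Atom (of_bool b))" for h'
      by (simp add: x args_def)
  qed
qed

lemma pmf_bind_le:
  assumes "\<And>x. x \<in> set_pmf M \<Longrightarrow> x \<notin> S \<Longrightarrow> pmf (f x) i \<le> c" "0 \<le> c"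
  shows "pmf (bind_pmf M f) i \<le> measure_pmf.prob M S + c"
proof -
  have ind: "integrable (measure_pmf M) (indicat_real S)"
    by (intro measure_pmf.integrable_const_bound[where B = 1]) (auto simp: indicator_def)
  have "pmf (bind_pmf M f) i = measure_pmf.expectation M (\<lambda>x. pmf (f x) i)"
    by (rule pmf_bind)
  also have "\<dots> \<le> measure_pmf.expectation M (\<lambda>x. indicator S x + c)"
  proof (rule integral_mono_AE)
    show "AE x in measure_pmf M. pmf (f x) i \<le> indicator S x + c"
      using assms by (intro AE_pmfI) (auto simp: indicator_def pmf_le_1 intro: order_trans[OF pmf_le_1])
  next
    show "integrable (measure_pmf M) (\<lambda>x. pmf (f x) i)"
      by (intro measure_pmf.integrable_const_bound[where B = 1]) (auto simp: pmf_le_1)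
    show "integrable (measure_pmf M) (\<lambda>x. indicator S x + c)"
      by (intro measure_pmf.integrable_const_bound[where B = "1 + c"])
        (use assms(2) in \<open>auto simp: indicator_def\<close>)
  qed
  also have "\<dots> = measure_pmf.prob M S + c"
    using ind by (subst Bochner_Integration.integral_add) auto
  finally show ?thesis .
qed

lemma pmf_bind_le': "(\<And>x. x \<in> set_pmf M \<Longrightarrow> pmf (f x) i \<le> c) \<Longrightarrow> 0 \<le> c \<Longrightarrow> pmf (bind_pmf M f) i \<le> c"
  using pmf_bind_le[of M "{}" f i c] by simp

text \<open>The challenge has the distribution of an encoding of 0. The draw of b then commutes with
  everything after it, so the final output is compared with a bit that is tossed last.\<close>

lemma (in mlm_instance) privacy_ideal_generator:
  assumes "1 \<le> \<kappa>" "coprime c (int N)"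
  shows "pmf (privacy_ideal A \<eta> k (pe_pub \<Gamma> k f s (ex 1 c))) True \<le> 1 / 2"
proof -
  let ?pk = "pe_pub \<Gamma> k f s (ex 1 c)"
  \<comment> \<open>The output may be neither of the two bits, hence an inequality.\<close>
  have guess: "pmf (bind_pmf (pmf_of_set (UNIV :: bool set)) (\<lambda>b. return_pmf (X = Atom (of_bool b)))) True \<le> 1 / 2" for X
    by (cases "X = Atom 0"; cases "X = Atom 1") (subst pmf_bind_pmf_of_set; auto simp: UNIV_bool)+
  have const: "outcome (pe_encode ?pk k (if b then x else y)) = outcome (pe_encode ?pk k 0)" for b x y
    using assms by (rule outcome_pe_encode_generator)
  show ?thesis
    unfolding privacy_ideal_def Let_def const
    apply (rule pmf_bind_le')
     apply (rule pmf_bind_le')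
      apply (subst bind_commute_pmf)
      apply (rule pmf_bind_le')
       apply (subst bind_commute_pmf)
       apply (rule pmf_bind_le')
        apply (rule guess)
       apply simp_all
    done
qed

section \<open>The SDA distinguisher\<close>

definition privacy_sim :: "alg \<Rightarrow> (data \<Rightarrow> data) \<Rightarrow> nat \<Rightarrow> (data \<Rightarrow> data) \<Rightarrow> nat poly \<Rightarrow> data \<Rightarrow> data" where
  "privacy_sim A mul k F Q z =
    (let un = left z; \<Omega> = int_of (left (right z)); inp = left (right (right z)); v = left (right inp);
         E = env Q un (left inp);
         c0 = 2 ^ len (unary_poly (coins A) un); T = 2 ^ len (unary_poly ([:0, 3 * k:] * calls A) un);
         s = (\<Omega> mod env_range E) mod env_mod E; w1 = \<Omega> div env_range E;
         \<omega> = w1 mod c0; w2 = w1 div c0;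
         t1 = w2 mod T; w3 = w2 div T;
         \<beta> = w3 mod 2; w4 = w3 div 2;
         t = w4 mod env_range E ^ k; t2 = w4 div env_range E ^ k;
         pk = lst [left E, env_gen 1 E, v, sim_powers mul k E s, F un];
         C1 = Node un (Node (Atom \<omega>) (lst [pk]));
         tr = sim_history mul k (next_message A) (len (unary_poly (calls A) un)) E v C1 t1;
         d = final (next_message A (Node C1 tr));
         x0 = int_of (left d) mod env_mod E; x1 = int_of (right d) mod env_mod E;
         \<sigma> = sim_encode mul k E v (if \<beta> = 1 then x1 else x0) t;
         C2 = Node un (Node (Atom \<omega>) (lst [pk, tr, Atom x0, Atom x1, \<sigma>]));
         tr' = sim_history mul k (next_message A) (len (unary_poly (calls A) un)) E v C2 t2
     in Atom (of_bool (final (next_message A (Node C2 tr')) = Atom \<beta>)))"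

lemma polytime_privacy_sim:
  assumes "ppt A" "polytime mul" "polytime F"
  shows "polytime (privacy_sim A mul k F Q)"
  unfolding privacy_sim_def[abs_def]
  by (intro polytime_Let polytime_Let_int;
      intro polytime_sim_history polytime_sim_encode polytime_sim_powers polytime_final polytime_next_message
        polytime_if_int polytime_env polytime_env_access polytime_pow2 polytime_unary_poly assms(1,2)
        polytime_comp[OF assms(3)] polytime_intros)

text \<open>Lies between program and experiment: genuine group operations as in the experiment, but
  randomness given by explicit digits as in the program.\<close>

definition privacy_tape :: "alg \<Rightarrow> nat \<Rightarrow> nat \<Rightarrow> int \<Rightarrow> pe_pk \<Rightarrow> int \<Rightarrow> int \<Rightarrow> int \<Rightarrow> int \<Rightarrow> int \<Rightarrow> bool" where
  "privacy_tape A \<eta> k R pk \<omega> t1 \<beta> t t2 =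
    (let N = modulus (pk_inst pk); enc = (\<lambda>x. tape_encode (pk_inst pk) (pk_h pk) R k x);
         m = poly (calls A) \<eta>; nx = encoding_message A \<eta> \<omega> N;
         h = tape_history enc (R ^ k) m (nx [pe_enc_pk pk]) [] t1;
         d = final (nx [pe_enc_pk pk] h);
         x0 = int_of (left d) mod int N; x1 = int_of (right d) mod int N;
         \<sigma> = enc (if \<beta> = 1 then x1 else x0) t;
         args = [pe_enc_pk pk, enc_history h, Atom x0, Atom x1, lst \<sigma>];
         h' = tape_history enc (R ^ k) m (nx args) [] t2
     in final (nx args h') = Atom \<beta>)"

context simulation
begin

lemma pe_enc_pk_sim:
  assumes "F (unary \<eta>) = lst (map Atom (coeffs f))"
  shows "lst [left E, env_gen 1 E, v, sim_powers mul k E (int s), F (unary \<eta>)] = pe_enc_pk (pe_pub \<Gamma> k f s v)"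
  using \<kappa> assms by (simp add: pe_enc_pk_def E env_gen_E gen_eq sim_powers_eq ex_pow_nat)

lemma sim_history_answer:
  assumes "v \<in> carrier (grp \<Gamma> 1)" "0 \<le> w" "w < (R ^ k) ^ m"
    "3 + m * (1 + entry_bound k) + 3 * \<eta> * k * m \<le> b"
  shows "sim_history mul k (next_message A) m E v (Node (unary \<eta>) (Node (Atom \<omega>) (lst args))) w =
    enc_history (tape_history (\<lambda>x. tape_encode \<Gamma> v R k x) (R ^ k) m (encoding_message A \<eta> \<omega> N args) [] w)"
proof -
  have "(R ^ k) ^ m = 2 ^ (3 * \<eta> * k * m)"
    by (simp add: R_eq power_mult)
  then show ?thesis
    using sim_history_eq[OF assms(1,2) _ assms(4), of "next_message A" "context_of \<eta> \<omega> args"] assms(3)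
    unfolding next_message_answer encoding_message_def[abs_def] by (simp add: context_of_def)
qed

lemma privacy_sim_eq:
  fixes c0 T :: int
  assumes E_eq: "E = env Q (unary \<eta>) (enc_mlm \<Gamma>)" and v: "v \<in> carrier (grp \<Gamma> 1)"
    and F: "F (unary \<eta>) = lst (map Atom (coeffs f))"
    and b': "3 + poly (calls A) \<eta> * (1 + entry_bound k) + 3 * \<eta> * k * poly (calls A) \<eta> \<le> b"
    and r: "0 \<le> r" "r < R" and \<omega>: "0 \<le> \<omega>" "\<omega> < c0" and t1: "0 \<le> t1" "t1 < T" and \<beta>: "0 \<le> \<beta>" "\<beta> < 2"
    and t: "0 \<le> t" "t < R ^ k" and t2: "0 \<le> t2" "t2 < T"
    and c0: "c0 = 2 ^ poly (coins A) \<eta>" and T: "T = (R ^ k) ^ poly (calls A) \<eta>"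
    and \<Omega>: "\<Omega> mod R = r" "\<Omega> div R mod c0 = \<omega>" "\<Omega> div R div c0 mod T = t1"
      "\<Omega> div R div c0 div T mod 2 = \<beta>" "\<Omega> div R div c0 div T div 2 mod R ^ k = t"
      "\<Omega> div R div c0 div T div 2 div R ^ k = t2"
  shows "privacy_sim A mul k F Q (lst [unary \<eta>, Atom \<Omega>, lst [enc_mlm \<Gamma>, v]]) =
    Atom (of_bool (privacy_tape A \<eta> k R (pe_pub \<Gamma> k f (nat (r mod int N)) v) \<omega> t1 \<beta> t t2))"
proof -
  have final: "final (next_message A (Node (Node (unary \<eta>) (Node (Atom \<omega>) (lst args))) (enc_history h))) =
      final (encoding_message A \<eta> \<omega> N args h)" for args h
    using next_message_answer[of A \<eta> \<omega> args "enc_history h"]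
    by (simp add: context_of_def encoding_message_def)
  have lens: "2 ^ len (unary_poly (coins A) (unary \<eta>)) = c0"
    "2 ^ len (unary_poly ([:0, 3 * k:] * calls A) (unary \<eta>)) = T" "len (unary_poly (calls A) (unary \<eta>)) = poly (calls A) \<eta>"
    by (simp_all add: c0 T R_eq mult.assoc mult.left_commute flip: power_mult)
  have pk: "lst [left E, env_gen 1 E, v, sim_powers mul k E (r mod int N), F (unary \<eta>)] =
      pe_enc_pk (pe_pub \<Gamma> k f (nat (r mod int N)) v)"
    using pe_enc_pk_sim[where F = F, OF F, of v k "nat (r mod int N)"] N_pos by simp
  have z: "left (lst [unary \<eta>, Atom \<Omega>, lst [enc_mlm \<Gamma>, v]]) = unary \<eta>"
    "int_of (left (right (lst [unary \<eta>, Atom \<Omega>, lst [enc_mlm \<Gamma>, v]]))) = \<Omega>"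
    "left (right (right (lst [unary \<eta>, Atom \<Omega>, lst [enc_mlm \<Gamma>, v]]))) = lst [enc_mlm \<Gamma>, v]"
    "left (lst [enc_mlm \<Gamma>, v]) = enc_mlm \<Gamma>" "left (right (lst [enc_mlm \<Gamma>, v])) = v"
    by (simp_all add: lst_Cons)
  show ?thesis
    unfolding privacy_sim_def z E_eq[symmetric] Let_def lens env_mod_E E(3) \<Omega>
      pk sim_history_answer[OF v t1[unfolded T] b'] final sim_encode_eq[OF v]
      sim_history_answer[OF v t2[unfolded T] b'] privacy_tape_def pe_pub_sel modulus_eq ..
qed

lemma pmf_of_set_bool: "map_pmf (\<lambda>\<beta>. \<beta> = 1) (uniform 2) = pmf_of_set (UNIV :: bool set)"
proof -
  have "bij_betw (\<lambda>\<beta>. \<beta> = 1) {0..<2 :: int} (UNIV :: bool set)"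
    by (rule bij_betw_byWitness[where f' = of_bool]) auto
  then show ?thesis
    unfolding uniform_def by (intro map_pmf_of_set_bij_betw) auto
qed

lemma covers_bind_left: "covers c P Q \<Longrightarrow> covers c (bind_pmf P F) (bind_pmf Q F)"
  using covers_bind[of c P Q 1 F F] by (simp add: covers_refl)

lemma covers_privacy_tape:
  fixes A \<eta>' f s k v
  defines "pk \<equiv> pe_pub \<Gamma> k f s v" and "m \<equiv> poly (calls A) \<eta>'" and "\<epsilon> \<equiv> 1 / 2 ^ \<eta> :: real"
  shows "covers ((1 - \<epsilon>) ^ (k * m) * ((1 - \<epsilon>) ^ k * (1 - \<epsilon>) ^ (k * m)))
    (bind_pmf (toss A \<eta>') (\<lambda>\<omega>. bind_pmf (uniform ((R ^ k) ^ m)) (\<lambda>t1. bind_pmf (uniform 2) (\<lambda>\<beta>.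
       bind_pmf (uniform (R ^ k)) (\<lambda>t. bind_pmf (uniform ((R ^ k) ^ m)) (\<lambda>t2.
         return_pmf (privacy_tape A \<eta>' k R pk \<omega> t1 \<beta> t t2)))))))
    (privacy_ideal A \<eta>' k pk)"
proof -
  let ?enc = "\<lambda>x. tape_encode \<Gamma> v R k x"
  let ?nx = "\<lambda>\<omega>. encoding_message A \<eta>' \<omega> N"
  let ?x = "\<lambda>\<omega> h b. if b then int_of (right (final (?nx \<omega> [pe_enc_pk pk] h))) mod int N
     else int_of (left (final (?nx \<omega> [pe_enc_pk pk] h))) mod int N"
  let ?args = "\<lambda>\<omega> h \<sigma>. [pe_enc_pk pk, enc_history h, Atom (int_of (left (final (?nx \<omega> [pe_enc_pk pk] h))) mod int N),
     Atom (int_of (right (final (?nx \<omega> [pe_enc_pk pk] h))) mod int N), lst \<sigma>]"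
  have \<epsilon>: "0 \<le> 1 - \<epsilon>"
    by (simp add: \<epsilon>_def)
  have "bind_pmf (toss A \<eta>') (\<lambda>\<omega>. bind_pmf (uniform ((R ^ k) ^ m)) (\<lambda>t1. bind_pmf (uniform 2) (\<lambda>\<beta>.
       bind_pmf (uniform (R ^ k)) (\<lambda>t. bind_pmf (uniform ((R ^ k) ^ m)) (\<lambda>t2.
         return_pmf (privacy_tape A \<eta>' k R pk \<omega> t1 \<beta> t t2)))))) =
      bind_pmf (toss A \<eta>') (\<lambda>\<omega>.
      bind_pmf (map_pmf (tape_history ?enc (R ^ k) m (?nx \<omega> [pe_enc_pk pk]) []) (uniform ((R ^ k) ^ m))) (\<lambda>h.
      bind_pmf (map_pmf (\<lambda>\<beta>. \<beta> = 1) (uniform 2)) (\<lambda>b.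
      bind_pmf (map_pmf (?enc (?x \<omega> h b)) (uniform (R ^ k))) (\<lambda>\<sigma>.
      bind_pmf (map_pmf (tape_history ?enc (R ^ k) m (?nx \<omega> (?args \<omega> h \<sigma>)) []) (uniform ((R ^ k) ^ m))) (\<lambda>h'.
        return_pmf (final (?nx \<omega> (?args \<omega> h \<sigma>) h') = Atom (of_bool b)))))))"
    unfolding bind_map_pmf
    by (intro bind_pmf_cong refl)
      (auto simp: privacy_tape_def Let_def pk_def m_def modulus_eq set_uniform of_bool_def)
  also have "covers ((1 - \<epsilon>) ^ (k * m) * ((1 - \<epsilon>) ^ k * (1 - \<epsilon>) ^ (k * m))) \<dots> (privacy_ideal A \<eta>' k pk)"
    unfolding privacy_ideal_def pmf_of_set_bool Let_def m_def[symmetric] pk_def pe_pub_sel modulus_eq \<epsilon>_def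
    by (rule covers_bind_same, rule covers_bind[OF covers_tape_history], rule covers_bind_same,
        rule covers_bind[OF covers_tape_encode], rule covers_bind_left[OF covers_tape_history])
      (use \<epsilon> in \<open>auto simp: \<epsilon>_def\<close>)
  finally show ?thesis .
qed

text \<open>The exponent counts approximated samples from \<open>\<int>\<^sub>N\<close>: one for s,
  k for the challenge and k for each of the m questions in both phases. The coins and the bit are
  exact.\<close>

lemma covers_privacy_sim:
  fixes A f v k Q F
  defines "m \<equiv> poly (calls A) \<eta>" and "c0 \<equiv> 2 ^ poly (coins A) \<eta> :: int"
  defines "T \<equiv> (R ^ k) ^ m"
  assumes E_eq: "E = env Q (unary \<eta>) (enc_mlm \<Gamma>)" and v: "v \<in> carrier (grp \<Gamma> 1)"
    and F: "F (unary \<eta>) = lst (map Atom (coeffs f))"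
    and b': "3 + m * (1 + entry_bound k) + 3 * \<eta> * k * m \<le> b"
  shows "covers ((1 - 1 / 2 ^ \<eta>) ^ (1 + k + 2 * k * m))
    (map_pmf (\<lambda>\<Omega>. privacy_sim A mul k F Q (lst [unary \<eta>, Atom \<Omega>, lst [enc_mlm \<Gamma>, v]]) = Atom 1)
      (uniform (R * (c0 * (T * (2 * (R ^ k * T)))))))
    (bind_pmf (pmf_of_set {0..<N}) (\<lambda>s. privacy_ideal A \<eta> k (pe_pub \<Gamma> k f s v)))"
proof -
  let ?P = "\<lambda>r \<omega> t1 \<beta> t t2. privacy_tape A \<eta> k R (pe_pub \<Gamma> k f (nat (r mod int N)) v) \<omega> t1 \<beta> t t2"
  have pos: "0 < R" "0 < c0" "0 < T" "0 < R ^ k"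
    using R_pos by (simp_all add: c0_def T_def)
  have c0': "c0 = 2 ^ poly (coins A) \<eta>" and T': "T = (R ^ k) ^ poly (calls A) \<eta>"
    by (simp_all add: c0_def T_def m_def)
  have "map_pmf (\<lambda>\<Omega>. privacy_sim A mul k F Q (lst [unary \<eta>, Atom \<Omega>, lst [enc_mlm \<Gamma>, v]]) = Atom 1)
      (uniform (R * (c0 * (T * (2 * (R ^ k * T)))))) =
    bind_pmf (uniform (R * (c0 * (T * (2 * (R ^ k * T)))))) (\<lambda>w. return_pmf
      (?P (w mod R) (w div R mod c0) (w div R div c0 mod T) (w div R div c0 div T mod 2)
         (w div R div c0 div T div 2 mod R ^ k) (w div R div c0 div T div 2 div R ^ k)))"
    unfolding map_pmf_def
  proof (intro bind_pmf_cong refl arg_cong[of _ _ return_pmf])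
    fix w assume "w \<in> set_pmf (uniform (R * (c0 * (T * (2 * (R ^ k * T))))))"
    then have w: "0 \<le> w" "w < R * (c0 * (T * (2 * (R ^ k * T))))"
      by (simp_all add: set_uniform pos)
    \<comment> \<open>All digits but the last are remainders and bounded as such. The last is a
      quotient, and its bound comes from the size of the whole tape.\<close>
    note d1 = div_bounds[OF w pos(1)]
    note d2 = div_bounds[OF conjunct1[OF d1] conjunct2[OF d1] pos(2)]
    note d3 = div_bounds[OF conjunct1[OF d2] conjunct2[OF d2] pos(3)]
    note d4 = div_bounds[OF conjunct1[OF d3] conjunct2[OF d3] zero_less_numeral]
    note t2 = div_bounds[OF conjunct1[OF d4] conjunct2[OF d4] pos(4), THEN conjunct1]
      div_bounds[OF conjunct1[OF d4] conjunct2[OF d4] pos(4), THEN conjunct2]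
    have "privacy_sim A mul k F Q (lst [unary \<eta>, Atom w, lst [enc_mlm \<Gamma>, v]]) = Atom (of_bool
        (?P (w mod R) (w div R mod c0) (w div R div c0 mod T) (w div R div c0 div T mod 2)
         (w div R div c0 div T div 2 mod R ^ k) (w div R div c0 div T div 2 div R ^ k)))"
      by (rule privacy_sim_eq[where ?c0.0 = c0 and T = T, OF E_eq v])
        (rule F b'[unfolded m_def] t2 c0' T' refl pos_mod_sign pos_mod_bound pos zero_less_numeral)+
    then show "(privacy_sim A mul k F Q (lst [unary \<eta>, Atom w, lst [enc_mlm \<Gamma>, v]]) = Atom 1) =
        ?P (w mod R) (w div R mod c0) (w div R div c0 mod T) (w div R div c0 div T mod 2)
         (w div R div c0 div T div 2 mod R ^ k) (w div R div c0 div T div 2 div R ^ k)"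
      by simp
  qed
  also have "\<dots> = bind_pmf (uniform R) (\<lambda>r. bind_pmf (uniform c0) (\<lambda>\<omega>. bind_pmf (uniform T) (\<lambda>t1.
      bind_pmf (uniform 2) (\<lambda>\<beta>. bind_pmf (uniform (R ^ k)) (\<lambda>t. bind_pmf (uniform T) (\<lambda>t2.
        return_pmf (?P r \<omega> t1 \<beta> t t2)))))))"
    by (rule uniform_split6[where F = "\<lambda>r \<omega> t1 \<beta> t t2. return_pmf (?P r \<omega> t1 \<beta> t t2)"]) (simp_all add: pos)
  also have "\<dots> = bind_pmf (map_pmf (\<lambda>r. nat (r mod int N)) (uniform R)) (\<lambda>s. bind_pmf (toss A \<eta>) (\<lambda>\<omega>.
      bind_pmf (uniform T) (\<lambda>t1. bind_pmf (uniform 2) (\<lambda>\<beta>. bind_pmf (uniform (R ^ k)) (\<lambda>t. bind_pmf (uniform T) (\<lambda>t2.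
        return_pmf (privacy_tape A \<eta> k R (pe_pub \<Gamma> k f s v) \<omega> t1 \<beta> t t2)))))))"
    unfolding bind_map_pmf toss_uniform c0' ..
  also have "covers ((1 - 1 / 2 ^ \<eta>) * ((1 - 1 / 2 ^ \<eta>) ^ (k * m) * ((1 - 1 / 2 ^ \<eta>) ^ k * (1 - 1 / 2 ^ \<eta>) ^ (k * m)))) \<dots>
      (bind_pmf (pmf_of_set {0..<N}) (\<lambda>s. privacy_ideal A \<eta> k (pe_pub \<Gamma> k f s v)))"
    unfolding T_def m_def
    by (rule covers_bind, rule covers_uniform_N, rule covers_privacy_tape)
      (intro mult_nonneg_nonneg zero_le_power; simp)
  finally have "covers ((1 - 1 / 2 ^ \<eta>) * ((1 - 1 / 2 ^ \<eta>) ^ (k * m) * ((1 - 1 / 2 ^ \<eta>) ^ k * (1 - 1 / 2 ^ \<eta>) ^ (k * m))))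
    (map_pmf (\<lambda>\<Omega>. privacy_sim A mul k F Q (lst [unary \<eta>, Atom \<Omega>, lst [enc_mlm \<Gamma>, v]]) = Atom 1)
      (uniform (R * (c0 * (T * (2 * (R ^ k * T)))))))
    (bind_pmf (pmf_of_set {0..<N}) (\<lambda>s. privacy_ideal A \<eta> k (pe_pub \<Gamma> k f s v)))" .
  moreover have "(1 - 1 / 2 ^ \<eta>) * ((1 - 1 / 2 ^ \<eta>) ^ (k * m) * ((1 - 1 / 2 ^ \<eta>) ^ k * (1 - 1 / 2 ^ \<eta>) ^ (k * m))) =
      (1 - 1 / 2 ^ \<eta> :: real) ^ (1 + k + 2 * k * m)"
    by (simp only: mult_2 distrib_right power_add power_one_right mult.assoc mult.left_commute)
  ultimately show ?thesis
    by (simp only:)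
qed

end

lemma privacy_game_pe:
  fixes \<G> D M n A \<eta>
  defines "k \<equiv> ceillog2 (n + 1)"
  shows "privacy_game (pe_scheme \<G> D M n) f A \<eta> = bind_pmf (pe_keygen \<G> k \<eta> (f \<eta>)) (\<lambda>(pk, sk). do {
     \<omega> \<leftarrow> toss A \<eta>;
     h \<leftarrow> history (poly (calls A) \<eta>) (\<lambda>h. answer A \<eta> \<omega> (lst ([pe_enc_pk pk] @ [enc_history h])))
       (\<lambda>x. outcome (pe_encode pk k x)) [];
     let d = final (answer A \<eta> \<omega> (lst ([pe_enc_pk pk] @ [enc_history h])));
     let x0 = int_of (left d);
     let x1 = int_of (right d);
     b \<leftarrow> pmf_of_set (UNIV :: bool set);
     \<sigma> \<leftarrow> outcome (pe_encode pk k (if b then x1 else x0));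
     let args = [pe_enc_pk pk, enc_history h, Atom x0, Atom x1, lst \<sigma>];
     h' \<leftarrow> history (poly (calls A) \<eta>) (\<lambda>h. answer A \<eta> \<omega> (lst (args @ [enc_history h])))
       (\<lambda>x. outcome (pe_encode pk k x)) [];
     return_pmf ({x0, x1} \<union> fst ` set (h @ h') \<subseteq> D (sk_q sk),
       final (answer A \<eta> \<omega> (lst (args @ [enc_history h']))) = Atom (of_bool b))
   })"
  unfolding privacy_game_def oracle_run_history bind_map_pmf Let_def enc_transcript_pe
  by (simp add: pe_scheme_def Let_def map_fst_pe_probgen outcome_pe_probgen bind_map_pmf k_def
      case_prod_beta map_pmf_comp cong: if_cong)

lemma map_pmf_privacy_game:
  assumes "stays_in_domain (privacy_game (pe_scheme \<G> D M n) f A)" "\<eta> \<ge> 2"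
    and D: "\<And>p q \<Gamma>. (p, q, \<Gamma>) \<in> set_pmf (\<G> \<eta> (2 * k + 1)) \<Longrightarrow> D q \<subseteq> {0..<int (modulus \<Gamma>)}"
    and k: "k = ceillog2 (n + 1)"
  shows "map_pmf snd (privacy_game (pe_scheme \<G> D M n) f A \<eta>) =
    bind_pmf (pe_keygen \<G> k \<eta> (f \<eta>)) (\<lambda>(pk, sk). privacy_ideal A \<eta> k pk)"
proof -
  have dom: "fst r" if "r \<in> set_pmf (privacy_game (pe_scheme \<G> D M n) f A \<eta>)" for r
    using assms(1,2) that by (auto simp: stays_in_domain_def)
  show ?thesis
    unfolding privacy_game_pe k[symmetric] map_bind_pmf
  proof (rule bind_pmf_cong[OF refl])
    fix key assume key: "key \<in> set_pmf (pe_keygen \<G> k \<eta> (f \<eta>))"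
    obtain pk sk where [simp]: "key = (pk, sk)" by (cases key)
    have D': "D (sk_q sk) \<subseteq> {0..<int (modulus (pk_inst pk))}"
      using key D by (fastforce simp: pe_keygen_eq)
    note in_game = dom[unfolded privacy_game_pe k[symmetric] set_bind_pmf, OF UN_I[OF key],
        unfolded \<open>key = (pk, sk)\<close> prod.case, folded set_bind_pmf]
    show "map_pmf snd (case key of (pk, sk) \<Rightarrow> do {
     \<omega> \<leftarrow> toss A \<eta>;
     h \<leftarrow> history (poly (calls A) \<eta>) (\<lambda>h. answer A \<eta> \<omega> (lst ([pe_enc_pk pk] @ [enc_history h])))
       (\<lambda>x. outcome (pe_encode pk k x)) [];
     let d = final (answer A \<eta> \<omega> (lst ([pe_enc_pk pk] @ [enc_history h])));
     let x0 = int_of (left d);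
     let x1 = int_of (right d);
     b \<leftarrow> pmf_of_set (UNIV :: bool set);
     \<sigma> \<leftarrow> outcome (pe_encode pk k (if b then x1 else x0));
     let args = [pe_enc_pk pk, enc_history h, Atom x0, Atom x1, lst \<sigma>];
     h' \<leftarrow> history (poly (calls A) \<eta>) (\<lambda>h. answer A \<eta> \<omega> (lst (args @ [enc_history h])))
       (\<lambda>x. outcome (pe_encode pk k x)) [];
     return_pmf ({x0, x1} \<union> fst ` set (h @ h') \<subseteq> D (sk_q sk),
       final (answer A \<eta> \<omega> (lst (args @ [enc_history h']))) = Atom (of_bool b))
   }) = (case key of (pk, sk) \<Rightarrow> privacy_ideal A \<eta> k pk)"
      unfolding \<open>key = (pk, sk)\<close> prod.case
      by (rule privacy_real_ideal[OF in_game D'])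
  qed
qed

lemma domain_subset_modulus:
  assumes "small_subsets D" "mlm_instance \<Gamma> p q \<kappa>"
  shows "D q \<subseteq> {0..<int (modulus \<Gamma>)}"
proof -
  interpret mlm_instance \<Gamma> p q \<kappa> by fact
  have "D q \<subseteq> {0..<int q}"
    using assms(1) primes(2) by (auto simp: small_subsets_def)
  moreover have "int q \<le> int (modulus \<Gamma>)"
    using primes(1) by (simp add: modulus prime_ge_1_nat[simplified] del: of_nat_mult)
  ultimately show ?thesis by fastforce
qed

lemma pe_private:
  fixes \<G> :: generator
  assumes n: "n \<ge> 1" and k: "k = ceillog2 (n + 1)" and gen: "multilinear_generator \<G> (2 * k + 1)"
    and D: "small_subsets D" and SDA: "SDA \<G> (2 * k + 1)"
  shows "input_private (pe_scheme \<G> D M n) (pe_family \<G> D M n)"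
  unfolding input_private_def
proof (intro ballI allI impI)
  fix f A
  assume f: "f \<in> pe_family \<G> D M n"
    and A: "ppt A \<and> stays_in_domain (privacy_game (pe_scheme \<G> D M n) f A)"
  obtain F where F: "polytime F" "\<And>\<eta>. F (unary \<eta>) = lst (map Atom (coeffs (f \<eta>)))"
    using f by (auto simp: pe_family_def)
  obtain mul e and B :: "nat poly" where mul: "polytime mul" and sim:
    "\<And>\<eta> p q \<Gamma> Q. \<eta> \<ge> 2 \<Longrightarrow> (p, q, \<Gamma>) \<in> set_pmf (\<G> \<eta> (2 * k + 1)) \<Longrightarrow> 3 + 2 * poly B \<eta> + 2 * \<eta> \<le> poly Q \<eta> \<Longrightarrow>
       simulation \<Gamma> p q (2 * k + 1) mul e (poly B \<eta>) (poly Q \<eta>) \<eta> (2 ^ (3 * \<eta>)) (env Q (unary \<eta>) (enc_mlm \<Gamma>))"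
    using simulation_exists[OF gen] by (metis le_add2)
  \<comment> \<open>The sum of the two demands on the clamp: room for exponentiation and room for a
    transcript.\<close>
  define Q where "Q = [:3, 2:] + [:2:] * B + calls A * ([:1:] + [:3, 2:] + [:k:] * ([:1:] + B)) + [:0, 3 * k:] * calls A"
  have Q: "3 + 2 * poly B \<eta> + 2 * \<eta> \<le> poly Q \<eta>"
    "3 + poly (calls A) \<eta> * (1 + (3 + 2 * \<eta> + k * (1 + poly B \<eta>))) + 3 * \<eta> * k * poly (calls A) \<eta> \<le> poly Q \<eta>" for \<eta>
    by (simp_all add: Q_def algebra_simps)
  \<comment> \<open>Bits for the six digits in the order in which they are read; an approximated
    element of \<open>\<int>\<^sub>N\<close> takes 3\<eta> bits.\<close>
  define J where "J = [:0, 3:] + (coins A + ([:0, 3 * k:] * calls A + ([:1:] + ([:0, 3 * k:] + [:0, 3 * k:] * calls A))))"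
  define C where "C = \<lparr>prog = privacy_sim A mul k F Q, coins = J, calls = 0\<rparr>"
  have "ppt C"
    using A polytime_privacy_sim[OF _ mul F(1)] by (simp add: ppt_def C_def)
  define \<delta> where "\<delta> \<eta> = (1 - 1 / 2 ^ \<eta> :: real) ^ (1 + k + 2 * k * poly (calls A) \<eta>)" for \<eta>
  have \<delta>: "0 \<le> \<delta> \<eta>" "\<delta> \<eta> \<le> 1" for \<eta>
    unfolding \<delta>_def by (rule zero_le_power, simp) (rule power_le_one; simp)
  define adv where "adv \<eta> = \<bar>pmf (SDA_game \<G> (2 * k + 1) 1 False C \<eta>) True - pmf (SDA_game \<G> (2 * k + 1) 1 True C \<eta>) True\<bar>" for \<eta>
  have adv: "negligible adv"
    using SDA \<open>ppt C\<close> unfolding SDA_def adv_def by auto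
  \<comment> \<open>The two hybrids: h is u^q or u itself. In the first the experiment is the real
    game, in the second h is uniform.\<close>
  define ideal where "ideal \<eta> inside = bind_pmf (\<G> \<eta> (2 * k + 1)) (\<lambda>(p, q, \<Gamma>).
      bind_pmf (pmf_of_set (carrier (grp \<Gamma> 1))) (\<lambda>u. bind_pmf (pmf_of_set {0..<modulus \<Gamma>}) (\<lambda>s.
        privacy_ideal A \<eta> k (pe_pub \<Gamma> k (f \<eta>) s (if inside then u [^]\<^bsub>grp \<Gamma> 1\<^esub> q else u)))))" for \<eta> inside
  have bound: "success (privacy_game (pe_scheme \<G> D M n) f A) \<eta> \<le> 1 / 2 + (4 / 2 ^ \<eta> + (2 * (1 - \<delta> \<eta>) + adv \<eta>))"
    if \<eta>: "\<eta> \<ge> 2" for \<eta>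
  proof -
    have inst: "mlm_instance \<Gamma> p q (2 * k + 1)" if "(p, q, \<Gamma>) \<in> set_pmf (\<G> \<eta> (2 * k + 1))" for p q \<Gamma>
      using multilinear_generatorD(1)[OF gen \<eta> that] .
    have "map_pmf snd (privacy_game (pe_scheme \<G> D M n) f A \<eta>) = ideal \<eta> True"
    proof -
      have "map_pmf snd (privacy_game (pe_scheme \<G> D M n) f A \<eta>) =
          bind_pmf (pe_keygen \<G> k \<eta> (f \<eta>)) (\<lambda>(pk, sk). privacy_ideal A \<eta> k pk)"
        using A inst domain_subset_modulus[OF D] by (intro map_pmf_privacy_game[OF _ \<eta> _ k]) blast+
      \<comment> \<open>Key generation draws s before u, the SDA challenge fixes u first; the draws
        are independent and commute.\<close>
      also have "\<dots> = ideal \<eta> True"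
        unfolding pe_keygen_eq ideal_def if_True bind_assoc_pmf bind_return_pmf case_prod_unfold
        by (intro bind_pmf_cong refl) (simp add: bind_assoc_pmf bind_return_pmf, rule bind_commute_pmf)
      finally show ?thesis .
    qed
    moreover have "covers (\<delta> \<eta>) (SDA_game \<G> (2 * k + 1) 1 inside C \<eta>) (ideal \<eta> inside)" for inside
      unfolding SDA_game_def ideal_def
    proof (rule covers_bind_same)
      fix x assume "x \<in> set_pmf (\<G> \<eta> (2 * k + 1))"
      then obtain p q \<Gamma> where x: "x = (p, q, \<Gamma>)" and G: "(p, q, \<Gamma>) \<in> set_pmf (\<G> \<eta> (2 * k + 1))"
        by (cases x) auto
      interpret simulation \<Gamma> p q "2 * k + 1" mul e "poly B \<eta>" "poly Q \<eta>" \<eta> "2 ^ (3 * \<eta>)" "env Q (unary \<eta>) (enc_mlm \<Gamma>)"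
        using sim[OF \<eta> G Q(1)] .
      have fin: "finite (carrier (grp \<Gamma> 1))" "carrier (grp \<Gamma> 1) \<noteq> {}"
        using order_grp[of 1] N_pos gen_closed[of 1] by (auto simp: Coset.order_def intro: card_ge_0_finite)
      have "covers (\<delta> \<eta>) (bind_pmf (pmf_of_set (carrier (grp \<Gamma> 1))) (\<lambda>u. bind_pmf (toss C \<eta>) (\<lambda>\<omega>.
            return_pmf (answer C \<eta> \<omega> (lst [enc_mlm \<Gamma>, if inside then u [^]\<^bsub>grp \<Gamma> 1\<^esub> q else u]) = Atom 1))))
          (bind_pmf (pmf_of_set (carrier (grp \<Gamma> 1))) (\<lambda>u. bind_pmf (pmf_of_set {0..<modulus \<Gamma>}) (\<lambda>s.
            privacy_ideal A \<eta> k (pe_pub \<Gamma> k (f \<eta>) s (if inside then u [^]\<^bsub>grp \<Gamma> 1\<^esub> q else u)))))"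
      proof (rule covers_bind_same[OF _ \<delta>(1)])
        fix u assume "u \<in> set_pmf (pmf_of_set (carrier (grp \<Gamma> 1)))"
        then have "u \<in> carrier (grp \<Gamma> 1)" using fin by simp
        then have v: "(if inside then u [^]\<^bsub>grp \<Gamma> 1\<^esub> q else u) \<in> carrier (grp \<Gamma> 1)"
          using group.is_monoid[OF group_grp, of 1] by (auto intro: monoid.nat_pow_closed)
        have "3 + poly (calls A) \<eta> * (1 + entry_bound k) + 3 * \<eta> * k * poly (calls A) \<eta> \<le> poly Q \<eta>"
          unfolding entry_bound_def by (rule Q(2))
        note cov = covers_privacy_sim[where F = F and Q = Q and f = "f \<eta>", OF refl v F(2) this]
        have "toss C \<eta> = uniform (2 ^ (3 * \<eta>) * (2 ^ poly (coins A) \<eta> * (((2 ^ (3 * \<eta>)) ^ k) ^ poly (calls A) \<eta> *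
            (2 * ((2 ^ (3 * \<eta>)) ^ k * ((2 ^ (3 * \<eta>)) ^ k) ^ poly (calls A) \<eta>)))))"
        proof -
          have "poly (coins C) \<eta> = 3 * \<eta> + (poly (coins A) \<eta> + (3 * \<eta> * k * poly (calls A) \<eta> +
              (1 + (3 * \<eta> * k + 3 * \<eta> * k * poly (calls A) \<eta>))))"
            by (simp add: C_def J_def algebra_simps)
          then show ?thesis
            by (simp only: toss_uniform power_add power_mult power_one_right)
        qed
        then show "covers (\<delta> \<eta>) (bind_pmf (toss C \<eta>) (\<lambda>\<omega>.
            return_pmf (answer C \<eta> \<omega> (lst [enc_mlm \<Gamma>, if inside then u [^]\<^bsub>grp \<Gamma> 1\<^esub> q else u]) = Atom 1)))
          (bind_pmf (pmf_of_set {0..<modulus \<Gamma>}) (\<lambda>s.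
            privacy_ideal A \<eta> k (pe_pub \<Gamma> k (f \<eta>) s (if inside then u [^]\<^bsub>grp \<Gamma> 1\<^esub> q else u))))"
          using cov by (simp add: \<delta>_def answer_def C_def modulus_eq map_pmf_def)
      qed
      then show "covers (\<delta> \<eta>) (case x of (p, q, \<Gamma>) \<Rightarrow> bind_pmf (pmf_of_set (carrier (grp \<Gamma> 1))) (\<lambda>u. bind_pmf (toss C \<eta>) (\<lambda>\<omega>.
            let v = if inside then u [^]\<^bsub>grp \<Gamma> 1\<^esub> q else u in return_pmf (answer C \<eta> \<omega> (lst [enc_mlm \<Gamma>, v]) = Atom 1))))
          (case x of (p, q, \<Gamma>) \<Rightarrow> bind_pmf (pmf_of_set (carrier (grp \<Gamma> 1))) (\<lambda>u. bind_pmf (pmf_of_set {0..<modulus \<Gamma>}) (\<lambda>s.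
            privacy_ideal A \<eta> k (pe_pub \<Gamma> k (f \<eta>) s (if inside then u [^]\<^bsub>grp \<Gamma> 1\<^esub> q else u)))))"
        by (simp add: x Let_def)
    qed (rule \<delta>(1))
    \<comment> \<open>The distinguisher differs from the hybrid by at most 1 - \<delta> in each of
      the two games, whence the factor 2 in the bound.\<close>
    note cov = covers_True_le[OF this \<delta>(2)]
    have "pmf (ideal \<eta> False) True \<le> 4 / 2 ^ \<eta> + 1 / 2"
      unfolding ideal_def if_False
    proof (rule pmf_bind_le')
      fix x assume "x \<in> set_pmf (\<G> \<eta> (2 * k + 1))"
      then obtain p q \<Gamma> where x: "x = (p, q, \<Gamma>)" and G: "(p, q, \<Gamma>) \<in> set_pmf (\<G> \<eta> (2 * k + 1))"
        by (cases x) auto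
      interpret simulation \<Gamma> p q "2 * k + 1" mul e "poly B \<eta>" "poly Q \<eta>" \<eta> "2 ^ (3 * \<eta>)" "env Q (unary \<eta>) (enc_mlm \<Gamma>)"
        using sim[OF \<eta> G Q(1)] .
      have unif: "pmf_of_set (carrier (grp \<Gamma> 1)) = map_pmf (\<lambda>r. ex 1 (int r)) (pmf_of_set {0..<N})"
        using map_pmf_ex[of 1 1 0] by simp
      have "pmf (bind_pmf (pmf_of_set (carrier (grp \<Gamma> 1))) (\<lambda>u. bind_pmf (pmf_of_set {0..<modulus \<Gamma>}) (\<lambda>s.
            privacy_ideal A \<eta> k (pe_pub \<Gamma> k (f \<eta>) s u)))) True =
          pmf (bind_pmf (pmf_of_set {0..<N}) (\<lambda>r. bind_pmf (pmf_of_set {0..<modulus \<Gamma>}) (\<lambda>s.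
            privacy_ideal A \<eta> k (pe_pub \<Gamma> k (f \<eta>) s (ex 1 (int r)))))) True"
        unfolding unif bind_map_pmf ..
      also have "\<dots> \<le> measure_pmf.prob (pmf_of_set {0..<N}) {r. \<not> coprime N r} + 1 / 2"
        by (intro pmf_bind_le pmf_bind_le' privacy_ideal_generator)
          (auto simp: coprime_commute)
      also have "\<dots> \<le> 4 / 2 ^ \<eta> + 1 / 2"
        using prob_not_coprime by simp
      finally show "pmf (case x of (p, q, \<Gamma>) \<Rightarrow> bind_pmf (pmf_of_set (carrier (grp \<Gamma> 1))) (\<lambda>u. bind_pmf (pmf_of_set {0..<modulus \<Gamma>}) (\<lambda>s.
            privacy_ideal A \<eta> k (pe_pub \<Gamma> k (f \<eta>) s u)))) True \<le> 4 / 2 ^ \<eta> + 1 / 2"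
        by (simp add: x)
    qed simp
    then show ?thesis
      using cov(1)[of True] cov(2)[of True] cov(1)[of False] cov(2)[of False] calculation
      unfolding success_def adv_def by simp
  qed
  have negl: "negligible (\<lambda>\<eta>. 4 / 2 ^ \<eta> + (2 * (1 - \<delta> \<eta>) + adv \<eta>))"
  proof (intro negligible_add adv)
    show "negligible (\<lambda>\<eta>. 4 / 2 ^ \<eta>)"
      using negligible_poly_mult[OF negligible_inverse_power2, of "[:4:]"] by simp
    have J': "\<bar>2 * (1 - \<delta> \<eta>)\<bar> \<le> real (poly ([:2:] * ([:1 + k:] + [:2 * k:] * calls A)) \<eta>) * (1 / 2 ^ \<eta>)" for \<eta>
    proof -
      define c where "c = real (1 + k + 2 * k * poly (calls A) \<eta>) * (1 / 2 ^ \<eta>)"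
      have "1 - c \<le> \<delta> \<eta>"
        unfolding \<delta>_def c_def by (rule bernoulli_power) auto
      then have "\<bar>2 * (1 - \<delta> \<eta>)\<bar> \<le> 2 * c"
        using \<delta>(2)[of \<eta>] by (simp add: abs_mult)
      also have "2 * c = real (poly ([:2:] * ([:1 + k:] + [:2 * k:] * calls A)) \<eta>) * (1 / 2 ^ \<eta>)"
        unfolding c_def by (simp add: algebra_simps)
      finally show ?thesis .
    qed
    show "negligible (\<lambda>\<eta>. 2 * (1 - \<delta> \<eta>))"
      by (rule negligible_mono[OF negligible_poly_mult[OF negligible_inverse_power2]
            always_eventually[OF allI[OF order_trans[OF J' abs_ge_self]]]])
  qed
  \<comment> \<open>Nothing is known about the generator for \<eta> < 2; there the trivial bound 1
    is used, which does not affect negligibility.\<close>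
  define \<nu> where "\<nu> \<eta> = (if \<eta> < 2 then 1 else 4 / 2 ^ \<eta> + (2 * (1 - \<delta> \<eta>) + adv \<eta>))" for \<eta>
  have "negligible \<nu>"
    by (rule negligible_mono[OF negl]) (auto simp: \<nu>_def eventually_at_top_linorder intro!: exI[of _ 2])
  moreover have "success (privacy_game (pe_scheme \<G> D M n) f A) \<eta> \<le> 1 / 2 + \<nu> \<eta>" for \<eta>
  proof (cases "\<eta> < 2")
    case True
    then show ?thesis
      using pmf_le_1[of "map_pmf snd (privacy_game (pe_scheme \<G> D M n) f A \<eta>)" True]
      by (simp add: \<nu>_def success_def)
  next
    case False
    then show ?thesis
      using bound[of \<eta>] by (simp add: \<nu>_def)
  qed
  ultimately show "\<exists>\<nu>. negligible \<nu> \<and> (\<forall>\<eta>. success (privacy_game (pe_scheme \<G> D M n) f A) \<eta> \<le> 1 / 2 + \<nu> \<eta>)"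
    by (intro exI[of _ \<nu>] conjI allI)
qed

section \<open>Security\<close>

text \<open>Evaluates a polynomial with known coefficients at the unknown s in the exponent: from
  the elements g^(s^j) it forms g^(\<Sum> c_j s^j).\<close>

primrec sim_comb :: "(data \<Rightarrow> data) \<Rightarrow> data \<Rightarrow> data \<Rightarrow> int list \<Rightarrow> data" where
  "sim_comb mul E P [] = sim_pow mul 1 E (env_gen 1 E) 0"
| "sim_comb mul E P (c # cs) = sim_mult mul 1 E (sim_pow mul 1 E (left P) c) (sim_comb mul E (right P) cs)"

lemma polytime_sim_comb:
  assumes "polytime mul" "polytime E" "\<And>j. j \<in> set js \<Longrightarrow> polytime (\<lambda>x. Atom (c j x))"
  shows "polytime P \<Longrightarrow> polytime (\<lambda>x. sim_comb mul (E x) (P x) (map (\<lambda>j. c j x) js))"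
  using assms(3)
proof (induction js arbitrary: P)
  case Nil
  show ?case
    unfolding list.map sim_comb.simps
    by (intro polytime_sim_pow polytime_env_access polytime_const assms(1,2))
next
  case (Cons j js)
  show ?case
    unfolding list.map sim_comb.simps
    by (intro polytime_sim_mult polytime_sim_pow polytime_left Cons.IH polytime_right assms(1,2)
        Cons.prems list.set_intros)
qed

lemma polytime_lst_map:
  assumes "\<And>j. j \<in> set js \<Longrightarrow> polytime (\<lambda>x. F j x)"
  shows "polytime (\<lambda>x. lst (map (\<lambda>j. F j x) js))"
  using assms by (induction js) (auto simp: lst_Nil lst_Cons intro: polytime_const polytime_Node)

definition dcoeff :: "nat \<Rightarrow> data \<Rightarrow> int" where
  "dcoeff i L = int_of (left ((right ^^ i) L))"

text \<open>The coefficients of \<open>f(X + a)\<close>.\<close>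

definition taylor :: "nat \<Rightarrow> nat \<Rightarrow> data \<Rightarrow> int \<Rightarrow> int" where
  "taylor n m L a = (\<Sum>i\<in>{m..n}. dcoeff i L * (int (i choose m) * a ^ (i - m)))"

lemma polytime_taylor:
  assumes "polytime L" "polytime (\<lambda>x. Atom (a x))"
  shows "polytime (\<lambda>x. Atom (taylor n m (L x) (a x)))"
  unfolding taylor_def dcoeff_def
  by (intro polytime_sum finite_atLeastAtMost polytime_times polytime_power polytime_int_of polytime_left
      polytime_right_pow polytime_const assms)

definition mult_mod :: "data \<Rightarrow> data" where
  "mult_mod z = Atom ((int_of (left (right z)) * int_of (right (right z))) mod int_of (left z))"

text \<open>With the exponent 2q - 4, \<open>fast_pow\<close> yields z^(2q - 3), an inverse of z
  since z^(2(q - 1)) = 1 modulo q. The usual z^(q - 2) would need the exponent q - 3, which is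
  negative for q = 2.\<close>

definition sim_inverse :: "data \<Rightarrow> int \<Rightarrow> int \<Rightarrow> int" where
  "sim_inverse E q z = int_of (fast_pow mult_mod (len (env_bound E)) (Atom q) (Atom z) (2 * q - 4))"

lemma polytime_sim_inverse:
  assumes "polytime E" "polytime (\<lambda>x. Atom (q x))" "polytime (\<lambda>x. Atom (z x))"
  shows "polytime (\<lambda>x. Atom (sim_inverse (E x) (q x) (z x)))"
proof -
  have "polytime mult_mod"
    unfolding mult_mod_def[abs_def] by (intro polytime_intros)
  then show ?thesis
    unfolding sim_inverse_def
    by (intro polytime_int_of polytime_fast_pow polytime_env_access polytime_minus polytime_times
        polytime_const assms)
qed

text \<open>Decryption as a linear search: the state holds the last hit and the rest of the listing
  of M.\<close>

definition decrypt_step :: "(data \<Rightarrow> data) \<Rightarrow> nat \<Rightarrow> data \<Rightarrow> data" where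
  "decrypt_step mul k z = (let rest = right (right z) in
     if sim_pow mul k (left (left z)) (left (right (left z))) (int_of (left rest)) = right (right (left z))
     then Node (left rest) (right rest) else Node (left (right z)) (right rest))"

definition sim_decrypt :: "(data \<Rightarrow> data) \<Rightarrow> nat \<Rightarrow> data \<Rightarrow> data \<Rightarrow> data \<Rightarrow> data \<Rightarrow> int" where
  "sim_decrypt mul k E g r ys = int_of (left (cloop (decrypt_step mul k) (len (env_bound E))
     (Node E (Node g r)) (len ys) (Node (Atom 0) ys)))"

lemma polytime_sim_decrypt:
  assumes "polytime mul" "polytime E" "polytime G" "polytime H" "polytime Y"
  shows "polytime (\<lambda>x. Atom (sim_decrypt mul k (E x) (G x) (H x) (Y x)))"
proof -
  have "polytime (decrypt_step mul k)"
    unfolding decrypt_step_def[abs_def]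
    by (intro polytime_Let; intro polytime_sim_pow assms(1) polytime_intros)
  then show ?thesis
    unfolding sim_decrypt_def
    by (intro polytime_int_of polytime_left polytime_cloop polytime_env_access polytime_Node polytime_const assms)
qed

definition sim_query ::
    "alg \<Rightarrow> (data \<Rightarrow> data) \<Rightarrow> nat \<Rightarrow> nat poly \<Rightarrow> data \<Rightarrow> data \<Rightarrow> data \<Rightarrow> data \<Rightarrow> int \<Rightarrow> int \<Rightarrow> data" where
  "sim_query A mul k l un E h pk \<omega> t = sim_history mul k (\<lambda>z. question (next_message A z))
     (len (unary_poly l un)) E h (Node un (Node (Atom \<omega>) (lst [pk]))) t"

definition sim_choice :: "alg \<Rightarrow> data \<Rightarrow> data \<Rightarrow> data \<Rightarrow> int \<Rightarrow> data \<Rightarrow> int" where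
  "sim_choice A un E pk \<omega> tr = int_of (next_message A (Node (Node un (Node (Atom \<omega>) (lst [pk]))) tr)) mod env_mod E"

lemma polytime_sim_query:
  assumes "ppt A" "polytime mul" "polytime U" "polytime E" "polytime H" "polytime K"
    "polytime (\<lambda>x. Atom (\<omega> x))" "polytime (\<lambda>x. Atom (t x))"
  shows "polytime (\<lambda>x. sim_query A mul k l (U x) (E x) (H x) (K x) (\<omega> x) (t x))"
  unfolding sim_query_def question_def
  by (intro polytime_sim_history polytime_Node polytime_lst_Cons polytime_lst_Nil polytime_const
      polytime_next_message polytime_id polytime_unary_poly assms)

lemma polytime_sim_choice:
  assumes "ppt A" "polytime U" "polytime E" "polytime K" "polytime (\<lambda>x. Atom (\<omega> x))" "polytime H"
  shows "polytime (\<lambda>x. Atom (sim_choice A (U x) (E x) (K x) (\<omega> x) (H x)))"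
  unfolding sim_choice_def
  by (intro polytime_mod polytime_int_of polytime_Node polytime_lst_Cons polytime_lst_Nil polytime_const
      polytime_next_message polytime_env_access assms)

text \<open>The first run, under keys the reduction makes itself. Knowing q, it obtains h = u^q as
  g^(v q) for random v. The digits of \<open>w\<close> are s, v, the coins and the
  transcript.\<close>

definition sim_guess ::
    "alg \<Rightarrow> (data \<Rightarrow> data) \<Rightarrow> nat \<Rightarrow> (data \<Rightarrow> data) \<Rightarrow> nat poly \<Rightarrow> data \<Rightarrow> data \<Rightarrow> int \<Rightarrow> int \<Rightarrow> int" where
  "sim_guess A mul k F l un E q w =
    (let s = (w mod env_range E) mod env_mod E; w1 = w div env_range E;
         h = sim_pow mul 1 E (env_gen 1 E) (((w1 mod env_range E) mod env_mod E) * q);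
         w2 = w1 div env_range E; c0 = 2 ^ len (unary_poly (coins A) un);
         pk = lst [left E, env_gen 1 E, h, sim_powers mul k E s, F un]
     in sim_choice A un E pk (w2 mod c0) (sim_query A mul k l un E h pk (w2 mod c0) (w2 div c0)))"

lemma polytime_Let_int':
  assumes "polytime (\<lambda>x. Atom (f x))" "polytime (\<lambda>z. Atom (g (left z) (int_of (right z))))"
  shows "polytime (\<lambda>x. Atom (let y = f x in g x y))"
  using polytime_Let_int[of f "\<lambda>x y. Atom (g x y)"] assms by (simp add: Let_def)

lemma polytime_Let':
  assumes "polytime F" "polytime (\<lambda>z. Atom (g (left z) (right z)))"
  shows "polytime (\<lambda>x. Atom (let y = F x in g x y))"
  using polytime_Let[of F "\<lambda>x y. Atom (g x y)"] assms by (simp add: Let_def)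

lemma polytime_sim_guess:
  assumes "ppt A" "polytime mul" "polytime F" and
    args: "polytime U" "polytime E" "polytime (\<lambda>x. Atom (q x))" "polytime (\<lambda>x. Atom (w x))"
  shows "polytime (\<lambda>x. Atom (sim_guess A mul k F l (U x) (E x) (q x) (w x)))"
  unfolding sim_guess_def
  by (intro polytime_Let' polytime_Let_int';
      intro polytime_sim_choice polytime_sim_query polytime_sim_pow polytime_sim_powers
        polytime_env_access polytime_pow2 polytime_unary_poly assms(1,2) args polytime_comp[OF args(1)]
        polytime_comp[OF args(2)] polytime_comp[OF args(3)] polytime_comp[OF args(4)]
        polytime_comp[OF assms(3)] polytime_intros)

text \<open>The binomial theorem in the exponent: the public powers belonging to the secret s + a
  are products of known powers of the challenge elements g^(s^j).\<close>

definition shifted_powers :: "(data \<Rightarrow> data) \<Rightarrow> nat \<Rightarrow> data \<Rightarrow> data \<Rightarrow> int \<Rightarrow> data" where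
  "shifted_powers mul k E P a = lst (map (\<lambda>i. sim_comb mul E P
     (map (\<lambda>j. int (2 ^ i choose j) * a ^ (2 ^ i - j)) [0..<Suc (2 ^ i)])) [0..<k])"

lemma polytime_shifted_powers:
  assumes "polytime mul" "polytime E" "polytime P" "polytime (\<lambda>x. Atom (a x))"
  shows "polytime (\<lambda>x. shifted_powers mul k (E x) (P x) (a x))"
  unfolding shifted_powers_def
  by (intro polytime_lst_map polytime_sim_comb polytime_times polytime_power polytime_const assms)

text \<open>Let s be the secret of the challenge, so that the key has s + a. Acceptance of y means
  f(s + a) - y = s w, and Taylor expansion at a gives f(s + a) - f(a) = s c, both modulo q. Hence w
  - c = (f(a) - y)/s, and the power with p/(f(a) - y) leaves p/s. Here \<open>c\<close> is assembled
  in G_1 and then lifted to the top level.\<close>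

definition sim_root ::
    "(data \<Rightarrow> data) \<Rightarrow> (data \<Rightarrow> data) \<Rightarrow> nat \<Rightarrow> nat \<Rightarrow> data \<Rightarrow> data \<Rightarrow> data \<Rightarrow> data \<Rightarrow> int \<Rightarrow> int \<Rightarrow> int \<Rightarrow> data \<Rightarrow> data" where
  "sim_root mul e k n L Y E P p q a d =
    (let y = sim_decrypt mul k E (sim_pow mul k E (env_gen k E) p) (sim_pow mul k E (left d) p) Y;
         z = (taylor n 0 L a - y) mod q;
         c = sim_comb mul E P (map (\<lambda>m. taylor n (Suc m) L a) [0..<n])
     in sim_pow mul (2 * k + 1) E
          (sim_mult mul (2 * k + 1) E (sim_pair e (2 * k) 1 E (right d) (env_gen 1 E))
            (sim_pow mul (2 * k + 1) E (sim_pair e 1 (2 * k) E c (env_gen (2 * k) E)) (- 1)))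
          (p * sim_inverse E q z))"

lemma polytime_sim_root:
  assumes "polytime mul" "polytime e" "polytime L" "polytime Y" "polytime E" "polytime P"
    "polytime (\<lambda>x. Atom (p x))" "polytime (\<lambda>x. Atom (q x))" "polytime (\<lambda>x. Atom (a x))" "polytime H"
  shows "polytime (\<lambda>x. sim_root mul e k n (L x) (Y x) (E x) (P x) (p x) (q x) (a x) (H x))"
  unfolding sim_root_def Let_def
  by (intro polytime_sim_pow polytime_sim_mult polytime_sim_pair polytime_sim_comb polytime_sim_inverse
      polytime_taylor polytime_sim_decrypt polytime_env_access polytime_mod polytime_minus polytime_times
      polytime_left polytime_right assms polytime_const)

text \<open>The second run, on the challenge shifted by the guess. The challenge encoding is made
  for the input actually chosen, so that the simulation is faithful also when the guess
  fails.\<close>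

definition sim_attack ::
    "alg \<Rightarrow> (data \<Rightarrow> data) \<Rightarrow> (data \<Rightarrow> data) \<Rightarrow> nat \<Rightarrow> nat \<Rightarrow> (data \<Rightarrow> data) \<Rightarrow> (data \<Rightarrow> data) \<Rightarrow> nat poly \<Rightarrow>
     data \<Rightarrow> data \<Rightarrow> int \<Rightarrow> int \<Rightarrow> data \<Rightarrow> int \<Rightarrow> int \<Rightarrow> data" where
  "sim_attack A mul e k n F Y l un E p q P a w =
    (let h = sim_pow mul 1 E (env_gen 1 E) (((w mod env_range E) mod env_mod E) * q);
         w1 = w div env_range E; c0 = 2 ^ len (unary_poly (coins A) un);
         \<omega> = w1 mod c0; w2 = w1 div c0; T = 2 ^ len (unary_poly ([:0, 3 * k:] * l) un);
         pk = lst [left E, env_gen 1 E, h, shifted_powers mul k E P a, F un];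
         tr = sim_query A mul k l un E h pk \<omega> (w2 mod T);
         \<sigma> = sim_encode mul k E h (sim_choice A un E pk \<omega> tr) (w2 div T);
         d = next_message A (Node (Node un (Node (Atom \<omega>) (lst [pk, tr]))) \<sigma>)
     in sim_root mul e k n (F un) (Y (Atom q)) E P p q a d)"

lemma polytime_sim_attack:
  assumes "ppt A" "polytime mul" "polytime e" "polytime F" "polytime Y" and
    args: "polytime U" "polytime E" "polytime (\<lambda>x. Atom (p x))" "polytime (\<lambda>x. Atom (q x))" "polytime P"
    "polytime (\<lambda>x. Atom (a x))" "polytime (\<lambda>x. Atom (w x))"
  shows "polytime (\<lambda>x. sim_attack A mul e k n F Y l (U x) (E x) (p x) (q x) (P x) (a x) (w x))"
  unfolding sim_attack_def
  by (intro polytime_Let polytime_Let_int;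
      intro polytime_sim_root polytime_sim_choice polytime_sim_query polytime_sim_pow polytime_sim_encode
        polytime_shifted_powers polytime_next_message
        polytime_env_access polytime_pow2 polytime_unary_poly assms(1-3) args polytime_comp[OF args(1)]
        polytime_comp[OF args(2)] polytime_comp[OF args(3)] polytime_comp[OF args(4)]
        polytime_comp[OF args(5)] polytime_comp[OF args(6)] polytime_comp[OF args(7)]
        polytime_comp[OF assms(4)] polytime_comp[OF assms(5)] polytime_intros)

text \<open>The low part of the tape feeds the first run and the high part the second, which makes
  the runs independent. \<open>X\<close> is the number of tapes of the first run.\<close>

definition security_sim ::
    "alg \<Rightarrow> (data \<Rightarrow> data) \<Rightarrow> (data \<Rightarrow> data) \<Rightarrow> nat \<Rightarrow> nat \<Rightarrow> (data \<Rightarrow> data) \<Rightarrow> (data \<Rightarrow> data) \<Rightarrow> nat poly \<Rightarrow>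
     nat poly \<Rightarrow> data \<Rightarrow> data" where
  "security_sim A mul e k n F Y l Q z =
    (let un = left z; \<Omega> = int_of (left (right z)); inp = left (right (right z));
         p = int_of (left inp); q = int_of (left (right inp)); E = env Q un (left (right (right inp)));
         P = left (right (right (right inp)));
         X = env_range E * (env_range E * (2 ^ len (unary_poly (coins A) un) *
           2 ^ len (unary_poly ([:0, 3 * k:] * l) un)))
     in sim_attack A mul e k n F Y l un E p q P (sim_guess A mul k F l un E q (\<Omega> mod X)) (\<Omega> div X))"

lemma polytime_security_sim:
  assumes "ppt A" "polytime mul" "polytime e" "polytime F" "polytime Y"
  shows "polytime (security_sim A mul e k n F Y l Q)"
  unfolding security_sim_def[abs_def]
  by (intro polytime_Let polytime_Let_int;
      intro polytime_sim_attack polytime_sim_guess polytime_env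
        polytime_env_access polytime_pow2 polytime_unary_poly assms polytime_intros)

section \<open>Correctness of the root extraction\<close>

lemma right_funpow_lst: "(right ^^ i) (lst xs) = lst (drop i xs)"
proof (induction i)
  case (Suc i)
  then show ?case
    by (cases "drop i xs") (auto simp: lst_Cons lst_Nil drop_Suc simp flip: tl_drop)
qed simp

lemma dcoeff_coeffs: "dcoeff i (lst (map Atom (coeffs f))) = Polynomial.coeff f i"
proof (cases "i < length (coeffs f)")
  case True
  then have "drop i (map Atom (coeffs f)) = Atom (coeffs f ! i) # drop (Suc i) (map Atom (coeffs f))"
    by (subst Cons_nth_drop_Suc[symmetric]) auto
  then show ?thesis
    using True by (simp add: dcoeff_def right_funpow_lst lst_Cons nth_default_def flip: nth_default_coeffs_eq)
next
  case False
  then show ?thesis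
    by (simp add: dcoeff_def right_funpow_lst lst_Nil nth_default_def flip: nth_default_coeffs_eq)
qed

text \<open>Binomial expansion of each monomial, followed by an exchange of the two sums.\<close>

lemma poly_shift_taylor:
  assumes "degree f \<le> n"
  shows "poly f (s + a) = (\<Sum>m\<le>n. taylor n m (lst (map Atom (coeffs f))) a * s ^ m)"
proof -
  have "poly f (s + a) = (\<Sum>i\<le>n. Polynomial.coeff f i * (s + a) ^ i)"
    unfolding poly_altdef using assms by (intro sum.mono_neutral_left) (auto intro: coeff_eq_0)
  also have "\<dots> = (\<Sum>i\<le>n. \<Sum>m\<le>i. Polynomial.coeff f i * (int (i choose m) * a ^ (i - m)) * s ^ m)"
    by (simp add: binomial_ring sum_distrib_left mult_ac)
  also have "\<dots> = (\<Sum>i\<le>n. \<Sum>m\<in>{m \<in> {..n}. m \<le> i}. Polynomial.coeff f i * (int (i choose m) * a ^ (i - m)) * s ^ m)"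
    by (intro sum.cong) auto
  also have "\<dots> = (\<Sum>m\<le>n. \<Sum>i\<in>{i \<in> {..n}. m \<le> i}. Polynomial.coeff f i * (int (i choose m) * a ^ (i - m)) * s ^ m)"
    by (rule sum.swap_restrict) auto
  also have "\<dots> = (\<Sum>m\<le>n. \<Sum>i\<in>{m..n}. Polynomial.coeff f i * (int (i choose m) * a ^ (i - m)) * s ^ m)"
    by (intro sum.cong) auto
  finally show ?thesis
    by (simp add: taylor_def dcoeff_coeffs sum_distrib_right)
qed

lemma taylor_0:
  assumes "degree f \<le> n"
  shows "taylor n 0 (lst (map Atom (coeffs f))) a = poly f a"
proof -
  have "poly f a = (\<Sum>m\<le>n. taylor n m (lst (map Atom (coeffs f))) a * 0 ^ m)"
    using poly_shift_taylor[OF assms, of 0 a] by simp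
  also have "\<dots> = (\<Sum>m\<in>{0}. taylor n m (lst (map Atom (coeffs f))) a * 0 ^ m)"
    by (rule sum.mono_neutral_right) (auto simp: power_0_left)
  finally show ?thesis by simp
qed

context simulation
begin

lemma sim_comb_list:
  "length cs \<le> length as \<Longrightarrow>
   sim_comb mul E (lst (map (ex 1) as)) cs = ex 1 (sum_list (map2 (*) cs as))"
proof (induction cs arbitrary: as)
  case Nil
  then show ?case
    using \<kappa> by (simp add: env_gen_E sim_pow_ex)
next
  case (Cons c cs)
  then obtain a as' where "as = a # as'" by (cases as) auto
  then show ?case
    using Cons \<kappa> by (simp add: lst_Cons sim_pow_ex sim_mult_ex mult.commute)
qed

lemma sim_comb_eq:
  assumes "L \<le> m"
  shows "sim_comb mul E (lst (map (\<lambda>i. ex 1 (g i)) [0..<m])) (map c [0..<L]) = ex 1 (\<Sum>j<L. c j * g j)"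
proof -
  have "sum_list (map2 (*) (map c [0..<L]) (map g [0..<m])) = (\<Sum>j<L. c j * g j)"
    using assms by (simp add: sum_list_sum_nth atLeast0LessThan)
  then show ?thesis
    using sim_comb_list[of "map c [0..<L]" "map g [0..<m]"] assms by (simp add: comp_def)
qed

lemma shifted_powers_eq:
  assumes "\<And>i. i < k \<Longrightarrow> 2 ^ i \<le> n"
  shows "shifted_powers mul k E (lst (map (\<lambda>i. ex 1 (s ^ i)) [0..<Suc n])) a =
    lst (map (\<lambda>i. ex 1 ((s + a) ^ 2 ^ i)) [0..<k])"
proof -
  have "sim_comb mul E (lst (map (\<lambda>i. ex 1 (s ^ i)) [0..<Suc n]))
      (map (\<lambda>j. int (2 ^ i choose j) * a ^ (2 ^ i - j)) [0..<Suc (2 ^ i)]) = ex 1 ((s + a) ^ 2 ^ i)" if "i < k" for i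
  proof -
    have "(s + a) ^ 2 ^ i = (\<Sum>j<Suc (2 ^ i). int (2 ^ i choose j) * a ^ (2 ^ i - j) * s ^ j)"
      unfolding binomial_ring lessThan_Suc_atMost by (intro sum.cong) auto
    then show ?thesis
      using assms[OF that] by (subst sim_comb_eq) auto
  qed
  then show ?thesis
    unfolding shifted_powers_def by (intro arg_cong[of _ _ lst] map_cong) auto
qed

lemma int_q_less: "int q < 2 ^ \<eta>"
  using q_less by (metis of_nat_less_iff of_nat_numeral of_nat_power)

lemma sim_inverse_eq:
  assumes z: "0 < z" "z < int q" and b: "6 + 3 * \<eta> \<le> b"
  shows "[z * sim_inverse E (int q) z = 1] (mod int q)"
proof -
  define val where "val i = Atom (z ^ i mod int q)" for i
  have q2: "2 \<le> q" using primes by (simp add: prime_ge_2_nat)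
  have c: "int (2 * q - 4) = 2 * int q - 4"
    using q2 by simp
  have "fast_pow mult_mod b (Atom (int q)) (val 1) (int (2 * q - 4)) = val (Suc (2 * q - 4))"
  proof (rule fast_pow_eq)
    show "mult_mod (Node (Atom (int q)) (Node (val i) (val j))) = val (i + j)" for i j
      by (simp add: mult_mod_def val_def mod_mult_eq power_add)
    show "bits (val i) \<le> 1 + \<eta>" for i
      unfolding val_def
    proof (rule bits_Atom_le)
      have "0 \<le> z ^ i mod int q" "z ^ i mod int q < int q" using z by auto
      then show "\<bar>z ^ i mod int q\<bar> < 2 ^ \<eta>" using int_q_less by linarith
    qed
    show "2 * q - 4 < 2 ^ (\<eta> + 1)" using q_less by simp
    show "\<eta> + 1 \<le> b" "3 + 2 * (1 + \<eta>) + (\<eta> + 1) \<le> b" using b by auto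
  qed
  moreover have "Suc (2 * q - 4) = 2 * q - 3" "val 1 = Atom z"
    using q2 z by (simp_all add: val_def)
  ultimately have eq: "sim_inverse E (int q) z = z ^ (2 * q - 3) mod int q"
    unfolding sim_inverse_def E c[symmetric] by (simp only: val_def int_of.simps)
  have "\<not> q dvd nat z"
    using z by (auto dest: dvd_imp_le)
  then have "[nat z ^ (q - 1) = 1] (mod q)"
    using primes(2) by (rule fermat_theorem[rotated])
  then have "[int (nat z ^ (q - 1)) = int 1] (mod int q)"
    by (simp only: cong_int_iff)
  then have "[z ^ (q - 1) = 1] (mod int q)"
    using z by simp
  then have "[z ^ (q - 1) * z ^ (q - 1) = 1 * 1] (mod int q)"
    by (rule cong_mult) fact
  moreover have "z ^ (q - 1) * z ^ (q - 1) = z * z ^ (2 * q - 3)"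
  proof -
    have "(q - 1) + (q - 1) = Suc (2 * q - 3)" using q2 by simp
    then show ?thesis by (metis power_Suc power_add)
  qed
  ultimately show ?thesis
    unfolding eq by (simp add: unique_euclidean_semiring_class.cong_def mod_mult_right_eq)
qed

text \<open>Since exactly one value fits, order and repetitions in the listing do not matter. The
  induction is over the part still to be searched, with an arbitrary previous hit.\<close>

lemma sim_decrypt_eq:
  assumes k: "1 \<le> k" "k \<le> \<kappa>" and y: "y \<in> set ys"
    and fits: "\<And>y'. y' \<in> set ys \<Longrightarrow> ex k (c * y') = ex k r \<longleftrightarrow> y' = y"
    and b: "2 + 2 * bits (lst (map Atom ys)) \<le> b"
  shows "sim_decrypt mul k E (ex k c) (ex k r) (lst (map Atom ys)) = y"
proof -
  have "left (cloop (decrypt_step mul k) b (Node E (Node (ex k c) (ex k r))) (length zs) (Node (Atom v) (lst (map Atom zs)))) =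
      (if y \<in> set zs then Atom y else Atom v)"
    if "set zs \<subseteq> set ys" "bits (lst (map Atom zs)) \<le> bits (lst (map Atom ys))"
      "bits (Atom v) \<le> bits (lst (map Atom ys))" for zs v
    using that
  proof (induction zs arbitrary: v)
    case (Cons z zs)
    let ?v = "if z = y then z else v"
    have step: "decrypt_step mul k (Node (Node E (Node (ex k c) (ex k r))) (Node (Atom v) (lst (Atom z # map Atom zs)))) =
        Node (Atom ?v) (lst (map Atom zs))"
      using Cons.prems fits[of z] k by (auto simp: decrypt_step_def Let_def lst_Cons sim_pow_ex)
    have "bits (Atom ?v) \<le> bits (lst (map Atom ys))" "bits (lst (map Atom zs)) \<le> bits (lst (map Atom ys))"
      using Cons.prems by (auto simp: lst_Cons)
    moreover from this have "bits (Node (Atom ?v) (lst (map Atom zs))) \<le> b"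
      using b unfolding bits.simps(2) by linarith
    ultimately show ?case
      using Cons.IH[of ?v] Cons.prems(1) unfolding list.size add_Suc_right add_0_right
      by (subst cloop_Suc) (auto simp: step)
  qed auto
  from this[of ys 0] show ?thesis
    using y bits_ge_1[of "lst (map Atom ys)"] by (simp add: sim_decrypt_def E floorlog_def)
qed

text \<open>The algebra of a forgery, for a run in which the input under attack is the guess a
  itself. Then s - a is the challenge secret s' modulo N.\<close>

lemma sim_root_eq:
  fixes f s' a n k
  defines "s \<equiv> nat ((s' + a) mod int N)"
  assumes k: "1 \<le> k" "\<kappa> = 2 * k + 1" and f: "degree f \<le> n"
    and Y: "set ys = M q" "2 + 2 * bits (lst (map Atom ys)) \<le> b" and M: "M q \<subseteq> {0..<int q}"
    and b: "6 + 3 * \<eta> \<le> b" and s': "coprime (int N) s'"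
    and win: "pe_verdict M k (pe_pub \<Gamma> k f s h) (pe_sec \<Gamma> p q f s) a (left d, right d) \<notin> {Some (poly f a mod int q), None}"
  shows "sim_root mul e k n (lst (map Atom (coeffs f))) (lst (map Atom ys)) E (lst (map (\<lambda>i. ex 1 (s' ^ i)) [0..<Suc n]))
      (int p) (int q) a d = ex \<kappa> (int p * modular_inverse (int N) s')"
proof -
  let ?L = "lst (map Atom (coeffs f))"
  have "left d \<in> carrier (grp \<Gamma> k)" "right d \<in> carrier (grp \<Gamma> (2 * k))"
    using pe_verdict_imp_carrier[of M k f s h "pe_sec \<Gamma> p q f s" a "left d" "right d"] win by auto
  then obtain r w where d: "left d = ex k r" "right d = ex (2 * k) w"
    using carrier_ex[of k] carrier_ex[of "2 * k"] k by auto
  obtain y where y: "pe_verdict M k (pe_pub \<Gamma> k f s h) (pe_sec \<Gamma> p q f s) a (left d, right d) = Some y"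
    and neq: "y \<noteq> poly f a mod int q"
    using win by auto
  have yM: "y \<in> M q" and ry: "[r = y] (mod int q)"
    and eq: "[poly f (int s) - y = (int s - a) * w] (mod int q)"
    using y unfolding d pe_verdict_eq_Some_iff[where M = M, OF k M] by blast+
  have y_range: "0 \<le> y" "y < int q" using yM M by auto
  have q0: "0 < int q" using primes(2) by (simp add: prime_gt_0_nat)
  have dec: "sim_decrypt mul k E (sim_pow mul k E (env_gen k E) (int p)) (sim_pow mul k E (left d) (int p)) (lst (map Atom ys)) = y"
  proof -
    have "ex k (int p * y') = ex k (r * int p) \<longleftrightarrow> y' = y" if "y' \<in> set ys" for y'
    proof -
      have "ex k (int p * y') = ex k (r * int p) \<longleftrightarrow> [y' = r] (mod int q)"
        using k cong_p_mult[of y' r] by (simp add: ex_eq_iff mult.commute)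
      also have "\<dots> \<longleftrightarrow> [y' = y] (mod int q)"
        using ry by (simp add: unique_euclidean_semiring_class.cong_def)
      also have "\<dots> \<longleftrightarrow> y' = y"
      proof -
        have "y' \<in> {0..<int q}" using that Y(1) M by blast
        then show ?thesis using y_range by (simp add: unique_euclidean_semiring_class.cong_def)
      qed
      finally show ?thesis .
    qed
    then have "sim_decrypt mul k E (ex k (int p)) (ex k (r * int p)) (lst (map Atom ys)) = y"
      using k yM Y by (intro sim_decrypt_eq) auto
    then show ?thesis
      using k by (simp add: env_gen_E d sim_pow_ex)
  qed
  define z where "z = (poly f a - y) mod int q"
  \<comment> \<open>The accepted y is a least residue different from f(a) modulo q. So the
    difference is not 0 modulo the prime q and can be inverted.\<close>
  have z: "0 < z" "z < int q"
  proof -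
    have "z \<noteq> 0"
    proof
      assume "z = 0"
      then have "[poly f a = y] (mod int q)"
        by (simp add: z_def cong_iff_dvd_diff mod_eq_0_iff_dvd)
      then show False using neq y_range by (simp add: unique_euclidean_semiring_class.cong_def)
    qed
    moreover have "0 \<le> z"
      unfolding z_def using q0 by (rule pos_mod_sign)
    ultimately show "0 < z" by linarith
    show "z < int q"
      unfolding z_def using q0 by (rule pos_mod_bound)
  qed
  \<comment> \<open>The Taylor coefficients above the constant one give the quotient of f(s' + a) -
    f(a) by s' as a polynomial in s'.\<close>
  define c where "c = (\<Sum>j<n. taylor n (Suc j) ?L a * s' ^ j)"
  have c: "poly f (s' + a) - poly f a = s' * c"
  proof -
    have "poly f (s' + a) = (\<Sum>m<Suc n. taylor n m ?L a * s' ^ m)"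
      unfolding poly_shift_taylor[OF f] lessThan_Suc_atMost ..
    also have "\<dots> = taylor n 0 ?L a + (\<Sum>m<n. taylor n (Suc m) ?L a * s' ^ Suc m)"
      by (subst sum.lessThan_Suc_shift) simp
    finally show ?thesis
      by (simp add: taylor_0[OF f] c_def sum_distrib_left mult_ac)
  qed
  define v where "v = sim_inverse E (int q) z"
  have v: "[z * v = 1] (mod int q)"
    unfolding v_def using sim_inverse_eq[OF z b] .
  have s: "[int s = s' + a] (mod int q)"
    unfolding s_def using N_pos by (intro mod_N_imp_mod_q) simp
  have "[poly f a - y = s' * (w - c)] (mod int q)"
  proof -
    have "[poly f (s' + a) - y = ((s' + a) - a) * w] (mod int q)"
    proof -
      have "[poly f (s' + a) - y = poly f (int s) - y] (mod int q)"
        unfolding poly_altdef using cong_sym[OF s] by (intro cong_diff cong_sum cong_mult cong_pow cong_refl)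
      also have "[poly f (int s) - y = (int s - a) * w] (mod int q)" by (rule eq)
      also have "[(int s - a) * w = ((s' + a) - a) * w] (mod int q)"
        using s by (intro cong_mult cong_diff cong_refl)
      finally show ?thesis .
    qed
    then have "[poly f (s' + a) - y - s' * c = s' * w - s' * c] (mod int q)"
      by (intro cong_diff) auto
    moreover have "poly f (s' + a) - y - s' * c = poly f a - y"
      using c by simp
    ultimately show ?thesis by (simp add: right_diff_distrib)
  qed
  then have "[z = s' * (w - c)] (mod int q)"
    by (simp add: z_def unique_euclidean_semiring_class.cong_def)
  then have "[z * v = s' * (w - c) * v] (mod int q)"
    by (rule cong_mult[OF _ cong_refl])
  from cong_trans[OF cong_sym[OF this] v] have "[s' * ((w - c) * v) = 1] (mod int q)"
    by (simp only: mult.assoc)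
  \<comment> \<open>The factor p lifts the congruence from q to N; only afterwards is the inverse of
    s' modulo N applied.\<close>
  then have "[int p * (s' * ((w - c) * v)) = int p * 1] (mod int N)"
    by (simp only: cong_p_mult)
  then have inv1: "[modular_inverse (int N) s' * (int p * (s' * ((w - c) * v))) = modular_inverse (int N) s' * (int p * 1)] (mod int N)"
    by (rule cong_mult[OF cong_refl])
  have inv2: "[modular_inverse (int N) s' * (int p * (s' * ((w - c) * v))) = 1 * (int p * ((w - c) * v))] (mod int N)"
  proof -
    have "[(modular_inverse (int N) s' * s') * (int p * ((w - c) * v)) = 1 * (int p * ((w - c) * v))] (mod int N)"
      by (rule cong_mult[OF cong_modular_inverse2[OF s'[unfolded coprime_commute[of "int N"]]] cong_refl])
    then show ?thesis by (simp add: mult_ac)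
  qed
  have "[1 * (int p * ((w - c) * v)) = modular_inverse (int N) s' * (int p * 1)] (mod int N)"
    by (rule cong_trans[OF cong_sym[OF inv2] inv1])
  moreover have "1 * (int p * ((w - c) * v)) = (w - c) * (int p * v)"
    "modular_inverse (int N) s' * (int p * 1) = int p * modular_inverse (int N) s'"
    by (simp_all add: mult_ac)
  ultimately have "[(w - c) * (int p * v) = int p * modular_inverse (int N) s'] (mod int N)"
    by (simp only:)
  then have final: "ex \<kappa> ((w - c) * (int p * v)) = ex \<kappa> (int p * modular_inverse (int N) s')"
    using \<kappa> by (intro ex_cong) auto
  have comb: "sim_comb mul E (lst (map (\<lambda>i. ex 1 (s' ^ i)) [0..<Suc n])) (map (\<lambda>m. taylor n (Suc m) ?L a) [0..<n]) = ex 1 c"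
    unfolding c_def by (rule sim_comb_eq) simp
  have pairs: "sim_pair e (2 * k) 1 E (ex (2 * k) w) (ex 1 1) = ex \<kappa> w"
    "sim_pair e 1 (2 * k) E (ex 1 c) (ex (2 * k) 1) = ex \<kappa> c"
    using k sim_pair_ex[of "2 * k" 1 w 1] sim_pair_ex[of 1 "2 * k" c 1] by simp_all
  show ?thesis
    unfolding sim_root_def Let_def dec taylor_0[OF f] comb d(2) z_def[symmetric] v_def[symmetric] final[symmetric]
    using k pairs by (simp add: env_gen_E sim_pow_ex sim_mult_ex)
qed

end

section \<open>Probability bounds for two runs\<close>

lemma uniform_split4:
  assumes "0 < a1" "0 < a2" "0 < a3" "0 < a4"
  shows "bind_pmf (uniform (a1 * (a2 * (a3 * a4))))
      (\<lambda>w. F (w mod a1) (w div a1 mod a2) (w div a1 div a2 mod a3) (w div a1 div a2 div a3)) =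
    bind_pmf (uniform a1) (\<lambda>x1. bind_pmf (uniform a2) (\<lambda>x2. bind_pmf (uniform a3) (\<lambda>x3.
      bind_pmf (uniform a4) (F x1 x2 x3))))"
proof -
  have s2: "bind_pmf (uniform (a3 * a4)) (\<lambda>w. G (w mod a3) (w div a3)) =
      bind_pmf (uniform a3) (\<lambda>x. bind_pmf (uniform a4) (G x))" for G :: "int \<Rightarrow> int \<Rightarrow> 'a pmf"
    using assms by (intro uniform_split) auto
  have s3: "bind_pmf (uniform (a2 * (a3 * a4))) (\<lambda>w. G (w mod a2) (w div a2 mod a3) (w div a2 div a3)) =
      bind_pmf (uniform a2) (\<lambda>x. bind_pmf (uniform a3) (\<lambda>y. bind_pmf (uniform a4) (G x y)))"
    for G :: "int \<Rightarrow> int \<Rightarrow> int \<Rightarrow> 'a pmf"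
    using assms s2 by (subst uniform_split[where F = "\<lambda>x w. G x (w mod a3) (w div a3)"]) auto
  show ?thesis
    using assms s3 by (subst uniform_split[where F = "\<lambda>x w. F x (w mod a2) (w div a2 mod a3) (w div a2 div a3)"]) auto
qed

text \<open>On the bad set S the left side is at most 1; elsewhere the pointwise comparison
  applies.\<close>

lemma pmf_bind_mono:
  assumes "\<And>x. x \<in> set_pmf M \<Longrightarrow> x \<notin> S \<Longrightarrow> pmf (f x) i \<le> pmf (g x) j + c" "0 \<le> c"
  shows "pmf (bind_pmf M f) i \<le> pmf (bind_pmf M g) j + (measure_pmf.prob M S + c)"
proof -
  have ind: "integrable (measure_pmf M) (indicat_real S)"
    by (intro measure_pmf.integrable_const_bound[where B = 1]) (auto simp: indicator_def)
  have int: "integrable (measure_pmf M) (\<lambda>x. pmf (h x) y)" for h :: "'a \<Rightarrow> 'z pmf" and y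
    by (intro measure_pmf.integrable_const_bound[where B = 1]) (auto simp: pmf_le_1)
  have "pmf (bind_pmf M f) i = measure_pmf.expectation M (\<lambda>x. pmf (f x) i)"
    by (rule pmf_bind)
  also have "\<dots> \<le> measure_pmf.expectation M (\<lambda>x. pmf (g x) j + (indicator S x + c))"
  proof (rule integral_mono_AE)
    have "pmf (f x) i \<le> pmf (g x) j + (indicator S x + c)" if "x \<in> set_pmf M" for x
    proof (cases "x \<in> S")
      case True
      have "pmf (f x) i \<le> 1" "0 \<le> pmf (g x) j" by (simp_all add: pmf_le_1)
      then have "pmf (f x) i \<le> pmf (g x) j + (1 + c)" using assms(2) by linarith
      then show ?thesis using True by simp
    qed (use assms(1)[OF that] in auto)
    then show "AE x in measure_pmf M. pmf (f x) i \<le> pmf (g x) j + (indicator S x + c)"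
      by (intro AE_pmfI)
    show "integrable (measure_pmf M) (\<lambda>x. pmf (g x) j + (indicator S x + c))"
      by (intro Bochner_Integration.integrable_add int ind) simp
  qed (rule int)
  also have "\<dots> = pmf (bind_pmf M g) j + (measure_pmf.prob M S + c)"
  proof -
    have "measure_pmf.expectation M (\<lambda>x. pmf (g x) j + (indicator S x + c)) =
        measure_pmf.expectation M (\<lambda>x. pmf (g x) j) + measure_pmf.expectation M (\<lambda>x. indicator S x + c)"
      by (intro Bochner_Integration.integral_add int Bochner_Integration.integrable_add ind) simp
    also have "measure_pmf.expectation M (\<lambda>x. indicator S x + c) = measure_pmf.prob M S + c"
      using ind by (subst Bochner_Integration.integral_add) auto
    finally show ?thesis by (simp add: pmf_bind)
  qed
  finally show ?thesis .
qed

lemma pmf_bind_mono':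
  assumes "\<And>x. x \<in> set_pmf M \<Longrightarrow> pmf (f x) i \<le> pmf (g x) j"
  shows "pmf (bind_pmf M f) i \<le> pmf (bind_pmf M g) j"
  using pmf_bind_mono[of M "{}" f i g j 0] assms by simp

text \<open>By Cauchy-Schwarz over the at most \<open>card D\<close> possible choices.\<close>

lemma collision:
  assumes "finite D" "\<And>j. j \<in> set_pmf J \<Longrightarrow> fst j \<in> D"
  shows "(pmf (map_pmf snd J) True)\<^sup>2 \<le>
    real (card D) * pmf (bind_pmf (map_pmf fst J) (\<lambda>a. map_pmf (\<lambda>j. snd j \<and> fst j = a) J)) True"
proof -
  define w where "w a = measure_pmf.prob J {j. snd j \<and> fst j = a}" for a
  have "pmf (map_pmf snd J) True = measure_pmf.prob J {j. snd j}"
    by (simp add: pmf_map vimage_def)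
  also have "\<dots> = measure_pmf.prob J (\<Union>a\<in>D. {j. snd j \<and> fst j = a})"
    using assms(2) by (intro measure_pmf.finite_measure_eq_AE AE_pmfI) auto
  also have "\<dots> = (\<Sum>a\<in>D. w a)"
    unfolding w_def using assms(1)
    by (intro measure_pmf.finite_measure_finite_Union) (auto simp: disjoint_family_on_def)
  finally have sum: "pmf (map_pmf snd J) True = (\<Sum>a\<in>D. w a)" .
  have "pmf (bind_pmf (map_pmf fst J) (\<lambda>a. map_pmf (\<lambda>j. snd j \<and> fst j = a) J)) True =
      measure_pmf.expectation (map_pmf fst J) w"
    unfolding pmf_bind by (simp add: pmf_map w_def vimage_def)
  also have "\<dots> = (\<Sum>a\<in>D. w a * pmf (map_pmf fst J) a)"
    using assms by (intro integral_measure_pmf_real) auto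
  finally have eq: "pmf (bind_pmf (map_pmf fst J) (\<lambda>a. map_pmf (\<lambda>j. snd j \<and> fst j = a) J)) True =
      (\<Sum>a\<in>D. w a * pmf (map_pmf fst J) a)" .
  have "w a \<le> pmf (map_pmf fst J) a" for a
    unfolding w_def pmf_map by (intro measure_pmf.finite_measure_mono) auto
  then have "(w a)\<^sup>2 \<le> w a * pmf (map_pmf fst J) a" for a
    unfolding power2_eq_square by (intro mult_left_mono) (auto simp: w_def)
  then have "(\<Sum>a\<in>D. (w a)\<^sup>2) \<le> (\<Sum>a\<in>D. w a * pmf (map_pmf fst J) a)"
    by (intro sum_mono) auto
  then have "real (card D) * (\<Sum>a\<in>D. (w a)\<^sup>2) \<le> real (card D) * (\<Sum>a\<in>D. w a * pmf (map_pmf fst J) a)"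
    by (rule mult_left_mono) simp
  moreover have "(\<Sum>a\<in>D. w a)\<^sup>2 \<le> real (card D) * (\<Sum>a\<in>D. (w a)\<^sup>2)"
    using sum_squared_le_sum_of_squares[of w D] by (simp only: mult.commute)
  ultimately show ?thesis
    unfolding sum eq by (rule order_trans[rotated])
qed

text \<open>The domain depends on q, so \<open>collision\<close> applies to each instance
  separately. Averaging over instances then needs that the square of a mean is at most the mean of
  the squares, that is, that variance is nonnegative.\<close>

lemma pmf_bind_square:
  "(pmf (bind_pmf M f) i)\<^sup>2 \<le> measure_pmf.expectation M (\<lambda>x. (pmf (f x) i)\<^sup>2)"
proof -
  have 1: "integrable (measure_pmf M) (\<lambda>x. pmf (f x) i)"
    by (intro measure_pmf.integrable_const_bound[where B = 1]) (auto simp: pmf_le_1)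
  have 2: "integrable (measure_pmf M) (\<lambda>x. (pmf (f x) i)\<^sup>2)"
    by (intro measure_pmf.integrable_const_bound[where B = 1]) (auto simp: pmf_le_1 power_le_one)
  show ?thesis
    using measure_pmf.variance_eq[OF 1 2] measure_pmf.variance_positive[of M "\<lambda>x. pmf (f x) i"]
    unfolding pmf_bind by linarith
qed

section \<open>The attack as an experiment on public keys\<close>

definition query_message :: "alg \<Rightarrow> nat \<Rightarrow> int \<Rightarrow> nat \<Rightarrow> data \<Rightarrow> (int \<times> data list) list \<Rightarrow> data" where
  "query_message A \<eta> \<omega> N pk h = reduced (int N) (question (answer A \<eta> \<omega> (lst [pk, enc_history h])))"

definition sec_history :: "alg \<Rightarrow> nat \<Rightarrow> nat \<Rightarrow> nat \<Rightarrow> pe_pk \<Rightarrow> int \<Rightarrow> (int \<times> data list) list pmf" where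
  "sec_history A \<eta> k m pk \<omega> = history m (query_message A \<eta> \<omega> (modulus (pk_inst pk)) (pe_enc_pk pk))
     (\<lambda>x. outcome (pe_encode pk k x)) []"

definition sec_chosen :: "alg \<Rightarrow> nat \<Rightarrow> pe_pk \<Rightarrow> int \<Rightarrow> (int \<times> data list) list \<Rightarrow> int" where
  "sec_chosen A \<eta> pk \<omega> h = int_of (answer A \<eta> \<omega> (lst [pe_enc_pk pk, enc_history h])) mod int (modulus (pk_inst pk))"

definition sec_forged :: "alg \<Rightarrow> nat \<Rightarrow> pe_pk \<Rightarrow> int \<Rightarrow> (int \<times> data list) list \<Rightarrow> data list \<Rightarrow> data" where
  "sec_forged A \<eta> pk \<omega> h \<sigma> = answer A \<eta> \<omega> (lst [pe_enc_pk pk, enc_history h, lst \<sigma>])"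

text \<open>Needs the public key only. Whether the forgery wins is judged afterwards from the
  result, so a reduction that does not know s can sample this experiment.\<close>

definition sec_attack :: "alg \<Rightarrow> nat \<Rightarrow> nat \<Rightarrow> nat \<Rightarrow> pe_pk \<Rightarrow> (int \<times> data) pmf" where
  "sec_attack A \<eta> k m pk = do {
     \<omega> \<leftarrow> toss A \<eta>;
     h \<leftarrow> sec_history A \<eta> k m pk \<omega>;
     \<sigma> \<leftarrow> outcome (pe_encode pk k (sec_chosen A \<eta> pk \<omega> h));
     return_pmf (sec_chosen A \<eta> pk \<omega> h, sec_forged A \<eta> pk \<omega> h \<sigma>)
   }"

definition sec_choice :: "alg \<Rightarrow> nat \<Rightarrow> nat \<Rightarrow> nat \<Rightarrow> pe_pk \<Rightarrow> int pmf" where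
  "sec_choice A \<eta> k m pk = do {
     \<omega> \<leftarrow> toss A \<eta>;
     h \<leftarrow> sec_history A \<eta> k m pk \<omega>;
     return_pmf (sec_chosen A \<eta> pk \<omega> h)
   }"

lemma map_fst_sec_attack: "map_pmf fst (sec_attack A \<eta> k m pk) = sec_choice A \<eta> k m pk"
  by (simp add: sec_attack_def sec_choice_def map_bind_pmf bind_pmf_const)

definition sec_win :: "(nat \<Rightarrow> int set) \<Rightarrow> nat \<Rightarrow> pe_pk \<Rightarrow> pe_sk \<Rightarrow> int poly \<Rightarrow> int \<Rightarrow> data \<Rightarrow> bool" where
  "sec_win M k pk sk f x d \<longleftrightarrow>
     pe_verdict M k pk sk x (left d, right d) \<notin> {Some (poly f x mod int (sk_q sk)), None}"

lemma security_game_pe: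
  fixes \<G> D M n A \<eta>
  defines "k \<equiv> ceillog2 (n + 1)"
  shows "security_game (pe_scheme \<G> D M n) f A l \<eta> = bind_pmf (pe_keygen \<G> k \<eta> (f \<eta>)) (\<lambda>(pk, sk). do {
     \<omega> \<leftarrow> toss A \<eta>;
     h \<leftarrow> history (poly l \<eta>) (\<lambda>h. question (answer A \<eta> \<omega> (lst [pe_enc_pk pk, enc_history h])))
       (\<lambda>x. outcome (pe_encode pk k x)) [];
     let x = int_of (answer A \<eta> \<omega> (lst [pe_enc_pk pk, enc_history h]));
     \<sigma> \<leftarrow> outcome (pe_encode pk k x);
     return_pmf (insert x (fst ` set h) \<subseteq> D (sk_q sk),
       sec_win M k pk sk (f \<eta>) x (sec_forged A \<eta> pk \<omega> h \<sigma>))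
   })"
  unfolding security_game_def query_phase_history Let_def enc_transcript_pe
  by (simp add: pe_scheme_def Let_def map_fst_pe_probgen outcome_pe_probgen bind_map_pmf k_def
      case_prod_beta map_pmf_comp outcome_pe_verify bind_return_pmf sec_win_def sec_forged_def cong: if_cong)

text \<open>As for privacy, reduction modulo N is invisible on the support. The second claim
  confines the choices to D, as \<open>collision\<close> requires.\<close>

lemma security_real_ideal:
  fixes A \<eta> k pk D m W
  defines "N \<equiv> modulus (pk_inst pk)" and "orac \<equiv> (\<lambda>x. outcome (pe_encode pk k x))"
  defines "nx \<equiv> (\<lambda>\<omega> h. answer A \<eta> \<omega> (lst [pe_enc_pk pk, enc_history h]))"
  defines "game \<equiv> do {
     \<omega> \<leftarrow> toss A \<eta>;
     h \<leftarrow> history m (\<lambda>h. question (nx \<omega> h)) orac [];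
     let x = int_of (nx \<omega> h);
     \<sigma> \<leftarrow> orac x;
     return_pmf (insert x (fst ` set h) \<subseteq> D, W x (sec_forged A \<eta> pk \<omega> h \<sigma>))
   }"
  assumes dom: "\<And>r. r \<in> set_pmf game \<Longrightarrow> fst r" and D: "D \<subseteq> {0..<int N}"
  shows "map_pmf snd game = map_pmf (\<lambda>(x, d). W x d) (sec_attack A \<eta> k m pk)" (is ?eq)
    and "\<And>r. r \<in> set_pmf (sec_attack A \<eta> k m pk) \<Longrightarrow> fst r \<in> D"
proof -
  define real where "real = do {
     \<omega> \<leftarrow> toss A \<eta>;
     h \<leftarrow> history m (\<lambda>h. question (nx \<omega> h)) orac [];
     \<sigma> \<leftarrow> orac (int_of (nx \<omega> h));
     return_pmf (int_of (nx \<omega> h), sec_forged A \<eta> pk \<omega> h \<sigma>)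
   }"
  have inD: "insert (int_of (nx \<omega> h)) (fst ` set h) \<subseteq> D"
    if "\<omega> \<in> set_pmf (toss A \<eta>)" "h \<in> set_pmf (history m (\<lambda>h. question (nx \<omega> h)) orac [])" for \<omega> h
  proof -
    obtain \<sigma> where \<sigma>: "\<sigma> \<in> set_pmf (orac (int_of (nx \<omega> h)))"
      using set_pmf_not_empty[of "orac (int_of (nx \<omega> h))"] by blast
    have "(insert (int_of (nx \<omega> h)) (fst ` set h) \<subseteq> D, W (int_of (nx \<omega> h)) (sec_forged A \<eta> pk \<omega> h \<sigma>)) \<in> set_pmf game"
      unfolding game_def Let_def set_bind_pmf UN_iff set_return_pmf
      by (rule bexI[OF _ that(1)], rule bexI[OF _ that(2)], rule bexI[OF _ \<sigma>]) simp
    from dom[OF this] show ?thesis by simp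
  qed
  have "real = sec_attack A \<eta> k m pk"
    unfolding real_def sec_attack_def
  proof (intro bind_pmf_cong refl)
    fix \<omega> assume \<omega>: "\<omega> \<in> set_pmf (toss A \<eta>)"
    have hist: "sec_history A \<eta> k m pk \<omega> = history m (\<lambda>h. question (nx \<omega> h)) orac []"
      unfolding sec_history_def query_message_def[abs_def] N_def[symmetric] orac_def nx_def
      by (rule history_reduced) (use inD[OF \<omega>] D in \<open>auto simp: orac_def nx_def\<close>)
    then show "history m (\<lambda>h. question (nx \<omega> h)) orac [] = sec_history A \<eta> k m pk \<omega>" ..
    fix h assume "h \<in> set_pmf (sec_history A \<eta> k m pk \<omega>)"
    then have "int_of (nx \<omega> h) \<in> {0..<int N}"
      using inD[OF \<omega>, of h] D unfolding hist by auto
    then have x: "sec_chosen A \<eta> pk \<omega> h = int_of (nx \<omega> h)"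
      by (simp add: sec_chosen_def N_def nx_def)
    show "orac (int_of (nx \<omega> h)) = outcome (pe_encode pk k (sec_chosen A \<eta> pk \<omega> h))"
      by (simp add: x orac_def)
    show "return_pmf (int_of (nx \<omega> h), sec_forged A \<eta> pk \<omega> h \<sigma>) =
        return_pmf (sec_chosen A \<eta> pk \<omega> h, sec_forged A \<eta> pk \<omega> h \<sigma>)" for \<sigma>
      by (simp add: x)
  qed
  moreover have "map_pmf snd game = map_pmf (\<lambda>(x, d). W x d) real"
    by (simp add: game_def real_def map_bind_pmf Let_def)
  ultimately show ?eq by simp
  show "fst r \<in> D" if "r \<in> set_pmf (sec_attack A \<eta> k m pk)" for r
    using that inD unfolding \<open>real = sec_attack A \<eta> k m pk\<close>[symmetric] real_def by fastforce
qed

definition choice_tape :: "alg \<Rightarrow> nat \<Rightarrow> nat \<Rightarrow> int \<Rightarrow> nat \<Rightarrow> pe_pk \<Rightarrow> int \<Rightarrow> int \<Rightarrow> (int \<times> data list) list" where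
  "choice_tape A \<eta> k R m pk \<omega> t = tape_history (\<lambda>x. tape_encode (pk_inst pk) (pk_h pk) R k x) (R ^ k) m
     (query_message A \<eta> \<omega> (modulus (pk_inst pk)) (pe_enc_pk pk)) [] t"

definition attack_tape :: "alg \<Rightarrow> nat \<Rightarrow> nat \<Rightarrow> int \<Rightarrow> nat \<Rightarrow> pe_pk \<Rightarrow> int \<Rightarrow> int \<Rightarrow> int \<Rightarrow> int \<times> data" where
  "attack_tape A \<eta> k R m pk \<omega> t t' = (let h = choice_tape A \<eta> k R m pk \<omega> t; x = sec_chosen A \<eta> pk \<omega> h
     in (x, sec_forged A \<eta> pk \<omega> h (tape_encode (pk_inst pk) (pk_h pk) R k x t')))"

context simulation
begin

lemma carrier_1_uniform: "pmf_of_set (carrier (grp \<Gamma> 1)) = map_pmf (\<lambda>r. ex 1 (int r)) (pmf_of_set {0..<N})"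
  using map_pmf_ex[of 1 1 0] \<kappa> by simp

lemma covers_choice_history:
  "covers ((1 - 1 / 2 ^ \<eta>) ^ (k * m)) (map_pmf (choice_tape A \<eta>' k R m (pe_pub \<Gamma> k f s h) \<omega>) (uniform ((R ^ k) ^ m)))
     (sec_history A \<eta>' k m (pe_pub \<Gamma> k f s h) \<omega>)"
  using covers_tape_history unfolding choice_tape_def[abs_def] sec_history_def pe_pub_sel by blast

text \<open>A uniform u is g^v with v uniform, so u^q is g^(v q), the form in which the program
  samples it. The samples are s, v and k for each question.\<close>

lemma covers_choice:
  fixes k m A f
  defines "\<epsilon> \<equiv> 1 / 2 ^ \<eta> :: real"
  shows "covers ((1 - \<epsilon>) * ((1 - \<epsilon>) * (1 - \<epsilon>) ^ (k * m)))
    (bind_pmf (uniform R) (\<lambda>r. bind_pmf (uniform R) (\<lambda>v. bind_pmf (toss A \<eta>) (\<lambda>\<omega>.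
       bind_pmf (uniform ((R ^ k) ^ m)) (\<lambda>t. return_pmf (
         let pk = pe_pub \<Gamma> k f (nat (r mod int N)) (ex 1 ((v mod int N) * int q))
         in sec_chosen A \<eta> pk \<omega> (choice_tape A \<eta> k R m pk \<omega> t)))))))
    (bind_pmf (pmf_of_set {0..<modulus \<Gamma>}) (\<lambda>s. bind_pmf (pmf_of_set (carrier (grp \<Gamma> 1))) (\<lambda>u.
       sec_choice A \<eta> k m (pe_pub \<Gamma> k f s (u [^]\<^bsub>grp \<Gamma> 1\<^esub> q)))))"
    (is "covers _ ?L ?Z")
proof -
  have \<epsilon>: "0 \<le> 1 - \<epsilon>" by (simp add: \<epsilon>_def)
  let ?X = "bind_pmf (map_pmf (\<lambda>w. nat (w mod int N)) (uniform R)) (\<lambda>s. bind_pmf (map_pmf (\<lambda>w. nat (w mod int N)) (uniform R)) (\<lambda>v.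
       bind_pmf (toss A \<eta>) (\<lambda>\<omega>.
       bind_pmf (map_pmf (choice_tape A \<eta> k R m (pe_pub \<Gamma> k f s (ex 1 (int v * int q))) \<omega>) (uniform ((R ^ k) ^ m))) (\<lambda>h.
         return_pmf (sec_chosen A \<eta> (pe_pub \<Gamma> k f s (ex 1 (int v * int q))) \<omega> h)))))"
  let ?Y = "bind_pmf (pmf_of_set {0..<N}) (\<lambda>s. bind_pmf (pmf_of_set {0..<N}) (\<lambda>v.
       sec_choice A \<eta> k m (pe_pub \<Gamma> k f s (ex 1 (int v * int q)))))"
  have L: "?L = ?X"
    using N_pos by (simp add: bind_map_pmf Let_def)
  have Z: "?Z = ?Y"
    unfolding carrier_1_uniform bind_map_pmf modulus_eq using \<kappa> by (simp add: ex_pow_nat)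
  show ?thesis
    unfolding L Z unfolding sec_choice_def \<epsilon>_def
    by (rule covers_bind, rule covers_uniform_N, rule covers_bind, rule covers_uniform_N,
        rule covers_bind_same, rule covers_bind_left, rule covers_choice_history) (use \<epsilon> in \<open>simp_all add: \<epsilon>_def\<close>)
qed

text \<open>Here s is given, since it comes from the challenge. Only the exponent of h, the answers
  and the final encoding are sampled.\<close>

lemma covers_attack:
  fixes k m A f s
  defines "\<epsilon> \<equiv> 1 / 2 ^ \<eta> :: real"
  shows "covers ((1 - \<epsilon>) * ((1 - \<epsilon>) ^ (k * m) * (1 - \<epsilon>) ^ k))
    (bind_pmf (uniform R) (\<lambda>v. bind_pmf (toss A \<eta>) (\<lambda>\<omega>.
       bind_pmf (uniform ((R ^ k) ^ m)) (\<lambda>t. bind_pmf (uniform (R ^ k)) (\<lambda>t'. return_pmf (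
         attack_tape A \<eta> k R m (pe_pub \<Gamma> k f s (ex 1 ((v mod int N) * int q))) \<omega> t t'))))))
    (bind_pmf (pmf_of_set (carrier (grp \<Gamma> 1))) (\<lambda>u. sec_attack A \<eta> k m (pe_pub \<Gamma> k f s (u [^]\<^bsub>grp \<Gamma> 1\<^esub> q))))"
    (is "covers _ ?L ?Z")
proof -
  have \<epsilon>: "0 \<le> 1 - \<epsilon>" by (simp add: \<epsilon>_def)
  let ?pk = "\<lambda>v. pe_pub \<Gamma> k f s (ex 1 (int v * int q))"
  let ?X = "bind_pmf (map_pmf (\<lambda>w. nat (w mod int N)) (uniform R)) (\<lambda>v.
       bind_pmf (toss A \<eta>) (\<lambda>\<omega>.
       bind_pmf (map_pmf (choice_tape A \<eta> k R m (?pk v) \<omega>) (uniform ((R ^ k) ^ m))) (\<lambda>h.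
       bind_pmf (map_pmf (tape_encode \<Gamma> (ex 1 (int v * int q)) R k (sec_chosen A \<eta> (?pk v) \<omega> h)) (uniform (R ^ k))) (\<lambda>\<sigma>.
         return_pmf (sec_chosen A \<eta> (?pk v) \<omega> h, sec_forged A \<eta> (?pk v) \<omega> h \<sigma>)))))"
  have L: "?L = ?X"
    using N_pos by (simp add: bind_map_pmf Let_def attack_tape_def)
  have Z: "?Z = bind_pmf (pmf_of_set {0..<N}) (\<lambda>v. sec_attack A \<eta> k m (?pk v))"
    unfolding carrier_1_uniform bind_map_pmf using \<kappa> by (simp add: ex_pow_nat)
  show ?thesis
    unfolding L Z unfolding sec_attack_def \<epsilon>_def
    by (rule covers_bind, rule covers_uniform_N, rule covers_bind_same, rule covers_bind, rule covers_choice_history,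
        rule covers_bind_left, rule covers_tape_encode) (use \<epsilon> in \<open>simp_all add: \<epsilon>_def\<close>)
qed

lemma sim_query_eq:
  assumes "h \<in> carrier (grp \<Gamma> 1)" "0 \<le> t" "t < (R ^ k) ^ poly l \<eta>"
    "3 + poly l \<eta> * (1 + entry_bound k) + 3 * \<eta> * k * poly l \<eta> \<le> b"
  shows "sim_query A mul k l (unary \<eta>) E h pk \<omega> t =
    enc_history (tape_history (\<lambda>x. tape_encode \<Gamma> h R k x) (R ^ k) (poly l \<eta>) (query_message A \<eta> \<omega> N pk) [] t)"
proof -
  have "(R ^ k) ^ poly l \<eta> = 2 ^ (3 * \<eta> * k * poly l \<eta>)"
    by (simp add: R_eq power_mult)
  then show ?thesis
    using sim_history_eq[OF assms(1,2) _ assms(4), of "\<lambda>z. question (next_message A z)" "context_of \<eta> \<omega> [pk]"] assms(3)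
    unfolding next_message_answer query_message_def[abs_def] sim_query_def by (simp add: context_of_def)
qed

lemma sim_choice_eq:
  "sim_choice A (unary \<eta>) E (pe_enc_pk (pe_pub \<Gamma> k f s h)) \<omega> (enc_history hs) = sec_chosen A \<eta> (pe_pub \<Gamma> k f s h) \<omega> hs"
  using next_message_answer[of A \<eta> \<omega> "[pe_enc_pk (pe_pub \<Gamma> k f s h)]" "enc_history hs"]
  by (simp add: sim_choice_def sec_chosen_def context_of_def modulus_eq)

lemma sim_guess_eq:
  assumes F: "F (unary \<eta>) = lst (map Atom (coeffs f))"
    and b': "3 + poly l \<eta> * (1 + entry_bound k) + 3 * \<eta> * k * poly l \<eta> \<le> b"
    and t: "0 \<le> w div R div R div 2 ^ poly (coins A) \<eta>"
      "w div R div R div 2 ^ poly (coins A) \<eta> < (R ^ k) ^ poly l \<eta>"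
  shows "sim_guess A mul k F l (unary \<eta>) E (int q) w =
    (let pk = pe_pub \<Gamma> k f (nat ((w mod R) mod int N)) (ex 1 (((w div R mod R) mod int N) * int q));
         \<omega> = w div R div R mod 2 ^ poly (coins A) \<eta>
     in sec_chosen A \<eta> pk \<omega> (choice_tape A \<eta> k R (poly l \<eta>) pk \<omega> (w div R div R div 2 ^ poly (coins A) \<eta>)))"
proof -
  have h: "sim_pow mul 1 E (env_gen 1 E) c = ex 1 c" for c
    using \<kappa> by (simp add: env_gen_E sim_pow_ex)
  have pk: "lst [left E, env_gen 1 E, v, sim_powers mul k E (r mod int N), F (unary \<eta>)] =
      pe_enc_pk (pe_pub \<Gamma> k f (nat (r mod int N)) v)" for r v
    using pe_enc_pk_sim[where F = F, OF F, of v k "nat (r mod int N)"] N_pos by simp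
  have "ex 1 c \<in> carrier (grp \<Gamma> 1)" for c
    using \<kappa> by (simp add: ex_closed)
  note query = sim_query_eq[OF this t b']
  show ?thesis
    unfolding sim_guess_def Let_def len_unary_poly len_unary env_mod_E E(3) h pk query sim_choice_eq
      choice_tape_def pe_pub_sel modulus_eq ..
qed

lemma sim_attack_eq:
  fixes s' a k n
  assumes F: "F (unary \<eta>) = lst (map Atom (coeffs f))"
    and b': "3 + poly l \<eta> * (1 + entry_bound k) + 3 * \<eta> * k * poly l \<eta> \<le> b"
    and n: "\<And>i. i < k \<Longrightarrow> 2 ^ i \<le> n"
  shows "sim_attack A mul e k n F Y l (unary \<eta>) E (int p) (int q) (lst (map (\<lambda>i. ex 1 (s' ^ i)) [0..<Suc n])) a w =
    sim_root mul e k n (lst (map Atom (coeffs f))) (Y (Atom (int q))) E (lst (map (\<lambda>i. ex 1 (s' ^ i)) [0..<Suc n]))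
      (int p) (int q) a (snd (attack_tape A \<eta> k R (poly l \<eta>)
        (pe_pub \<Gamma> k f (nat ((s' + a) mod int N)) (ex 1 (((w mod R) mod int N) * int q)))
        (w div R mod 2 ^ poly (coins A) \<eta>) (w div R div 2 ^ poly (coins A) \<eta> mod (R ^ k) ^ poly l \<eta>)
        (w div R div 2 ^ poly (coins A) \<eta> div (R ^ k) ^ poly l \<eta>)))"
proof -
  have h: "sim_pow mul 1 E (env_gen 1 E) c = ex 1 c" for c
    using \<kappa> by (simp add: env_gen_E sim_pow_ex)
  have carrier: "ex 1 c \<in> carrier (grp \<Gamma> 1)" for c
    using \<kappa> by (simp add: ex_closed)
  have T: "2 ^ len (unary_poly ([:0, 3 * k:] * l) (unary \<eta>)) = (R ^ k) ^ poly l \<eta>"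
    by (simp add: R_eq mult.assoc mult.left_commute flip: power_mult)
  have "0 < (R ^ k) ^ poly l \<eta>"
    using R_pos by simp
  note query = sim_query_eq[OF carrier pos_mod_sign[OF this] pos_mod_bound[OF this] b']
  have pk: "lst [left E, env_gen 1 E, v, shifted_powers mul k E (lst (map (\<lambda>i. ex 1 (s' ^ i)) [0..<Suc n])) a,
      lst (map Atom (coeffs f))] = pe_enc_pk (pe_pub \<Gamma> k f (nat ((s' + a) mod int N)) v)" for v
  proof -
    have "ex 1 ((s' + a) ^ 2 ^ i) = gen \<Gamma> 1 [^]\<^bsub>grp \<Gamma> 1\<^esub> (nat ((s' + a) mod int N) ^ 2 ^ i)" for i
    proof -
      have "gen \<Gamma> 1 [^]\<^bsub>grp \<Gamma> 1\<^esub> (nat ((s' + a) mod int N) ^ 2 ^ i) = ex 1 (((s' + a) mod int N) ^ 2 ^ i)"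
        using \<kappa> N_pos by (subst gen_pow_nat) auto
      also have "\<dots> = ex 1 ((s' + a) ^ 2 ^ i)"
        using \<kappa> by (intro ex_cong cong_pow) auto
      finally show ?thesis ..
    qed
    then have "shifted_powers mul k E (lst (map (\<lambda>i. ex 1 (s' ^ i)) [0..<Suc n])) a =
        lst (map (\<lambda>i. gen \<Gamma> 1 [^]\<^bsub>grp \<Gamma> 1\<^esub> (nat ((s' + a) mod int N) ^ 2 ^ i)) [0..<k])"
      by (subst shifted_powers_eq[OF n]) simp_all
    then show ?thesis
      unfolding pe_enc_pk_def pe_pub_sel E(1) using \<kappa> by (simp only: env_gen_E gen_eq order_refl)
  qed
  have forged: "next_message A (Node (Node (unary \<eta>) (Node (Atom \<omega>) (lst [pe_enc_pk pk, enc_history hs]))) (lst \<sigma>)) =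
      sec_forged A \<eta> pk \<omega> hs \<sigma>" for \<omega> pk hs \<sigma>
    using next_message_answer[of A \<eta> \<omega> "[pe_enc_pk pk, enc_history hs]" "lst \<sigma>"]
    by (simp add: sec_forged_def context_of_def)
  show ?thesis
    unfolding sim_attack_def Let_def T
    unfolding len_unary_poly len_unary env_mod_E E(3) h F pk query sim_choice_eq sim_encode_eq[OF carrier] forged
      attack_tape_def choice_tape_def pe_pub_sel modulus_eq Let_def snd_conv ..
qed

text \<open>The comparison for one instance and one invertible challenge secret s'. The exponent of
  \<delta> adds up the samples of both runs: 2 + k m for the guess and 1 + k m + k for the
  attack.\<close>

lemma security_bound:
  fixes s' k m n :: nat and A C :: alg and f :: "int poly"
  defines "\<delta> \<equiv> (1 - 1 / 2 ^ \<eta> :: real) ^ (3 + k + 2 * k * m)"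
  defines "ch \<equiv> bind_pmf (pmf_of_set {0..<modulus \<Gamma>}) (\<lambda>s. bind_pmf (pmf_of_set (carrier (grp \<Gamma> 1))) (\<lambda>u.
       sec_choice A \<eta> k m (pe_pub \<Gamma> k f s (u [^]\<^bsub>grp \<Gamma> 1\<^esub> q))))"
  defines "powers \<equiv> map (\<lambda>i. gen \<Gamma> 1 [^]\<^bsub>grp \<Gamma> 1\<^esub> (s' ^ i)) [0..<Suc n]"
  defines "sh a \<equiv> nat ((int s' + a) mod int N)"
  assumes k: "1 \<le> k" "\<kappa> = 2 * k + 1" "\<And>i. i < k \<Longrightarrow> 2 ^ i \<le> n" and deg: "degree f \<le> n" and m: "m = poly l \<eta>"
    and E_eq: "E = env Q (unary \<eta>) (enc_mlm \<Gamma>)" and F: "F (unary \<eta>) = lst (map Atom (coeffs f))"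
    and Y: "Y (Atom (int q)) = lst (map Atom ys)" "set ys = M q" "M q \<subseteq> {0..<int q}"
    and b': "3 + m * (1 + entry_bound k) + 3 * \<eta> * k * m \<le> b" "2 + 2 * bits (lst (map Atom ys)) \<le> b" "6 + 3 * \<eta> \<le> b"
    and C: "prog C = security_sim A mul e k n F Y l Q"
      "toss C \<eta> = uniform ((R * (R * (2 ^ poly (coins A) \<eta> * (R ^ k) ^ m))) * (R * (2 ^ poly (coins A) \<eta> * ((R ^ k) ^ m * R ^ k))))"
    and s': "coprime N s'"
  shows "pmf (bind_pmf ch (\<lambda>a. bind_pmf (pmf_of_set (carrier (grp \<Gamma> 1))) (\<lambda>u. map_pmf
        (\<lambda>(x, d). sec_win M k (pe_pub \<Gamma> k f (sh a) (u [^]\<^bsub>grp \<Gamma> 1\<^esub> q)) (pe_sec \<Gamma> p q f (sh a)) f x d \<and> x = a)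
        (sec_attack A \<eta> k m (pe_pub \<Gamma> k f (sh a) (u [^]\<^bsub>grp \<Gamma> 1\<^esub> q)))))) True \<le>
    pmf (bind_pmf (toss C \<eta>) (\<lambda>\<omega>. return_pmf (coprime (modulus \<Gamma>) s' \<and>
        answer C \<eta> \<omega> (lst [Atom (int p), Atom (int q), enc_mlm \<Gamma>, lst powers]) =
          gen \<Gamma> \<kappa> [^]\<^bsub>grp \<Gamma> \<kappa>\<^esub> (int p * modular_inverse (int (modulus \<Gamma>)) (int s'))))) True + (1 - \<delta>)"
    (is "pmf ?ideal True \<le> pmf ?msdhs True + _")
proof -
  let ?c0 = "2 ^ poly (coins A) \<eta> :: int" and ?T = "(R ^ k) ^ m"
  let ?X = "R * (R * (?c0 * ?T))" and ?X' = "R * (?c0 * (?T * R ^ k))"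
  define \<epsilon> where "\<epsilon> = (1 / 2 ^ \<eta> :: real)"
  have \<epsilon>: "0 \<le> 1 - \<epsilon>" "1 - \<epsilon> \<le> 1" by (simp_all add: \<epsilon>_def)
  have pos: "0 < R" "0 < ?c0" "0 < ?T" "0 < R ^ k" using R_pos by simp_all
  define gch where "gch r v \<omega> t = (let pk = pe_pub \<Gamma> k f (nat (r mod int N)) (ex 1 ((v mod int N) * int q))
      in sec_chosen A \<eta> pk \<omega> (choice_tape A \<eta> k R m pk \<omega> t))" for r v \<omega> t
  define gat where "gat a v \<omega> t t' = attack_tape A \<eta> k R m (pe_pub \<Gamma> k f (sh a) (ex 1 ((v mod int N) * int q))) \<omega> t t'" for a v \<omega> t t'
  \<comment> \<open>Verification does not look at h. Quantifying it away makes winning a function of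
    the guess and the result, so that \<open>covers\<close> can be applied to the distributions of
    these alone.\<close>
  define win where "win a xd \<longleftrightarrow> (\<exists>h. sec_win M k (pe_pub \<Gamma> k f (sh a) h) (pe_sec \<Gamma> p q f (sh a)) f (fst xd) (snd xd)) \<and> fst xd = a" for a xd
  have winI: "win a xd" if "sec_win M k (pe_pub \<Gamma> k f (sh a) h) (pe_sec \<Gamma> p q f (sh a)) f (fst xd) (snd xd)" "fst xd = a" for a xd h
    unfolding win_def using that by (intro conjI exI)
  define g1 where "g1 w = gch (w mod R) (w div R mod R) (w div R div R mod ?c0) (w div R div R div ?c0)" for w
  define g2 where "g2 a w = gat a (w mod R) (w div R mod ?c0) (w div R div ?c0 mod ?T) (w div R div ?c0 div ?T)" for a w
  define CT where "CT = bind_pmf (uniform R) (\<lambda>r. bind_pmf (uniform R) (\<lambda>v. bind_pmf (toss A \<eta>) (\<lambda>\<omega>.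
       bind_pmf (uniform ?T) (\<lambda>t. return_pmf (gch r v \<omega> t)))))"
  define AT where "AT a = bind_pmf (uniform R) (\<lambda>v. bind_pmf (toss A \<eta>) (\<lambda>\<omega>.
       bind_pmf (uniform ?T) (\<lambda>t. bind_pmf (uniform (R ^ k)) (\<lambda>t'. return_pmf (gat a v \<omega> t t')))))" for a
  have CT: "bind_pmf (uniform ?X) (\<lambda>w. K (g1 w)) = bind_pmf CT K" for K :: "int \<Rightarrow> bool pmf"
    unfolding g1_def CT_def bind_assoc_pmf bind_return_pmf toss_uniform
    by (rule uniform_split4[where F = "\<lambda>r v \<omega> t. K (gch r v \<omega> t)"]) (rule pos)+
  have AT: "bind_pmf (uniform ?X') (\<lambda>w. K (g2 a w)) = bind_pmf (AT a) K" for K :: "int \<times> data \<Rightarrow> bool pmf" and a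
    unfolding g2_def AT_def bind_assoc_pmf bind_return_pmf toss_uniform
    by (rule uniform_split4[where F = "\<lambda>v \<omega> t t'. K (gat a v \<omega> t t')"]) (rule pos)+
  \<comment> \<open>The low and high parts of the tape are independent; splitting them and then
    their digits turns one draw into two successive runs.\<close>
  have tape: "bind_pmf (toss C \<eta>) (\<lambda>\<omega>. return_pmf (win (g1 (\<omega> mod ?X)) (g2 (g1 (\<omega> mod ?X)) (\<omega> div ?X)))) =
      bind_pmf CT (\<lambda>a. map_pmf (win a) (AT a))"
  proof -
    have "bind_pmf (toss C \<eta>) (\<lambda>\<omega>. return_pmf (win (g1 (\<omega> mod ?X)) (g2 (g1 (\<omega> mod ?X)) (\<omega> div ?X)))) =
        bind_pmf (uniform ?X) (\<lambda>w. bind_pmf (uniform ?X') (\<lambda>w'. return_pmf (win (g1 w) (g2 (g1 w) w'))))"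
      unfolding C(2)
      by (rule uniform_split[where F = "\<lambda>w w'. return_pmf (win (g1 w) (g2 (g1 w) w'))"])
        (intro mult_pos_pos pos)+
    also have "\<dots> = bind_pmf CT (\<lambda>a. bind_pmf (AT a) (\<lambda>xd. return_pmf (win a xd)))"
      unfolding AT[of "\<lambda>xd. return_pmf (win _ xd)"] by (rule CT)
    finally show ?thesis by (simp only: map_pmf_def)
  qed
  have cov: "covers (((1 - \<epsilon>) * ((1 - \<epsilon>) * (1 - \<epsilon>) ^ (k * m))) * ((1 - \<epsilon>) * ((1 - \<epsilon>) ^ (k * m) * (1 - \<epsilon>) ^ k)))
      (bind_pmf CT (\<lambda>a. map_pmf (win a) (AT a)))
      (bind_pmf ch (\<lambda>a. map_pmf (win a) (bind_pmf (pmf_of_set (carrier (grp \<Gamma> 1))) (\<lambda>u.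
         sec_attack A \<eta> k m (pe_pub \<Gamma> k f (sh a) (u [^]\<^bsub>grp \<Gamma> 1\<^esub> q))))))"
    unfolding CT_def ch_def AT_def gch_def gat_def \<epsilon>_def
    by (rule covers_bind, rule covers_choice, rule covers_map, rule covers_attack)
      (use \<epsilon> in \<open>simp add: \<epsilon>_def\<close>)
  have "((1 - \<epsilon>) * ((1 - \<epsilon>) * (1 - \<epsilon>) ^ (k * m))) * ((1 - \<epsilon>) * ((1 - \<epsilon>) ^ (k * m) * (1 - \<epsilon>) ^ k)) = \<delta>"
  proof -
    have "3 + k + 2 * k * m = (1 + (1 + k * m)) + (1 + (k * m + k))" by simp
    then show ?thesis
      unfolding \<delta>_def \<epsilon>_def[symmetric] by (simp only: power_add power_one_right)
  qed
  note cov = cov[unfolded this]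
  have \<delta>: "\<delta> \<le> 1"
    unfolding \<delta>_def by (rule power_le_one) simp_all
  have ideal_le: "pmf ?ideal True \<le> pmf (bind_pmf ch (\<lambda>a. map_pmf (win a) (bind_pmf (pmf_of_set (carrier (grp \<Gamma> 1))) (\<lambda>u.
         sec_attack A \<eta> k m (pe_pub \<Gamma> k f (sh a) (u [^]\<^bsub>grp \<Gamma> 1\<^esub> q)))))) True"
    unfolding map_bind_pmf
  proof (rule pmf_bind_mono', rule pmf_bind_mono')
    fix a u
    show "pmf (map_pmf (\<lambda>(x, d). sec_win M k (pe_pub \<Gamma> k f (sh a) (u [^]\<^bsub>grp \<Gamma> 1\<^esub> q)) (pe_sec \<Gamma> p q f (sh a)) f x d \<and> x = a)
          (sec_attack A \<eta> k m (pe_pub \<Gamma> k f (sh a) (u [^]\<^bsub>grp \<Gamma> 1\<^esub> q)))) True \<le>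
        pmf (map_pmf (win a) (sec_attack A \<eta> k m (pe_pub \<Gamma> k f (sh a) (u [^]\<^bsub>grp \<Gamma> 1\<^esub> q)))) True"
      unfolding pmf_map
    proof (rule measure_pmf.finite_measure_mono[OF subsetI])
      fix xd assume "xd \<in> (\<lambda>(x, d). sec_win M k (pe_pub \<Gamma> k f (sh a) (u [^]\<^bsub>grp \<Gamma> 1\<^esub> q)) (pe_sec \<Gamma> p q f (sh a)) f x d \<and> x = a) -` {True}"
      then have "win a xd"
        unfolding vimage_def mem_Collect_eq singleton_iff case_prod_unfold eq_True by (intro winI) (erule conjunct1 conjunct2)+
      then show "xd \<in> win a -` {True}" by (simp only: vimage_singleton_eq)
    qed (simp only: sets_measure_pmf UNIV_I)
  qed
  note cov_le = covers_True_le(2)[OF cov \<delta>]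
  have tape_le: "pmf (bind_pmf CT (\<lambda>a. map_pmf (win a) (AT a))) True \<le> pmf ?msdhs True"
    unfolding tape[symmetric]
  proof (rule pmf_bind_mono')
    fix \<omega> assume \<omega>: "\<omega> \<in> set_pmf (toss C \<eta>)"
    have "answer C \<eta> \<omega> (lst [Atom (int p), Atom (int q), enc_mlm \<Gamma>, lst powers]) = ex \<kappa> (int p * modular_inverse (int N) (int s'))"
      if w: "win (g1 (\<omega> mod ?X)) (g2 (g1 (\<omega> mod ?X)) (\<omega> div ?X))"
    proof -
      have "0 < ?X * ?X'" "0 < ?X" by (intro mult_pos_pos pos)+
      then have "0 \<le> \<omega> mod ?X" "\<omega> mod ?X < R * (R * (?c0 * ?T))"
        by (simp_all only: pos_mod_sign pos_mod_bound)
      note d1 = div_bounds[OF this pos(1)]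
      note d2 = div_bounds[OF conjunct1[OF d1] conjunct2[OF d1] pos(1)]
      note d3 = div_bounds[OF conjunct1[OF d2] conjunct2[OF d2] pos(2)]
      define a where "a = g1 (\<omega> mod ?X)"
      have guess: "sim_guess A mul k F l (unary \<eta>) E (int q) (\<omega> mod ?X) = a"
        using sim_guess_eq[where F = F and w = "\<omega> mod ?X" and A = A, OF F b'(1)[unfolded m]] conjunct1[OF d3] conjunct2[OF d3]
        by (simp only: a_def g1_def gch_def Let_def m)
      define d where "d = snd (g2 a (\<omega> div ?X))"
      have powers: "lst powers = lst (map (\<lambda>i. ex 1 (int s' ^ i)) [0..<Suc n])"
        unfolding powers_def using \<kappa> by (simp add: gen_pow_nat del: upt_Suc)
      have X: "env_range E * (env_range E * (2 ^ len (unary_poly (coins A) (unary \<eta>)) *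
           2 ^ len (unary_poly ([:0, 3 * k:] * l) (unary \<eta>)))) = ?X"
        by (simp add: E(3) R_eq m mult.assoc mult.left_commute flip: power_mult)
      have args: "left (lst [unary \<eta>, Atom \<omega>, x]) = unary \<eta>" "int_of (left (right (lst [unary \<eta>, Atom \<omega>, x]))) = \<omega>"
        "left (right (right (lst [unary \<eta>, Atom \<omega>, x]))) = x"
        "int_of (left (lst [Atom (int p), Atom (int q), enc_mlm \<Gamma>, lst powers])) = int p"
        "int_of (left (right (lst [Atom (int p), Atom (int q), enc_mlm \<Gamma>, lst powers]))) = int q"
        "left (right (right (lst [Atom (int p), Atom (int q), enc_mlm \<Gamma>, lst powers]))) = enc_mlm \<Gamma>"
        "left (right (right (right (lst [Atom (int p), Atom (int q), enc_mlm \<Gamma>, lst powers])))) = lst powers" for x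
        by (simp_all add: lst_Cons)
      have "answer C \<eta> \<omega> (lst [Atom (int p), Atom (int q), enc_mlm \<Gamma>, lst powers]) =
          sim_attack A mul e k n F Y l (unary \<eta>) E (int p) (int q) (lst powers) a (\<omega> div ?X)"
        unfolding answer_def C(1) security_sim_def Let_def args E_eq[symmetric] X guess ..
      also have "\<dots> = sim_root mul e k n (lst (map Atom (coeffs f))) (lst (map Atom ys)) E
          (lst (map (\<lambda>i. ex 1 (int s' ^ i)) [0..<Suc n])) (int p) (int q) a d"
        using sim_attack_eq[where F = F and Y = Y and A = A and s' = "int s'" and a = a and w = "\<omega> div ?X",
            OF F b'(1)[unfolded m] k(3)]
        unfolding powers Y(1) d_def g2_def gat_def sh_def m .
      also have "\<dots> = ex \<kappa> (int p * modular_inverse (int N) (int s'))"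
      proof -
        obtain h where h: "sec_win M k (pe_pub \<Gamma> k f (sh a) h) (pe_sec \<Gamma> p q f (sh a)) f a d"
          using w unfolding win_def a_def[symmetric] d_def by auto
        show ?thesis
          by (rule sim_root_eq[where M = M, OF k(1,2) deg Y(2) b'(2) Y(3) b'(3) _ h[unfolded sec_win_def sh_def pe_sec_sel]])
            (use s' in simp)
      qed
      finally show ?thesis .
    qed
    then show "pmf (return_pmf (win (g1 (\<omega> mod ?X)) (g2 (g1 (\<omega> mod ?X)) (\<omega> div ?X)))) True \<le>
        pmf (return_pmf (coprime (modulus \<Gamma>) s' \<and>
        answer C \<eta> \<omega> (lst [Atom (int p), Atom (int q), enc_mlm \<Gamma>, lst powers]) =
          gen \<Gamma> \<kappa> [^]\<^bsub>grp \<Gamma> \<kappa>\<^esub> (int p * modular_inverse (int (modulus \<Gamma>)) (int s')))) True"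
      using s' unfolding modulus_eq ex_def pmf_return by (simp add: indicator_def)
  qed
  show ?thesis
    using ideal_le cov_le tape_le by linarith
qed

end

text \<open>For each instance, \<open>collision\<close> bounds the squared success by the size of D
  times the probability that two runs agree on the input and the second wins. That probability is at
  most the MSDHS advantage up to sampling errors and non-invertible secrets.\<close>

lemma pe_secure:
  fixes \<G> :: generator
  assumes n: "n \<ge> 1" and k: "k = ceillog2 (n + 1)" and gen: "multilinear_generator \<G> (2 * k + 1)"
    and D: "small_subsets D" and M: "small_subsets M" and list: "listable M" and MSDHS: "MSDHS \<G> (2 * k + 1) n"
  shows "secure (pe_scheme \<G> D M n) (pe_family \<G> D M n)"
  unfolding secure_def
proof (intro ballI allI impI)
  fix f A l
  assume f: "f \<in> pe_family \<G> D M n"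
    and A: "ppt A \<and> stays_in_domain (security_game (pe_scheme \<G> D M n) f A l)"
  have k1: "1 \<le> k" using enc_levels[OF n] by (simp add: k)
  \<comment> \<open>The largest exponent published in the key is 2^(k - 1). As k is least with n <
    2^k, the n powers of the challenge reach that far.\<close>
  have kn: "2 ^ i \<le> n" if "i < k" for i
  proof -
    have "2 ^ Suc i \<le> (2::nat) ^ k" using that by (intro power_increasing) auto
    then show ?thesis using two_power_ceillog2_gt[of "n + 1"] by (simp add: k)
  qed
  obtain F where F: "polytime F" "\<And>\<eta>. F (unary \<eta>) = lst (map Atom (coeffs (f \<eta>)))" and deg: "\<And>\<eta>. degree (f \<eta>) \<le> n"
    using f by (auto simp: pe_family_def)
  obtain Y where Y: "polytime Y" "\<And>q. prime q \<Longrightarrow> \<exists>ys. set ys = M q \<and> Y (Atom (int q)) = lst (map Atom ys)"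
    using list unfolding listable_def by (elim exE conjE) auto
  obtain TY :: "nat poly" where TY: "\<And>x. bits (Y x) \<le> poly TY (bits x)"
    using polytime_pbounded[OF Y(1)] by (auto simp: pbounded_def)
  obtain BD :: "nat poly" where BD: "\<And>q. prime q \<Longrightarrow> D q \<subseteq> {0..<int q} \<and> card (D q) \<le> poly BD (floorlog 2 q)"
    using D by (auto simp: small_subsets_def)
  obtain mul e and B :: "nat poly" where mul: "polytime mul" and e: "polytime e" and sim:
    "\<And>\<eta> p q \<Gamma> Q. \<eta> \<ge> 2 \<Longrightarrow> (p, q, \<Gamma>) \<in> set_pmf (\<G> \<eta> (2 * k + 1)) \<Longrightarrow> 3 + 2 * poly B \<eta> + 2 * \<eta> \<le> poly Q \<eta> \<Longrightarrow>
       simulation \<Gamma> p q (2 * k + 1) mul e (poly B \<eta>) (poly Q \<eta>) \<eta> (2 ^ (3 * \<eta>)) (env Q (unary \<eta>) (enc_mlm \<Gamma>))"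
    using simulation_exists[OF gen] by (metis le_add2)
  \<comment> \<open>Besides exponentiation and transcripts, the clamp must leave room for inversion
    modulo q and for the listing of \<open>M q\<close>, produced from an atom of at most 1 + \<eta>
    bits.\<close>
  define Q where "Q = [:6, 3:] + [:2:] * B + l * ([:1:] + [:3, 2:] + [:k:] * ([:1:] + B)) + [:0, 3 * k:] * l +
      [:2:] * pcompose TY [:1, 1:]"
  have Q: "3 + 2 * poly B \<eta> + 2 * \<eta> \<le> poly Q \<eta>" "6 + 3 * \<eta> \<le> poly Q \<eta>"
    "3 + poly l \<eta> * (1 + (3 + 2 * \<eta> + k * (1 + poly B \<eta>))) + 3 * \<eta> * k * poly l \<eta> \<le> poly Q \<eta>"
    "2 + 2 * poly TY (1 + \<eta>) \<le> poly Q \<eta>" for \<eta>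
    by (simp_all add: Q_def algebra_simps poly_pcompose)
  \<comment> \<open>First the guess: s, the exponent of h, coins, transcript. Then the attack: the
    exponent of h, coins, transcript, final encoding; its secret is the challenge.\<close>
  define J where "J = ([:0, 3:] + ([:0, 3:] + (coins A + [:0, 3 * k:] * l))) +
      ([:0, 3:] + (coins A + ([:0, 3 * k:] * l + [:0, 3 * k:])))"
  define C where "C = \<lparr>prog = security_sim A mul e k n F Y l Q, coins = J, calls = 0\<rparr>"
  have "ppt C"
    using A polytime_security_sim[OF _ mul e F(1) Y(1)] by (simp add: ppt_def C_def)
  define \<delta> where "\<delta> \<eta> = (1 - 1 / 2 ^ \<eta> :: real) ^ (3 + k + 2 * k * poly l \<eta>)" for \<eta>
  have \<delta>: "\<delta> \<eta> \<le> 1" for \<eta>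
    unfolding \<delta>_def by (rule power_le_one) simp_all
  define adv where "adv \<eta> = pmf (MSDHS_game \<G> (2 * k + 1) n C \<eta>) True" for \<eta>
  have adv: "negligible adv"
    using MSDHS \<open>ppt C\<close> unfolding MSDHS_def adv_def by auto
  have bound: "(success (security_game (pe_scheme \<G> D M n) f A l) \<eta>)\<^sup>2 \<le>
      real (poly BD \<eta>) * (adv \<eta> + (4 / 2 ^ \<eta> + (1 - \<delta> \<eta>)))" if \<eta>: "\<eta> \<ge> 2" for \<eta>
  proof -
    define att where "att \<Gamma> q s u = sec_attack A \<eta> k (poly l \<eta>) (pe_pub \<Gamma> k (f \<eta>) s (u [^]\<^bsub>grp \<Gamma> 1\<^esub> (q::nat)))" for \<Gamma> q s u
    define win where "win p q \<Gamma> s u x d = sec_win M k (pe_pub \<Gamma> k (f \<eta>) s (u [^]\<^bsub>grp \<Gamma> 1\<^esub> q)) (pe_sec \<Gamma> p q (f \<eta>) s) (f \<eta>) x d"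
      for p q \<Gamma> s u x d
    define run where "run = (\<lambda>(p, q, \<Gamma>). bind_pmf (pmf_of_set {0..<modulus \<Gamma>}) (\<lambda>s.
        bind_pmf (pmf_of_set (carrier (grp \<Gamma> 1))) (\<lambda>u. map_pmf (\<lambda>(x, d). (x, win p q \<Gamma> s u x d)) (att \<Gamma> q s u))))"
    \<comment> \<open>Two independent runs for the same instance. Of the first only the choice is
      kept; the second has to repeat it and win.\<close>
    define twice where "twice G = bind_pmf (map_pmf fst (run G)) (\<lambda>a. map_pmf (\<lambda>j. snd j \<and> fst j = a) (run G))" for G
    have inst: "mlm_instance \<Gamma> p q (2 * k + 1)" if "(p, q, \<Gamma>) \<in> set_pmf (\<G> \<eta> (2 * k + 1))" for p q \<Gamma>
      using multilinear_generatorD(1)[OF gen \<eta> that] .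
    have dom: "fst r" if "r \<in> set_pmf (security_game (pe_scheme \<G> D M n) f A l \<eta>)" for r
      using A \<eta> that by (auto simp: stays_in_domain_def)
    have key: "map_pmf snd (do {
         \<omega> \<leftarrow> toss A \<eta>;
         h \<leftarrow> history (poly l \<eta>) (\<lambda>h. question (answer A \<eta> \<omega> (lst [pe_enc_pk pk, enc_history h])))
           (\<lambda>x. outcome (pe_encode pk k x)) [];
         let x = int_of (answer A \<eta> \<omega> (lst [pe_enc_pk pk, enc_history h]));
         \<sigma> \<leftarrow> outcome (pe_encode pk k x);
         return_pmf (insert x (fst ` set h) \<subseteq> D (sk_q sk),
           sec_win M k pk sk (f \<eta>) x (sec_forged A \<eta> pk \<omega> h \<sigma>))
       }) = map_pmf (\<lambda>(x, d). sec_win M k pk sk (f \<eta>) x d) (sec_attack A \<eta> k (poly l \<eta>) pk)"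
      "\<And>r. r \<in> set_pmf (sec_attack A \<eta> k (poly l \<eta>) pk) \<Longrightarrow> fst r \<in> D (sk_q sk)"
      if key: "(pk, sk) \<in> set_pmf (pe_keygen \<G> k \<eta> (f \<eta>))" for pk sk
    proof -
      have D': "D (sk_q sk) \<subseteq> {0..<int (modulus (pk_inst pk))}"
        using key domain_subset_modulus[OF D inst] by (fastforce simp: pe_keygen_eq)
      note in_game = dom[unfolded security_game_pe k[symmetric] set_bind_pmf, OF UN_I[OF key],
        unfolded prod.case, folded set_bind_pmf]
      note ideal = security_real_ideal[where W = "sec_win M k pk sk (f \<eta>)" and A = A and \<eta> = \<eta> and k = k
          and m = "poly l \<eta>" and pk = pk and D = "D (sk_q sk)", OF _ D']
      show "map_pmf snd (do {
         \<omega> \<leftarrow> toss A \<eta>;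
         h \<leftarrow> history (poly l \<eta>) (\<lambda>h. question (answer A \<eta> \<omega> (lst [pe_enc_pk pk, enc_history h])))
           (\<lambda>x. outcome (pe_encode pk k x)) [];
         let x = int_of (answer A \<eta> \<omega> (lst [pe_enc_pk pk, enc_history h]));
         \<sigma> \<leftarrow> outcome (pe_encode pk k x);
         return_pmf (insert x (fst ` set h) \<subseteq> D (sk_q sk),
           sec_win M k pk sk (f \<eta>) x (sec_forged A \<eta> pk \<omega> h \<sigma>))
       }) = map_pmf (\<lambda>(x, d). sec_win M k pk sk (f \<eta>) x d) (sec_attack A \<eta> k (poly l \<eta>) pk)"
        by (rule ideal(1)) (rule in_game)
      show "fst r \<in> D (sk_q sk)" if "r \<in> set_pmf (sec_attack A \<eta> k (poly l \<eta>) pk)" for r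
        by (rule ideal(2)[OF _ that]) (rule in_game)
    qed
    have succ: "map_pmf snd (security_game (pe_scheme \<G> D M n) f A l \<eta>) = bind_pmf (\<G> \<eta> (2 * k + 1)) (\<lambda>G. map_pmf snd (run G))"
    proof -
      have "map_pmf snd (security_game (pe_scheme \<G> D M n) f A l \<eta>) = bind_pmf (pe_keygen \<G> k \<eta> (f \<eta>))
          (\<lambda>(pk, sk). map_pmf (\<lambda>(x, d). sec_win M k pk sk (f \<eta>) x d) (sec_attack A \<eta> k (poly l \<eta>) pk))"
        unfolding security_game_pe k[symmetric] map_bind_pmf[of snd "pe_keygen \<G> k \<eta> (f \<eta>)"]
        by (intro bind_pmf_cong refl) (clarsimp simp only: split_paired_all prod.case key(1))
      also have "\<dots> = bind_pmf (\<G> \<eta> (2 * k + 1)) (\<lambda>G. map_pmf snd (run G))"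
        unfolding pe_keygen_eq bind_assoc_pmf run_def
        by (intro bind_pmf_cong refl)
          (auto simp: bind_assoc_pmf bind_return_pmf map_bind_pmf map_pmf_comp case_prod_unfold win_def att_def)
      finally show ?thesis .
    qed
    have per: "(pmf (map_pmf snd (run G)) True)\<^sup>2 \<le> real (poly BD \<eta>) * pmf (twice G) True"
      and msdhs: "pmf (twice G) True \<le> pmf (case G of (p, q, \<Gamma>) \<Rightarrow> bind_pmf (pmf_of_set {0..<modulus \<Gamma>}) (\<lambda>s.
        bind_pmf (toss C \<eta>) (\<lambda>\<omega>. return_pmf (coprime (modulus \<Gamma>) s \<and>
          answer C \<eta> \<omega> (lst [Atom (int p), Atom (int q), enc_mlm \<Gamma>, lst (map (\<lambda>i. gen \<Gamma> 1 [^]\<^bsub>grp \<Gamma> 1\<^esub> (s ^ i)) [0..<Suc n])]) =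
          gen \<Gamma> (2 * k + 1) [^]\<^bsub>grp \<Gamma> (2 * k + 1)\<^esub> (int p * modular_inverse (int (modulus \<Gamma>)) (int s)))))) True +
          (4 / 2 ^ \<eta> + (1 - \<delta> \<eta>))"
      if G: "G \<in> set_pmf (\<G> \<eta> (2 * k + 1))" for G
    proof -
      obtain p q \<Gamma> where G_eq: "G = (p, q, \<Gamma>)" by (cases G)
      note G' = G[unfolded G_eq]
      interpret simulation \<Gamma> p q "2 * k + 1" mul e "poly B \<eta>" "poly Q \<eta>" \<eta> "2 ^ (3 * \<eta>)" "env Q (unary \<eta>) (enc_mlm \<Gamma>)"
        using sim[OF \<eta> G' Q(1)] .
      have fin: "finite (carrier (grp \<Gamma> 1))" "carrier (grp \<Gamma> 1) \<noteq> {}"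
        using order_grp[of 1] N_pos gen_closed[of 1] by (auto simp: Coset.order_def intro: card_ge_0_finite)
      have D': "D q \<subseteq> {0..<int q}" "card (D q) \<le> poly BD \<eta>"
        using BD[OF primes(2)] size by auto
      have finD: "finite (D q)" using D'(1) by (rule finite_subset) simp
      have inD: "fst j \<in> D q" if "j \<in> set_pmf (run G)" for j
      proof -
        obtain s u r where s: "s \<in> set_pmf (pmf_of_set {0..<modulus \<Gamma>})" and u: "u \<in> set_pmf (pmf_of_set (carrier (grp \<Gamma> 1)))"
          and r: "r \<in> set_pmf (att \<Gamma> q s u)" "fst j = fst r"
          using \<open>j \<in> set_pmf (run G)\<close> by (auto simp: run_def G_eq)
        have "(pe_pub \<Gamma> k (f \<eta>) s (u [^]\<^bsub>grp \<Gamma> 1\<^esub> q), pe_sec \<Gamma> p q (f \<eta>) s) \<in> set_pmf (pe_keygen \<G> k \<eta> (f \<eta>))"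
          unfolding pe_keygen_eq set_bind_pmf
          by (rule UN_I[OF G'], unfold prod.case set_bind_pmf, rule UN_I[OF s], rule UN_I[OF u]) simp
        from key(2)[OF this r(1)[unfolded att_def]] show ?thesis by (simp add: r(2))
      qed
      have "(pmf (map_pmf snd (run G)) True)\<^sup>2 \<le> real (card (D q)) * pmf (twice G) True"
        unfolding twice_def by (rule collision[OF finD inD])
      also have "\<dots> \<le> real (poly BD \<eta>) * pmf (twice G) True"
        using D'(2) by (intro mult_right_mono) auto
      finally show "(pmf (map_pmf snd (run G)) True)\<^sup>2 \<le> real (poly BD \<eta>) * pmf (twice G) True" .
      define ch where "ch = bind_pmf (pmf_of_set {0..<modulus \<Gamma>}) (\<lambda>s. bind_pmf (pmf_of_set (carrier (grp \<Gamma> 1))) (\<lambda>u.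
        sec_choice A \<eta> k (poly l \<eta>) (pe_pub \<Gamma> k (f \<eta>) s (u [^]\<^bsub>grp \<Gamma> 1\<^esub> q))))"
      have ch: "map_pmf fst (run G) = ch"
        by (simp add: run_def G_eq ch_def map_bind_pmf map_pmf_comp case_prod_unfold att_def map_fst_sec_attack)
      define hit where "hit a s = bind_pmf (pmf_of_set (carrier (grp \<Gamma> 1))) (\<lambda>u.
        map_pmf (\<lambda>(x, d). win p q \<Gamma> s u x d \<and> x = a) (att \<Gamma> q s u))" for a s
      \<comment> \<open>The guess is independent of the second secret, so for each a replacing s by
        s + a preserves uniformity. The unshifted s can then play the challenge.\<close>
      have shift: "map_pmf (\<lambda>s. nat ((int s + a) mod int N)) (pmf_of_set {0..<N}) = pmf_of_set {0..<N}" for a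
      proof (rule map_pmf_of_set_bij_betw)
        show "bij_betw (\<lambda>s. nat ((int s + a) mod int N)) {0..<N} {0..<N}"
        proof (rule bij_betw_byWitness[where f' = "\<lambda>s. nat ((int s - a) mod int N)"])
          show "\<forall>s\<in>{0..<N}. nat ((int (nat ((int s + a) mod int N)) - a) mod int N) = s"
            "\<forall>s\<in>{0..<N}. nat ((int (nat ((int s - a) mod int N)) + a) mod int N) = s"
            using N_pos by (simp_all add: mod_diff_left_eq mod_add_left_eq)
        qed (use N_pos in \<open>auto simp: nat_less_iff\<close>)
      qed (use N_pos in auto)
      have "twice G = bind_pmf ch (\<lambda>a. bind_pmf (pmf_of_set {0..<N}) (hit a))"
        unfolding twice_def ch
        by (simp add: run_def G_eq map_bind_pmf map_pmf_comp case_prod_unfold hit_def[abs_def] modulus_eq)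
      also have "\<dots> = bind_pmf ch (\<lambda>a. bind_pmf (pmf_of_set {0..<N}) (\<lambda>s. hit a (nat ((int s + a) mod int N))))"
      proof (rule arg_cong[where f = "bind_pmf ch"], rule ext)
        fix a
        show "bind_pmf (pmf_of_set {0..<N}) (hit a) =
            bind_pmf (pmf_of_set {0..<N}) (\<lambda>s. hit a (nat ((int s + a) mod int N)))"
          using arg_cong[OF shift[of a], of "\<lambda>U. bind_pmf U (hit a)"] unfolding bind_map_pmf by (rule sym)
      qed
      \<comment> \<open>The MSDHS game fixes its secret first, so this draw is moved in front of the
        guess.\<close>
      also have "\<dots> = bind_pmf (pmf_of_set {0..<N}) (\<lambda>s. bind_pmf ch (\<lambda>a. hit a (nat ((int s + a) mod int N))))"
        by (rule bind_commute_pmf)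
      finally have twice: "twice G = bind_pmf (pmf_of_set {0..<N}) (\<lambda>s. bind_pmf ch (\<lambda>a. hit a (nat ((int s + a) mod int N))))" .
      obtain ys where ys: "set ys = M q" "Y (Atom (int q)) = lst (map Atom ys)"
        using Y(2)[OF primes(2)] by blast
      have bits_ys: "2 + 2 * bits (lst (map Atom ys)) \<le> poly Q \<eta>"
      proof -
        have "bits (Atom (int q)) \<le> 1 + \<eta>"
          using int_q_less by (intro bits_Atom_le) auto
        then have "poly TY (bits (Atom (int q))) \<le> poly TY (1 + \<eta>)"
          by (rule poly_nat_mono)
        then have "bits (lst (map Atom ys)) \<le> poly TY (1 + \<eta>)"
          using TY[of "Atom (int q)"] unfolding ys(2) by linarith
        then show ?thesis using Q(4)[of \<eta>] by linarith
      qed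
      have Mq: "M q \<subseteq> {0..<int q}"
        using M primes(2) by (auto simp: small_subsets_def)
      have "toss C \<eta> = uniform ((2 ^ (3 * \<eta>) * (2 ^ (3 * \<eta>) * (2 ^ poly (coins A) \<eta> * ((2 ^ (3 * \<eta>)) ^ k) ^ poly l \<eta>))) *
          (2 ^ (3 * \<eta>) * (2 ^ poly (coins A) \<eta> * (((2 ^ (3 * \<eta>)) ^ k) ^ poly l \<eta> * (2 ^ (3 * \<eta>)) ^ k))))"
      proof -
        have "poly (coins C) \<eta> = (3 * \<eta> + (3 * \<eta> + (poly (coins A) \<eta> + 3 * \<eta> * k * poly l \<eta>))) +
            (3 * \<eta> + (poly (coins A) \<eta> + (3 * \<eta> * k * poly l \<eta> + 3 * \<eta> * k)))"
          by (simp add: C_def J_def algebra_simps)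
        then show ?thesis
          by (simp only: toss_uniform power_add power_mult)
      qed
      note tossC = this
      have Q3: "3 + poly l \<eta> * (1 + entry_bound k) + 3 * \<eta> * k * poly l \<eta> \<le> poly Q \<eta>"
        unfolding entry_bound_def by (rule Q(3))
      have progC: "prog C = security_sim A mul e k n F Y l Q" by (simp add: C_def)
      have "pmf (twice G) True \<le> pmf (bind_pmf (pmf_of_set {0..<N}) (\<lambda>s.
        bind_pmf (toss C \<eta>) (\<lambda>\<omega>. return_pmf (coprime (modulus \<Gamma>) s \<and>
          answer C \<eta> \<omega> (lst [Atom (int p), Atom (int q), enc_mlm \<Gamma>, lst (map (\<lambda>i. gen \<Gamma> 1 [^]\<^bsub>grp \<Gamma> 1\<^esub> (s ^ i)) [0..<Suc n])]) =
          gen \<Gamma> (2 * k + 1) [^]\<^bsub>grp \<Gamma> (2 * k + 1)\<^esub> (int p * modular_inverse (int (modulus \<Gamma>)) (int s)))))) True +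
          (measure_pmf.prob (pmf_of_set {0..<N}) {r. \<not> coprime N r} + (1 - \<delta> \<eta>))"
        unfolding twice
      proof (rule pmf_bind_mono)
        fix s assume "s \<notin> {r. \<not> coprime N r}"
        then have s: "coprime N s" by simp
        show "pmf (bind_pmf ch (\<lambda>a. hit a (nat ((int s + a) mod int N)))) True \<le>
            pmf (bind_pmf (toss C \<eta>) (\<lambda>\<omega>. return_pmf (coprime (modulus \<Gamma>) s \<and>
          answer C \<eta> \<omega> (lst [Atom (int p), Atom (int q), enc_mlm \<Gamma>, lst (map (\<lambda>i. gen \<Gamma> 1 [^]\<^bsub>grp \<Gamma> 1\<^esub> (s ^ i)) [0..<Suc n])]) =
          gen \<Gamma> (2 * k + 1) [^]\<^bsub>grp \<Gamma> (2 * k + 1)\<^esub> (int p * modular_inverse (int (modulus \<Gamma>)) (int s))))) True + (1 - \<delta> \<eta>)"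
          unfolding hit_def win_def att_def ch_def \<delta>_def
          by (rule security_bound[where k = k and m = "poly l \<eta>" and n = n and f = "f \<eta>" and A = A and C = C and F = F
                and Y = Y and Q = Q and l = l and ys = ys and M = M and s' = s, OF k1 refl kn deg refl refl F(2) ys(2) ys(1) Mq Q3 bits_ys Q(2) progC tossC s])
      qed (use \<delta>[of \<eta>] in simp)
      also have "\<dots> \<le> pmf (bind_pmf (pmf_of_set {0..<N}) (\<lambda>s.
        bind_pmf (toss C \<eta>) (\<lambda>\<omega>. return_pmf (coprime (modulus \<Gamma>) s \<and>
          answer C \<eta> \<omega> (lst [Atom (int p), Atom (int q), enc_mlm \<Gamma>, lst (map (\<lambda>i. gen \<Gamma> 1 [^]\<^bsub>grp \<Gamma> 1\<^esub> (s ^ i)) [0..<Suc n])]) =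
          gen \<Gamma> (2 * k + 1) [^]\<^bsub>grp \<Gamma> (2 * k + 1)\<^esub> (int p * modular_inverse (int (modulus \<Gamma>)) (int s)))))) True + (4 / 2 ^ \<eta> + (1 - \<delta> \<eta>))"
        using prob_not_coprime by (intro add_left_mono add_right_mono)
      finally show "pmf (twice G) True \<le> pmf (case G of (p, q, \<Gamma>) \<Rightarrow> bind_pmf (pmf_of_set {0..<modulus \<Gamma>}) (\<lambda>s.
        bind_pmf (toss C \<eta>) (\<lambda>\<omega>. return_pmf (coprime (modulus \<Gamma>) s \<and>
          answer C \<eta> \<omega> (lst [Atom (int p), Atom (int q), enc_mlm \<Gamma>, lst (map (\<lambda>i. gen \<Gamma> 1 [^]\<^bsub>grp \<Gamma> 1\<^esub> (s ^ i)) [0..<Suc n])]) =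
          gen \<Gamma> (2 * k + 1) [^]\<^bsub>grp \<Gamma> (2 * k + 1)\<^esub> (int p * modular_inverse (int (modulus \<Gamma>)) (int s)))))) True +
          (4 / 2 ^ \<eta> + (1 - \<delta> \<eta>))"
        unfolding G_eq prod.case by (simp only: modulus_eq)
    qed
    have "(success (security_game (pe_scheme \<G> D M n) f A l) \<eta>)\<^sup>2 \<le>
        measure_pmf.expectation (\<G> \<eta> (2 * k + 1)) (\<lambda>G. (pmf (map_pmf snd (run G)) True)\<^sup>2)"
      unfolding success_def succ by (rule pmf_bind_square)
    also have "\<dots> \<le> measure_pmf.expectation (\<G> \<eta> (2 * k + 1)) (\<lambda>G. real (poly BD \<eta>) * pmf (twice G) True)"
    proof (rule integral_mono_AE)
      show "integrable (\<G> \<eta> (2 * k + 1)) (\<lambda>G. (pmf (map_pmf snd (run G)) True)\<^sup>2)"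
        by (intro measure_pmf.integrable_const_bound[where B = 1]) (auto simp: pmf_le_1 power_le_one)
      show "integrable (\<G> \<eta> (2 * k + 1)) (\<lambda>G. real (poly BD \<eta>) * pmf (twice G) True)"
        by (intro integrable_mult_right measure_pmf.integrable_const_bound[where B = 1]) (auto simp: pmf_le_1)
      show "AE G in \<G> \<eta> (2 * k + 1). (pmf (map_pmf snd (run G)) True)\<^sup>2 \<le> real (poly BD \<eta>) * pmf (twice G) True"
        by (intro AE_pmfI per)
    qed
    also have "\<dots> = real (poly BD \<eta>) * pmf (bind_pmf (\<G> \<eta> (2 * k + 1)) twice) True"
      unfolding pmf_bind by (rule integral_mult_right_zero)
    finally have square: "(success (security_game (pe_scheme \<G> D M n) f A l) \<eta>)\<^sup>2 \<le>
        real (poly BD \<eta>) * pmf (bind_pmf (\<G> \<eta> (2 * k + 1)) twice) True" .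
    have "pmf (bind_pmf (\<G> \<eta> (2 * k + 1)) twice) True \<le> adv \<eta> +
        (measure_pmf.prob (\<G> \<eta> (2 * k + 1)) {} + (4 / 2 ^ \<eta> + (1 - \<delta> \<eta>)))"
      unfolding adv_def MSDHS_game_def Let_def
    proof (rule pmf_bind_mono)
      show "0 \<le> 4 / 2 ^ \<eta> + (1 - \<delta> \<eta>)" using \<delta>[of \<eta>] by simp
    qed (rule msdhs)
    then have "pmf (bind_pmf (\<G> \<eta> (2 * k + 1)) twice) True \<le> adv \<eta> + (4 / 2 ^ \<eta> + (1 - \<delta> \<eta>))"
      by simp
    then have "real (poly BD \<eta>) * pmf (bind_pmf (\<G> \<eta> (2 * k + 1)) twice) True \<le>
        real (poly BD \<eta>) * (adv \<eta> + (4 / 2 ^ \<eta> + (1 - \<delta> \<eta>)))"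
      by (rule mult_left_mono) simp
    with square show ?thesis
      by (rule order_trans)
  qed
  have "negligible (\<lambda>\<eta>. real (poly BD \<eta>) * (adv \<eta> + (4 / 2 ^ \<eta> + (1 - \<delta> \<eta>))))"
  proof (intro negligible_poly_mult negligible_add adv)
    show "negligible (\<lambda>\<eta>. 4 / 2 ^ \<eta>)"
      using negligible_poly_mult[OF negligible_inverse_power2, of "[:4:]"] by simp
    have J': "\<bar>1 - \<delta> \<eta>\<bar> \<le> real (poly ([:3 + k:] + [:2 * k:] * l) \<eta>) * (1 / 2 ^ \<eta>)" for \<eta>
    proof -
      define c where "c = real (3 + k + 2 * k * poly l \<eta>) * (1 / 2 ^ \<eta>)"
      have "1 - c \<le> \<delta> \<eta>"
        unfolding \<delta>_def c_def by (rule bernoulli_power) auto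
      then have "\<bar>1 - \<delta> \<eta>\<bar> \<le> c"
        using \<delta>[of \<eta>] by simp
      also have "c = real (poly ([:3 + k:] + [:2 * k:] * l) \<eta>) * (1 / 2 ^ \<eta>)"
        unfolding c_def by (simp add: algebra_simps)
      finally show ?thesis .
    qed
    show "negligible (\<lambda>\<eta>. 1 - \<delta> \<eta>)"
      by (rule negligible_mono[OF negligible_poly_mult[OF negligible_inverse_power2]
            always_eventually[OF allI[OF order_trans[OF J' abs_ge_self]]]])
  qed
  note sqrt = negligible_sqrt[OF this]
  show "negligible (success (security_game (pe_scheme \<G> D M n) f A l))"
  proof (rule negligible_mono[OF sqrt])
    \<comment> \<open>The bound on the square is available for \<eta> \<ge> 2, which suffices
      eventually.\<close>
    have "\<bar>success (security_game (pe_scheme \<G> D M n) f A l) \<eta>\<bar> \<le>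
        \<bar>sqrt (real (poly BD \<eta>) * (adv \<eta> + (4 / 2 ^ \<eta> + (1 - \<delta> \<eta>))))\<bar>" if "\<eta> \<ge> 2" for \<eta>
    proof -
      have "0 \<le> success (security_game (pe_scheme \<G> D M n) f A l) \<eta>"
        by (simp add: success_def)
      then show ?thesis
        using real_le_rsqrt[OF bound[OF that]] by linarith
    qed
    then show "\<forall>\<^sub>F \<eta> in sequentially. \<bar>success (security_game (pe_scheme \<G> D M n) f A l) \<eta>\<bar> \<le>
        \<bar>sqrt (real (poly BD \<eta>) * (adv \<eta> + (4 / 2 ^ \<eta> + (1 - \<delta> \<eta>))))\<bar>"
      unfolding eventually_sequentially by (intro exI[of _ 2] allI impI)
  qed
qed

theorem theorem3p1:
  fixes \<G> :: generator and D M :: "nat \<Rightarrow> int set" and n k :: nat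
  assumes "n \<ge> 1" and "k = nat \<lceil>log 2 (real n + 1)\<rceil>"
    and "multilinear_generator \<G> (2 * k + 1)"
    and "small_subsets D" and "small_subsets M" and "listable M"
    and "MSDHS \<G> (2 * k + 1) n"
    and "SDA \<G> (2 * k + 1)"
  shows "correct (pe_scheme \<G> D M n) (pe_family \<G> D M n) \<and>
    secure (pe_scheme \<G> D M n) (pe_family \<G> D M n) \<and>
    input_private (pe_scheme \<G> D M n) (pe_family \<G> D M n) \<and>
    outsourced (pe_scheme \<G> D M) (pe_family \<G> D M)"
proof -
  have k: "k = ceillog2 (n + 1)"
    using assms(2) by (simp add: ceillog2_def add.commute)
  show ?thesis
    using pe_correct[OF assms(1) assms(3)[unfolded k] assms(5)]
      pe_secure[OF assms(1) k assms(3-7)] pe_private[OF assms(1) k assms(3,4,8)] pe_outsourced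
    by blast
qed

end
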